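(* Let $\Bbbk$ be a field. For all disjoint finite nonempty ordinals $I,J$ and every $i\in I$, let $\circ_{I,i}^J\colon\mathcal B(I)\times\mathcal B(J)\to\mathcal B(I\sqcup_i J)$ be the maps defined in the context on brick manifolds over $\Bbbk$. These maps make the nonsymmetric collection $\mathcal B$ into a nonsymmetric operad in the category of algebraic varieties.
   Context: Finite ordinals are finite totally ordered sets. For $i$ in a finite ordinal $I$, $p(i)$ and $s(i)$ denote the immediate predecessor and successor (if they exist). $\mathrm{Gap}(I)=\{(p(i),i): i\in I, i\ne\min I\}$. $G(I)$ is the $\Bbbk$-vector space with basis $e_{u,v}$, $(u,v)\in\mathrm{Gap}(I)$. For an interval $[a,b]\subset I$, $G(a,b):=G([a,b])\subset G(I)$ is spanned by the basis vectors indexed by gaps of $[a,b]$ (so $G(a,a)=0$). Brick manifold: a point of $\mathcal B(I)$ is a collection of subspaces $V_{i,j}\subset G(I)$, one for every proper nonempty interval $[i,j]\subsetneq I$, with $\dim V_{i,j}=\#[i,j]$; $V_{i,j}\subset V_{p(i),j}$ whenever $\min(I)<i$ and $[p(i),j]$ is proper; $V_{i,j}\subset V_{i,s(j)}$ whenever $j<\max(I)$ and $[i,s(j)]$ is proper; $V_{\min(I),j}=G(\min(I),s(j))$; $V_{i,\max(I)}=G(p(i),\max(I))$. It is an algebraic variety (a closed subvariety of a product of Grassmannians). For disjoint ordinals $I,J$ and $i\in I$, $I\sqcup_i J$ is the set $(I\setminus\{i\})\sqcup J$ ordered by inserting $J$ in place of $i$. Let $f=f_{I,i}^J\colon G(I)\oplus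 G(J)\to G(I\sqcup_iJ)$ be the linear isomorphism sending $e_{p(i),i}\mapsto e_{p(i),\min J}$, $e_{i,s(i)}\mapsto e_{\max J,s(i)}$ (when these exist) and every other basis vector to the basis vector with the same indices. For $V^1\in\mathcal B(I)$, $V^2\in\mathcal B(J)$, the collection $V^1\circ_{I,i}^JV^2$ is given, for proper intervals $[a,b]$ of $I\sqcup_iJ$, by - $f(V^1_{a,b})$ if $a,b\in I$, $a\le b<i$ or $i<a\le b$; - $f(V^2_{a,b})$ if $a\le b$ in $J$, $(a,b)\ne(\min J,\max J)$; - $f(V^1_{a,p(i)}\oplus G(\min J,s(b)))$ if $a\in I$, $a<i$, $b\in J$, $b<\max J$; - $f(V^1_{s(i),b}\oplus G(p(a),\max J))$ if $a\in J$, $a>\min J$, $b\in I$, $i<b$; - $f(V^1_{i,i}\oplus G(J))$ if $(a,b)=(\min J,\max J)$; - $f(V^1_{a,i}\oplus G(J))$ if $a\in I$, $a<i$, $b=\max J$; - $f(V^1_{i,b}\oplus G(J))$ if $b\in I$, $b>i$, $a=\min J$; - $f(V^1_{a,b}\oplus G(J))$ if $a,b\in I$, $a<i<b$. A nonsymmetric operad is given by such partial (infinitesimal) compositions, functorial in order-preserving bijections, satisfying the usual parallel and sequential axioms and having a unit in arity one. *)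

theory Defs
  imports
    Complex_Main
    "HOL-Library.FuncSet"
    "HOL-Library.Function_Algebras"
    "HOL-Library.Poly_Mapping"
begin

section \<open>Coordinate vector spaces\<close>

definition fscale :: "'a::field \<Rightarrow> ('s \<Rightarrow> 'a) \<Rightarrow> ('s \<Rightarrow> 'a)" where
  "fscale c v = (\<lambda>s. c * v s)"

global_interpretation fvs: vector_space "fscale :: 'a::field \<Rightarrow> ('s \<Rightarrow> 'a) \<Rightarrow> ('s \<Rightarrow> 'a)"
  by unfold_locales (auto simp: fscale_def fun_eq_iff algebra_simps)

text \<open>The vector space with basis \<open>(basis_vec s)\<close>, \<open>s \<in> S\<close>; only used for finite \<open>S\<close>.\<close>

definition coord_space :: "'s set \<Rightarrow> ('s \<Rightarrow> 'a::zero) set" where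
  "coord_space S = {v. \<forall>s. s \<notin> S \<longrightarrow> v s = 0}"

definition basis_vec :: "'s \<Rightarrow> ('s \<Rightarrow> 'a::zero_neq_one)" where
  "basis_vec s = (\<lambda>t. if t = s then 1 else 0)"

definition grassmannian :: "'s set \<Rightarrow> nat \<Rightarrow> ('s \<Rightarrow> 'a::field) set set" where
  "grassmannian S d = {V. fvs.subspace V \<and> V \<subseteq> coord_space S \<and> fvs.dim V = d}"


section \<open>Algebraic varieties\<close>

text \<open>
  A variety over a field \<open>k\<close> is described by its points with coordinates in an extension field
  of \<open>k\<close>. The extension is the type \<open>'a\<close>, and \<open>k\<close> is a subfield of it; all equations and all
  regular functions have coefficients in \<open>k\<close>. For \<open>k = UNIV\<close> these are the \<open>k\<close>-rational points.
  When \<open>'a\<close> is algebraically closed one gets the usual category of (reduced, separated, not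
  necessarily irreducible) varieties over the arbitrary field \<open>k\<close>.
\<close>

definition is_subfield :: "'a::field set \<Rightarrow> bool" where
  "is_subfield k \<longleftrightarrow> 0 \<in> k \<and> 1 \<in> k \<and>
     (\<forall>x\<in>k. \<forall>y\<in>k. x + y \<in> k \<and> x * y \<in> k) \<and> (\<forall>x\<in>k. - x \<in> k \<and> inverse x \<in> k)"

text \<open>Polynomials in variables from \<open>'c\<close>: finitely supported functions on monomials
  \<open>'c \<Rightarrow>\<^sub>0 nat\<close>.\<close>

type_synonym ('c, 'a) mpoly = "('c \<Rightarrow>\<^sub>0 nat) \<Rightarrow>\<^sub>0 'a"

definition mpoly_eval :: "('c, 'a::field) mpoly \<Rightarrow> ('c \<Rightarrow> 'a) \<Rightarrow> 'a" where
  "mpoly_eval p x = (\<Sum>m\<in>Poly_Mapping.keys p.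
     Poly_Mapping.lookup p m * (\<Prod>c\<in>Poly_Mapping.keys m. x c ^ Poly_Mapping.lookup m c))"

definition polys_over :: "'a::field set \<Rightarrow> ('c, 'a) mpoly set" where
  "polys_over k = {p. \<forall>m. Poly_Mapping.lookup p m \<in> k}"

definition affine_closed :: "'a::field set \<Rightarrow> 'c set \<Rightarrow> ('c \<Rightarrow> 'a) set \<Rightarrow> bool" where
  "affine_closed k N Z \<longleftrightarrow>
     (\<exists>F \<subseteq> polys_over k. Z = {x \<in> coord_space N. \<forall>p\<in>F. mpoly_eval p x = 0})"

text \<open>An affine chart: its domain, the set of its coordinate indices, and the coordinate map,
  which takes values in \<open>coord_space\<close> of the index set.\<close>

datatype ('p, 'c, 'a) chart =
  Chart (cdom: "'p set") (cvars: "'c set") (ccoord: "'p \<Rightarrow> 'c \<Rightarrow> 'a")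

datatype ('p, 'c, 'a) variety =
  Variety (points: "'p set") (atlas: "('p, 'c, 'a) chart set")

text \<open>Near \<open>x\<close>, namely on a principal open subset of the chart \<open>C\<close>, the map \<open>\<phi>\<close> takes values in
  the chart \<open>D\<close> and its coordinates are rational functions with a common denominator.\<close>

definition regular_at ::
  "'a::field set \<Rightarrow> ('p, 'c, 'a) chart \<Rightarrow> ('q, 'd, 'a) chart \<Rightarrow> ('p \<Rightarrow> 'q) \<Rightarrow> 'p \<Rightarrow> bool" where
  "regular_at k C D \<phi> x \<longleftrightarrow> x \<in> cdom C \<and>
     (\<exists>q\<in>polys_over k. \<exists>p. (\<forall>j. p j \<in> polys_over k) \<and> mpoly_eval q (ccoord C x) \<noteq> 0 \<and>
        (\<forall>y\<in>cdom C. mpoly_eval q (ccoord C y) \<noteq> 0 \<longrightarrow>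
           \<phi> y \<in> cdom D \<and>
           (\<forall>j\<in>cvars D. ccoord D (\<phi> y) j =
              mpoly_eval (p j) (ccoord C y) / mpoly_eval q (ccoord C y))))"

text \<open>The third condition says that chart domains meet in open sets and that changes of
  coordinates are regular; the last one, that the diagonal is closed.\<close>

definition is_variety :: "'a::field set \<Rightarrow> ('p, 'c, 'a) variety \<Rightarrow> bool" where
  "is_variety k X \<longleftrightarrow>
     finite (atlas X) \<and> points X = (\<Union>C\<in>atlas X. cdom C) \<and>
     (\<forall>C\<in>atlas X. finite (cvars C) \<and> inj_on (ccoord C) (cdom C) \<and>
        affine_closed k (cvars C) (ccoord C ` cdom C)) \<and>
     (\<forall>C\<in>atlas X. \<forall>D\<in>atlas X. \<forall>x \<in> cdom C \<inter> cdom D. regular_at k C D (\<lambda>y. y) x) \<and>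
     (\<forall>C\<in>atlas X. \<forall>D\<in>atlas X. affine_closed k (cvars C <+> cvars D)
        ((\<lambda>x. case_sum (ccoord C x) (ccoord D x)) ` (cdom C \<inter> cdom D)))"

definition morphism ::
  "'a::field set \<Rightarrow> ('p, 'c, 'a) variety \<Rightarrow> ('q, 'd, 'a) variety \<Rightarrow> ('p \<Rightarrow> 'q) \<Rightarrow> bool" where
  "morphism k X Y \<phi> \<longleftrightarrow> \<phi> \<in> points X \<rightarrow> points Y \<and>
     (\<forall>x\<in>points X. \<exists>C\<in>atlas X. \<exists>D\<in>atlas Y. regular_at k C D \<phi> x)"

definition point_variety :: "(unit, unit, 'a::field) variety" where
  "point_variety = Variety UNIV {Chart UNIV {} (\<lambda>_ _. 0)}"

definition prod_chart ::
  "('p, 'c, 'a) chart \<Rightarrow> ('q, 'd, 'a) chart \<Rightarrow> ('p \<times> 'q, 'c + 'd, 'a) chart" where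
  "prod_chart C D = Chart (cdom C \<times> cdom D) (cvars C <+> cvars D)
     (\<lambda>(x, y). case_sum (ccoord C x) (ccoord D y))"

definition prod_variety ::
  "('p, 'c, 'a) variety \<Rightarrow> ('q, 'd, 'a) variety \<Rightarrow> ('p \<times> 'q, 'c + 'd, 'a) variety" where
  "prod_variety X Y = Variety (points X \<times> points Y)
     {prod_chart C D | C D. C \<in> atlas X \<and> D \<in> atlas Y}"

text \<open>The induced structure on a subset \<open>Z\<close>; it is a variety when \<open>Z\<close> is Zariski closed.\<close>

definition subvariety :: "('p, 'c, 'a) variety \<Rightarrow> 'p set \<Rightarrow> ('p, 'c, 'a) variety" where
  "subvariety X Z = Variety Z ((\<lambda>C. Chart (cdom C \<inter> Z) (cvars C) (ccoord C)) ` atlas X)"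

text \<open>
  The product of the Grassmannians \<open>Gr(d \<alpha>, coord_space (S \<alpha>))\<close>, \<open>\<alpha> \<in> A\<close>, with its standard
  charts. A chart is given by \<open>d \<alpha>\<close>-element subsets \<open>T \<alpha>\<close> of \<open>S \<alpha>\<close> and consists of the families
  with each \<open>V \<alpha>\<close> complementary to \<open>coord_space (S \<alpha> - T \<alpha>)\<close>. Then \<open>V \<alpha>\<close> has a unique basis
  \<open>(v\<^sub>t)\<close>, \<open>t \<in> T \<alpha>\<close>, projecting to the standard basis of \<open>coord_space (T \<alpha>)\<close>, and the
  coordinates are the other entries of these basis vectors.
\<close>

definition graph_vec :: "('s \<Rightarrow> 'a::field) set \<Rightarrow> 's set \<Rightarrow> 's \<Rightarrow> ('s \<Rightarrow> 'a)" where
  "graph_vec V T t = (THE v. v \<in> V \<and> (\<forall>t'\<in>T. v t' = basis_vec t t'))"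

definition grassmannian_chart ::
  "'n set \<Rightarrow> ('n \<Rightarrow> 's set) \<Rightarrow> ('n \<Rightarrow> nat) \<Rightarrow> ('n \<Rightarrow> 's set) \<Rightarrow>
     ('n \<Rightarrow> ('s \<Rightarrow> 'a::field) set, 'n \<times> 's \<times> 's, 'a) chart" where
  "grassmannian_chart A S d T =
     (let N = {(\<alpha>, t, s). \<alpha> \<in> A \<and> t \<in> T \<alpha> \<and> s \<in> S \<alpha> - T \<alpha>} in
      Chart
        {V \<in> \<Pi>\<^sub>E \<alpha>\<in>A. grassmannian (S \<alpha>) (d \<alpha>).
           \<forall>\<alpha>\<in>A. V \<alpha> \<inter> coord_space (S \<alpha> - T \<alpha>) = {0}}
        N
        (\<lambda>V (\<alpha>, t, s). if (\<alpha>, t, s) \<in> N then graph_vec (V \<alpha>) (T \<alpha>) t s else 0))"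

definition grassmannian_product ::
  "'n set \<Rightarrow> ('n \<Rightarrow> 's set) \<Rightarrow> ('n \<Rightarrow> nat) \<Rightarrow>
     ('n \<Rightarrow> ('s \<Rightarrow> 'a::field) set, 'n \<times> 's \<times> 's, 'a) variety" where
  "grassmannian_product A S d = Variety (\<Pi>\<^sub>E \<alpha>\<in>A. grassmannian (S \<alpha>) (d \<alpha>))
     (grassmannian_chart A S d ` (\<Pi>\<^sub>E \<alpha>\<in>A. {t. t \<subseteq> S \<alpha> \<and> card t = d \<alpha>}))"


section \<open>Finite ordinals\<close>

text \<open>A finite totally ordered set is represented by its reflexive order relation, whose
  \<open>Field\<close> is the underlying set.\<close>

definition finite_ordinal :: "'i rel \<Rightarrow> bool" where
  "finite_ordinal I \<longleftrightarrow> Linear_order I \<and> finite (Field I) \<and> Field I \<noteq> {}"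

definition ord_iso :: "'i rel \<Rightarrow> 'i rel \<Rightarrow> ('i \<Rightarrow> 'i) \<Rightarrow> bool" where
  "ord_iso I I' \<phi> \<longleftrightarrow> bij_betw \<phi> (Field I) (Field I') \<and>
     (\<forall>x\<in>Field I. \<forall>y\<in>Field I. (x, y) \<in> I \<longleftrightarrow> (\<phi> x, \<phi> y) \<in> I')"

definition ord_lt :: "'i rel \<Rightarrow> 'i \<Rightarrow> 'i \<Rightarrow> bool" where
  "ord_lt I x y \<longleftrightarrow> (x, y) \<in> I \<and> x \<noteq> y"

definition ord_min :: "'i rel \<Rightarrow> 'i" where
  "ord_min I = (THE m. m \<in> Field I \<and> (\<forall>x\<in>Field I. (m, x) \<in> I))"

definition ord_max :: "'i rel \<Rightarrow> 'i" where
  "ord_max I = (THE m. m \<in> Field I \<and> (\<forall>x\<in>Field I. (x, m) \<in> I))"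

definition Gap :: "'i rel \<Rightarrow> ('i \<times> 'i) set" where
  "Gap I = {(u, v). ord_lt I u v \<and> \<not> (\<exists>w. ord_lt I u w \<and> ord_lt I w v)}"

definition ord_pred :: "'i rel \<Rightarrow> 'i \<Rightarrow> 'i" where
  "ord_pred I i = (THE u. (u, i) \<in> Gap I)"

definition ord_succ :: "'i rel \<Rightarrow> 'i \<Rightarrow> 'i" where
  "ord_succ I i = (THE v. (i, v) \<in> Gap I)"

definition ord_interval :: "'i rel \<Rightarrow> 'i \<Rightarrow> 'i \<Rightarrow> 'i set" where
  "ord_interval I a b = {x. (a, x) \<in> I \<and> (x, b) \<in> I}"

text \<open>End points of the proper nonempty intervals.\<close>

definition proper_intervals :: "'i rel \<Rightarrow> ('i \<times> 'i) set" where
  "proper_intervals I = {(a, b). (a, b) \<in> I \<and> ord_interval I a b \<noteq> Field I}"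

text \<open>The ordinal obtained from \<open>I\<close> by replacing \<open>i\<close> with \<open>J\<close>, for \<open>J\<close> disjoint from \<open>I\<close>.\<close>

definition ord_insert :: "'i rel \<Rightarrow> 'i \<Rightarrow> 'i rel \<Rightarrow> 'i rel" where
  "ord_insert I i J =
     {(x, y). (x, y) \<in> I \<and> x \<noteq> i \<and> y \<noteq> i} \<union> J \<union>
     {(x, y). ord_lt I x i \<and> y \<in> Field J} \<union>
     {(x, y). x \<in> Field J \<and> ord_lt I i y}"


section \<open>Nonsymmetric operads in the category of varieties\<close>

text \<open>
  The operad is indexed by the finite nonempty ordinals with elements in \<open>'i\<close>: \<open>P I\<close> is the
  component, \<open>act I I' \<phi>\<close> the action of an order-preserving bijection, \<open>cmp I i J\<close> the partial
  composition and \<open>unt i\<close> the unit in the component of the one-element ordinal \<open>{i}\<close>, whose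
  order relation is \<open>{(i, i)}\<close>.
\<close>

locale ns_operad_of_varieties =
  fixes k :: "'a::field set"
    and P :: "'i rel \<Rightarrow> ('p, 'c, 'a) variety"
    and act :: "'i rel \<Rightarrow> 'i rel \<Rightarrow> ('i \<Rightarrow> 'i) \<Rightarrow> 'p \<Rightarrow> 'p"
    and cmp :: "'i rel \<Rightarrow> 'i \<Rightarrow> 'i rel \<Rightarrow> 'p \<Rightarrow> 'p \<Rightarrow> 'p"
    and unt :: "'i \<Rightarrow> 'p"
  assumes component_variety:
      "finite_ordinal I \<Longrightarrow> is_variety k (P I)"
    and act_morphism:
      "\<lbrakk>finite_ordinal I; finite_ordinal I'; ord_iso I I' \<phi>\<rbrakk>
        \<Longrightarrow> morphism k (P I) (P I') (act I I' \<phi>)"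
    and act_cong:
      "\<lbrakk>finite_ordinal I; finite_ordinal I'; ord_iso I I' \<phi>; \<forall>j\<in>Field I. \<psi> j = \<phi> j;
        x \<in> points (P I)\<rbrakk>
        \<Longrightarrow> act I I' \<psi> x = act I I' \<phi> x"
    and act_id:
      "\<lbrakk>finite_ordinal I; x \<in> points (P I)\<rbrakk> \<Longrightarrow> act I I (\<lambda>j. j) x = x"
    and act_comp:
      "\<lbrakk>finite_ordinal I; finite_ordinal I'; finite_ordinal I''; ord_iso I I' \<phi>; ord_iso I' I'' \<psi>;
        x \<in> points (P I)\<rbrakk>
        \<Longrightarrow> act I I'' (\<lambda>j. \<psi> (\<phi> j)) x = act I' I'' \<psi> (act I I' \<phi> x)"
    and cmp_morphism:
      "\<lbrakk>finite_ordinal I; finite_ordinal J; Field I \<inter> Field J = {}; i \<in> Field I\<rbrakk>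
        \<Longrightarrow> morphism k (prod_variety (P I) (P J)) (P (ord_insert I i J))
              (\<lambda>(x, y). cmp I i J x y)"
    and cmp_natural:
      "\<lbrakk>finite_ordinal I; finite_ordinal J; Field I \<inter> Field J = {}; i \<in> Field I;
        finite_ordinal I'; finite_ordinal J'; Field I' \<inter> Field J' = {};
        ord_iso I I' \<phi>; ord_iso J J' \<psi>; x \<in> points (P I); y \<in> points (P J)\<rbrakk>
        \<Longrightarrow> act (ord_insert I i J) (ord_insert I' (\<phi> i) J')
              (\<lambda>j. if j \<in> Field J then \<psi> j else \<phi> j) (cmp I i J x y)
            = cmp I' (\<phi> i) J' (act I I' \<phi> x) (act J J' \<psi> y)"
    and parallel:
      "\<lbrakk>finite_ordinal I; finite_ordinal J; finite_ordinal K;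
        Field I \<inter> Field J = {}; Field I \<inter> Field K = {}; Field J \<inter> Field K = {};
        i \<in> Field I; i' \<in> Field I; i \<noteq> i';
        x \<in> points (P I); y \<in> points (P J); z \<in> points (P K)\<rbrakk>
        \<Longrightarrow> cmp (ord_insert I i J) i' K (cmp I i J x y) z
            = cmp (ord_insert I i' K) i J (cmp I i' K x z) y"
    and sequential:
      "\<lbrakk>finite_ordinal I; finite_ordinal J; finite_ordinal K;
        Field I \<inter> Field J = {}; Field I \<inter> Field K = {}; Field J \<inter> Field K = {};
        i \<in> Field I; j \<in> Field J;
        x \<in> points (P I); y \<in> points (P J); z \<in> points (P K)\<rbrakk>
        \<Longrightarrow> cmp (ord_insert I i J) j K (cmp I i J x y) z
            = cmp I i (ord_insert J j K) x (cmp J j K y z)"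
    and unit_morphism:
      "morphism k point_variety (P {(i, i)}) (\<lambda>_. unt i)"
    and unit_natural:
      "act {(i, i)} {(j, j)} (\<lambda>_. j) (unt i) = unt j"
    and unit_left:
      "\<lbrakk>finite_ordinal J; i \<notin> Field J; y \<in> points (P J)\<rbrakk>
        \<Longrightarrow> cmp {(i, i)} i J (unt i) y = y"
    and unit_right:
      "\<lbrakk>finite_ordinal I; i \<in> Field I; j \<notin> Field I; x \<in> points (P I)\<rbrakk>
        \<Longrightarrow> cmp I i {(j, j)} x (unt j)
            = act I (ord_insert I i {(j, j)}) ((\<lambda>l. l)(i := j)) x"


section \<open>Brick manifolds\<close>

definition Gsp :: "'i rel \<Rightarrow> ('i \<times> 'i \<Rightarrow> 'a::zero) set" where
  "Gsp I = coord_space (Gap I)"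

definition Gint :: "'i rel \<Rightarrow> 'i \<Rightarrow> 'i \<Rightarrow> ('i \<times> 'i \<Rightarrow> 'a::zero) set" where
  "Gint I a b = Gsp (Restr I (ord_interval I a b))"

type_synonym ('i, 'a) subspaces = "'i \<times> 'i \<Rightarrow> ('i \<times> 'i \<Rightarrow> 'a) set"

text \<open>The value at \<open>(i, j)\<close> is \<open>V\<^sub>i\<^sub>,\<^sub>j\<close>; outside the proper intervals a family is \<open>undefined\<close>.\<close>

definition bricks :: "'i rel \<Rightarrow> ('i, 'a::field) subspaces set" where
  "bricks I = {V \<in> \<Pi>\<^sub>E (i, j)\<in>proper_intervals I. grassmannian (Gap I) (card (ord_interval I i j)).
     (\<forall>(i, j)\<in>proper_intervals I. i \<noteq> ord_min I \<and> (ord_pred I i, j) \<in> proper_intervals I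
        \<longrightarrow> V (i, j) \<subseteq> V (ord_pred I i, j)) \<and>
     (\<forall>(i, j)\<in>proper_intervals I. j \<noteq> ord_max I \<and> (i, ord_succ I j) \<in> proper_intervals I
        \<longrightarrow> V (i, j) \<subseteq> V (i, ord_succ I j)) \<and>
     (\<forall>j. (ord_min I, j) \<in> proper_intervals I
        \<longrightarrow> V (ord_min I, j) = Gint I (ord_min I) (ord_succ I j)) \<and>
     (\<forall>i. (i, ord_max I) \<in> proper_intervals I
        \<longrightarrow> V (i, ord_max I) = Gint I (ord_pred I i) (ord_max I))}"

definition brick_variety ::
  "'i rel \<Rightarrow> (('i, 'a) subspaces, ('i \<times> 'i) \<times> ('i \<times> 'i) \<times> ('i \<times> 'i), 'a::field) variety" where
  "brick_variety I = subvariety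
     (grassmannian_product (proper_intervals I) (\<lambda>_. Gap I) (\<lambda>(i, j). card (ord_interval I i j)))
     (bricks I)"

definition brick_act ::
  "'i rel \<Rightarrow> 'i rel \<Rightarrow> ('i \<Rightarrow> 'i) \<Rightarrow> ('i, 'a::field) subspaces \<Rightarrow> ('i, 'a) subspaces" where
  "brick_act I I' \<phi> V =
     (\<lambda>(a, b)\<in>proper_intervals I'.
        (\<lambda>v. \<Sum>g\<in>Gap I. fscale (v g) (basis_vec (map_prod \<phi> \<phi> g))) `
          V (inv_into (Field I) \<phi> a, inv_into (Field I) \<phi> b))"

text \<open>On a gap of \<open>I\<close> the first entry is \<open>i\<close> only for the gap \<open>(i, s(i))\<close>, and the second
  only for \<open>(p(i), i)\<close>.\<close>

definition gap_map :: "'i \<Rightarrow> 'i rel \<Rightarrow> 'i \<times> 'i \<Rightarrow> 'i \<times> 'i" where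
  "gap_map i J = (\<lambda>(u, v). (if u = i then ord_max J else u, if v = i then ord_min J else v))"

definition insert_iso ::
  "'i rel \<Rightarrow> 'i \<Rightarrow> 'i rel \<Rightarrow>
     ('i \<times> 'i \<Rightarrow> 'a::field) \<times> ('i \<times> 'i \<Rightarrow> 'a) \<Rightarrow> ('i \<times> 'i \<Rightarrow> 'a)" where
  "insert_iso I i J = (\<lambda>(v, w).
     (\<Sum>g\<in>Gap I. fscale (v g) (basis_vec (gap_map i J g))) +
     (\<Sum>g\<in>Gap J. fscale (w g) (basis_vec g)))"

text \<open>In the cases where only one summand occurs, the other one is the zero subspace.\<close>

definition brick_comp ::
  "'i rel \<Rightarrow> 'i \<Rightarrow> 'i rel \<Rightarrow>
     ('i, 'a::field) subspaces \<Rightarrow> ('i, 'a) subspaces \<Rightarrow> ('i, 'a) subspaces" where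
  "brick_comp I i J V W =
     (\<lambda>(a, b)\<in>proper_intervals (ord_insert I i J). insert_iso I i J `
       (if (a, b) \<in> I \<and> (ord_lt I b i \<or> ord_lt I i a) then V (a, b) \<times> {0}
        else if (a, b) \<in> J \<and> (a, b) \<noteq> (ord_min J, ord_max J) then {0} \<times> W (a, b)
        else if ord_lt I a i \<and> b \<in> Field J \<and> b \<noteq> ord_max J
          then V (a, ord_pred I i) \<times> Gint J (ord_min J) (ord_succ J b)
        else if a \<in> Field J \<and> a \<noteq> ord_min J \<and> ord_lt I i b
          then V (ord_succ I i, b) \<times> Gint J (ord_pred J a) (ord_max J)
        else if (a, b) = (ord_min J, ord_max J) then V (i, i) \<times> Gsp J
        else if ord_lt I a i \<and> b = ord_max J then V (a, i) \<times> Gsp J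
        else if a = ord_min J \<and> ord_lt I i b then V (i, b) \<times> Gsp J
        else V (a, b) \<times> Gsp J))"

text \<open>The only point of the brick manifold of a one-element ordinal: the empty family.\<close>

definition brick_unit :: "'i \<Rightarrow> ('i, 'a::field) subspaces" where
  "brick_unit i = (\<lambda>_. undefined)"

end

theory Submission
  imports Defs
begin

text \<open>
  Each subspace \<open>V\<close> in a coordinate space projects isomorphically to the coordinates in some set
  \<open>T\<close>; its coordinates in the chart of \<open>T\<close> are the entries of the basis of \<open>V\<close> dual to \<open>T\<close>. In these
  terms inclusions between subspaces are polynomial equations, so that brick manifolds are closed in
  products of Grassmannians, and changes of charts are compositions of exchanges of a single index,
  which are visibly rational.

  A point of a brick manifold is extended to all convex subsets of the ordinal, with value \<open>0\<close> on
  the empty set and \<open>G(I)\<close> on all of \<open>I\<close>. The composition then has the uniform description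
  \<open>(V \<circ> W)(X) = f (V(X') \<oplus> W(X \<inter> J))\<close>, where \<open>X'\<close> is \<open>X - J\<close>, enlarged by \<open>i\<close> if \<open>J \<subseteq> X\<close>.
  Describing \<open>f (A \<oplus> B)\<close> as the set of vectors whose pullbacks to the gaps of \<open>I\<close> and of \<open>J\<close> lie in \<open>A\<close>
  and \<open>B\<close>, the operad axioms become identities between maps of gaps and between subsets.
  In charts, the composition only relabels coordinates and inserts constants.
\<close>

section \<open>Polynomial functions\<close>

text \<open>The obstacle is the shape of the composition: with eight cases in its definition, a
  direct check of an associativity axiom would compare nested eight-fold case distinctions. They
  disappear because the boundary conditions make the subspaces of initial and final segments
  coordinate subspaces; the empty set and the whole ordinal are initial and final as well, and the
  values \<open>0\<close> and \<open>G(I)\<close> fit the same conditions. The price is one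
  exception: \<open>G(I)\<close> has dimension \<open>card (Field I) - 1\<close>, one less than the
  rule for proper intervals. The exception explains the enlargement by \<open>i\<close>: once
  \<open>J\<close> lies in \<open>X\<close>, the part coming from \<open>J\<close> is one dimension
  short, and the point \<open>i\<close> makes up for it.

  Since \<open>k\<close> is any subfield and the coordinate field need not be algebraically closed,
  closedness and regularity have to be exhibited by explicit polynomials over \<open>k\<close>. With
  dual bases as coordinates, all of these are built from \<open>0\<close>, \<open>1\<close> and
  variables by ring operations.\<close>

definition polyfun :: "'a::field set \<Rightarrow> (('c \<Rightarrow> 'a) \<Rightarrow> 'a) \<Rightarrow> bool" where
  "polyfun k f \<longleftrightarrow> (\<exists>p\<in>polys_over k. \<forall>x. mpoly_eval p x = f x)"

definition monomial_fun :: "('c \<Rightarrow>\<^sub>0 nat) \<Rightarrow> ('c \<Rightarrow> 'a::field) \<Rightarrow> 'a" where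
  "monomial_fun m x = (\<Prod>c\<in>Poly_Mapping.keys m. x c ^ Poly_Mapping.lookup m c)"

text \<open>Terms outside the support vanish; a common finite index set makes polynomials with
  different supports comparable.\<close>

lemma mpoly_eval_superset:
  assumes "finite M" "Poly_Mapping.keys p \<subseteq> M"
  shows "mpoly_eval p x = (\<Sum>m\<in>M. Poly_Mapping.lookup p m * monomial_fun m x)"
  unfolding mpoly_eval_def monomial_fun_def
  by (rule sum.mono_neutral_left) (use assms in \<open>auto simp: in_keys_iff\<close>)

lemma monomial_fun_superset:
  assumes "finite M" "Poly_Mapping.keys m \<subseteq> M"
  shows "monomial_fun m x = (\<Prod>c\<in>M. x c ^ Poly_Mapping.lookup m c)"
  unfolding monomial_fun_def
  by (rule prod.mono_neutral_left) (use assms in \<open>auto simp: in_keys_iff\<close>)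

lemma monomial_fun_add: "monomial_fun (m + n) x = monomial_fun m x * monomial_fun n x"
proof -
  let ?M = "Poly_Mapping.keys m \<union> Poly_Mapping.keys n"
  have "monomial_fun (m + n) x = (\<Prod>c\<in>?M. x c ^ Poly_Mapping.lookup (m + n) c)"
    by (intro monomial_fun_superset) (auto dest: subsetD[OF keys_add])
  also have "\<dots> = (\<Prod>c\<in>?M. x c ^ Poly_Mapping.lookup m c) * (\<Prod>c\<in>?M. x c ^ Poly_Mapping.lookup n c)"
    by (simp add: lookup_add power_add prod.distrib)
  also have "\<dots> = monomial_fun m x * monomial_fun n x"
    by (simp add: monomial_fun_superset[of ?M m] monomial_fun_superset[of ?M n])
  finally show ?thesis .
qed

section \<open>Ring operations and substitution for polynomial functions\<close>

lemma polyfun_add: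
  assumes "is_subfield k" "polyfun k f" "polyfun k g"
  shows "polyfun k (\<lambda>x. f x + g x)"
proof -
  obtain p q where p: "p \<in> polys_over k" "\<And>x. mpoly_eval p x = f x"
    and q: "q \<in> polys_over k" "\<And>x. mpoly_eval q x = g x"
    using assms unfolding polyfun_def by blast
  let ?M = "Poly_Mapping.keys p \<union> Poly_Mapping.keys q"
  have "mpoly_eval (p + q) x = f x + g x" for x
  proof -
    have "mpoly_eval (p + q) x = (\<Sum>m\<in>?M. Poly_Mapping.lookup (p + q) m * monomial_fun m x)"
      by (intro mpoly_eval_superset) (auto dest: subsetD[OF keys_add])
    also have "\<dots> = mpoly_eval p x + mpoly_eval q x"
      by (simp add: lookup_add algebra_simps sum.distrib mpoly_eval_superset[of ?M p]
            mpoly_eval_superset[of ?M q])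
    finally show ?thesis using p q by simp
  qed
  moreover have "p + q \<in> polys_over k"
    using p q assms(1) by (auto simp: polys_over_def lookup_add is_subfield_def)
  ultimately show ?thesis unfolding polyfun_def by blast
qed

lemma polyfun_monomial:
  assumes "is_subfield k" "c \<in> k"
  shows "polyfun k (\<lambda>x. c * monomial_fun m x)"
proof -
  have "Poly_Mapping.single m c \<in> polys_over k"
    using assms by (auto simp: polys_over_def lookup_single when_def is_subfield_def)
  moreover have "mpoly_eval (Poly_Mapping.single m c) x = c * monomial_fun m x" for x
    by (subst mpoly_eval_superset[of "{m}"]) auto
  ultimately show ?thesis unfolding polyfun_def by blast
qed

lemma polyfun_const: "is_subfield k \<Longrightarrow> c \<in> k \<Longrightarrow> polyfun k (\<lambda>x. c)"
  using polyfun_monomial[of k c 0] by (simp add: monomial_fun_def)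

lemma polyfun_0: "is_subfield k \<Longrightarrow> polyfun k (\<lambda>x. 0)"
  and polyfun_1: "is_subfield k \<Longrightarrow> polyfun k (\<lambda>x. 1)"
  by (auto intro!: polyfun_const simp: is_subfield_def)

lemma polyfun_var: "is_subfield k \<Longrightarrow> polyfun k (\<lambda>x. x c)"
  using polyfun_monomial[of k 1 "Poly_Mapping.single c 1"]
  by (simp add: monomial_fun_def is_subfield_def)

lemma polyfun_sum:
  assumes "is_subfield k" "\<And>a. a \<in> A \<Longrightarrow> polyfun k (f a)"
  shows "polyfun k (\<lambda>x. \<Sum>a\<in>A. f a x)"
  using assms(2)
  by (induction A rule: infinite_finite_induct) (auto intro!: polyfun_add assms(1) polyfun_0)

text \<open>The double sum over pairs of monomials is already a combination of monomial functions
  with coefficients in \<open>k\<close>, so no product of the polynomials themselves has to be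
  formed.\<close>

lemma polyfun_mult:
  assumes "is_subfield k" "polyfun k f" "polyfun k g"
  shows "polyfun k (\<lambda>x. f x * g x)"
proof -
  obtain p q where p: "p \<in> polys_over k" "\<And>x. mpoly_eval p x = f x"
    and q: "q \<in> polys_over k" "\<And>x. mpoly_eval q x = g x"
    using assms unfolding polyfun_def by blast
  have "f x * g x = (\<Sum>m\<in>Poly_Mapping.keys p. \<Sum>n\<in>Poly_Mapping.keys q.
      (Poly_Mapping.lookup p m * Poly_Mapping.lookup q n) * monomial_fun (m + n) x)" for x
    by (simp add: p(2)[symmetric] q(2)[symmetric] mpoly_eval_def sum_product monomial_fun_add
        mult_ac flip: monomial_fun_def)
  moreover have "polyfun k (\<lambda>x. \<Sum>m\<in>Poly_Mapping.keys p. \<Sum>n\<in>Poly_Mapping.keys q.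
      (Poly_Mapping.lookup p m * Poly_Mapping.lookup q n) * monomial_fun (m + n) x)"
    using p q assms(1)
    by (intro polyfun_sum polyfun_monomial) (auto simp: polys_over_def is_subfield_def)
  ultimately show ?thesis by simp
qed

lemma polyfun_diff:
  assumes "is_subfield k" "polyfun k f" "polyfun k g"
  shows "polyfun k (\<lambda>x. f x - g x)"
proof -
  have "polyfun k (\<lambda>x. f x + (-1) * g x)"
    by (intro polyfun_add polyfun_mult polyfun_const assms)
       (use assms(1) in \<open>simp add: is_subfield_def\<close>)
  then show ?thesis by simp
qed

lemma polyfun_prod:
  assumes "is_subfield k" "\<And>a. a \<in> A \<Longrightarrow> polyfun k (f a)"
  shows "polyfun k (\<lambda>x. \<Prod>a\<in>A. f a x)"
  using assms(2)
  by (induction A rule: infinite_finite_induct) (auto intro!: polyfun_mult assms(1) polyfun_1)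

lemma polyfun_power:
  assumes "is_subfield k" "polyfun k f"
  shows "polyfun k (\<lambda>x. f x ^ n)"
  by (induction n) (auto intro!: polyfun_mult assms polyfun_1)

text \<open>Evaluating a polynomial at polynomial arguments takes only sums, products and powers.
  This carries the equations of one chart over to the joint coordinates of two charts, as closedness
  of the diagonal requires.\<close>

lemma polyfun_subst:
  assumes "is_subfield k" "polyfun k f" "\<And>c. polyfun k (\<lambda>z. g z c)"
  shows "polyfun k (\<lambda>z. f (g z))"
proof -
  obtain p where p: "p \<in> polys_over k" "\<And>x. mpoly_eval p x = f x"
    using assms unfolding polyfun_def by blast
  have "polyfun k (\<lambda>z. mpoly_eval p (g z))"
    unfolding mpoly_eval_def using p(1)
    by (intro polyfun_sum polyfun_mult polyfun_prod polyfun_power polyfun_const assms)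
       (auto simp: polys_over_def)
  then show ?thesis using p by simp
qed

lemmas polyfun_intros =
  polyfun_0 polyfun_1 polyfun_var polyfun_add polyfun_diff polyfun_mult polyfun_sum polyfun_prod

text \<open>Equations may be given as functions: the set \<open>?G\<close> of all polynomials over
  \<open>k\<close> that represent one of them has the same zeros, and no representatives have to be
  chosen.\<close>

lemma affine_closedI:
  assumes "\<And>f. f \<in> F \<Longrightarrow> polyfun k f" "Z = {x \<in> coord_space N. \<forall>f\<in>F. f x = 0}"
  shows "affine_closed k N Z"
proof -
  let ?G = "{p \<in> polys_over k. \<exists>f\<in>F. \<forall>x. mpoly_eval p x = f x}"
  have "(\<forall>f\<in>F. f x = 0) \<longleftrightarrow> (\<forall>p\<in>?G. mpoly_eval p x = 0)" for x
    using assms(1) unfolding polyfun_def by fastforce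
  then show ?thesis
    unfolding affine_closed_def assms(2) by (intro exI[of _ ?G]) auto
qed

lemma regular_atI:
  assumes "x \<in> cdom C" "polyfun k q" "\<And>j. polyfun k (p j)" "q (ccoord C x) \<noteq> 0"
    "\<And>y. y \<in> cdom C \<Longrightarrow> q (ccoord C y) \<noteq> 0 \<Longrightarrow> \<phi> y \<in> cdom D"
    "\<And>y j. y \<in> cdom C \<Longrightarrow> q (ccoord C y) \<noteq> 0 \<Longrightarrow> j \<in> cvars D \<Longrightarrow>
       ccoord D (\<phi> y) j = p j (ccoord C y) / q (ccoord C y)"
  shows "regular_at k C D \<phi> x"
proof -
  obtain q' where q': "q' \<in> polys_over k" "\<And>x. mpoly_eval q' x = q x"
    using assms(2) unfolding polyfun_def by blast
  obtain p' where p': "\<And>j. p' j \<in> polys_over k" "\<And>j x. mpoly_eval (p' j) x = p j x"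
    using assms(3) unfolding polyfun_def by metis
  show ?thesis
    unfolding regular_at_def
    by (intro conjI bexI[of _ q'] exI[of _ p']) (use assms p' q' in auto)
qed

text \<open>The case of denominator \<open>1\<close>, where a whole chart is mapped into one chart
  by polynomials. The composition, the relabellings and the unit are all of this kind; proper
  denominators occur only in changes of charts.\<close>

lemma regular_atI_polyfun:
  assumes "is_subfield k" "x \<in> cdom C" "\<And>j. polyfun k (p j)"
    "\<And>y. y \<in> cdom C \<Longrightarrow> \<phi> y \<in> cdom D"
    "\<And>y j. y \<in> cdom C \<Longrightarrow> j \<in> cvars D \<Longrightarrow> ccoord D (\<phi> y) j = p j (ccoord C y)"
  shows "regular_at k C D \<phi> x"
  by (rule regular_atI[where q = "\<lambda>_. 1" and p = p]) (use assms in \<open>auto intro: polyfun_1\<close>)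

section \<open>Framed subspaces\<close>

lemma sum_fun_apply: "(\<Sum>a\<in>A. f a) s = (\<Sum>a\<in>A. f a s)"
  by (induction A rule: infinite_finite_induct) auto

text \<open>\<open>V\<close> is framed by \<open>T\<close> when the projection to the coordinates in \<open>T\<close> is an
  isomorphism, that is, when \<open>V\<close> lies in the Grassmannian chart of \<open>T\<close>.\<close>

definition framed :: "('s \<Rightarrow> 'a::field) set \<Rightarrow> 's set \<Rightarrow> bool" where
  "framed V T \<longleftrightarrow> fvs.subspace V \<and>
     (\<forall>t\<in>T. \<exists>v\<in>V. \<forall>t'\<in>T. v t' = basis_vec t t') \<and> (\<forall>v\<in>V. (\<forall>t\<in>T. v t = 0) \<longrightarrow> v = 0)"

lemma framed_eqI:
  assumes "framed V T" "v \<in> V" "w \<in> V" "\<And>t. t \<in> T \<Longrightarrow> v t = w t"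
  shows "v = w"
proof -
  have "v - w \<in> V" using assms fvs.subspace_diff unfolding framed_def by blast
  moreover have "\<forall>t\<in>T. (v - w) t = 0" using assms by simp
  ultimately have "v - w = 0" using assms(1) unfolding framed_def by blast
  then show ?thesis by simp
qed

lemma graph_vec_framed:
  assumes "framed V T" "t \<in> T"
  shows "graph_vec V T t \<in> V" "\<And>t'. t' \<in> T \<Longrightarrow> graph_vec V T t t' = basis_vec t t'"
proof -
  obtain v where v: "v \<in> V \<and> (\<forall>t'\<in>T. v t' = basis_vec t t')"
    using assms unfolding framed_def by blast
  have "graph_vec V T t \<in> V \<and> (\<forall>t'\<in>T. graph_vec V T t t' = basis_vec t t')"
    unfolding graph_vec_def
    by (rule theI[of _ v]) (use v framed_eqI[OF assms(1)] in auto)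
  then show "graph_vec V T t \<in> V" "\<And>t'. t' \<in> T \<Longrightarrow> graph_vec V T t t' = basis_vec t t'"
    by auto
qed

lemma graph_vec_eqI:
  assumes "framed V T" "t \<in> T" "v \<in> V" "\<And>t'. t' \<in> T \<Longrightarrow> v t' = basis_vec t t'"
  shows "graph_vec V T t = v"
  by (rule framed_eqI[OF assms(1)]) (use graph_vec_framed[OF assms(1,2)] assms in auto)

lemma sum_basis_vec:
  assumes "finite T" "t \<in> T"
  shows "(\<Sum>u\<in>T. f u * basis_vec u t) = (f t :: 'a::field)"
proof -
  have "(\<Sum>u\<in>T. f u * basis_vec u t) = (\<Sum>u\<in>T. if t = u then f u else 0)"
    by (rule sum.cong) (auto simp: basis_vec_def)
  then show ?thesis using assms by simp
qed

lemma sum_fscale_in: "fvs.subspace V \<Longrightarrow> (\<And>t. t \<in> T \<Longrightarrow> g t \<in> V) \<Longrightarrow> (\<lambda>s. \<Sum>t\<in>T. c t * g t s) \<in> V"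
proof -
  assume "fvs.subspace V" "\<And>t. t \<in> T \<Longrightarrow> g t \<in> V"
  then have "(\<Sum>t\<in>T. fscale (c t) (g t)) \<in> V"
    by (intro fvs.subspace_sum fvs.subspace_scale) auto
  moreover have "(\<Sum>t\<in>T. fscale (c t) (g t)) = (\<lambda>s. \<Sum>t\<in>T. c t * g t s)"
    by (auto simp: fun_eq_iff sum_fun_apply fscale_def)
  ultimately show ?thesis by simp
qed

text \<open>The sum on the right is the only element of \<open>V\<close> with the same entries in
  \<open>T\<close> as \<open>v\<close>, so \<open>v\<close> lies in \<open>V\<close> exactly if it
  equals that sum. Membership thereby becomes a system of equations in the entries of the
  frame.\<close>

lemma framed_mem_iff:
  assumes "framed V T" "finite T"
  shows "v \<in> V \<longleftrightarrow> (\<forall>s. v s = (\<Sum>t\<in>T. v t * graph_vec V T t s))"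
proof -
  let ?w = "\<lambda>s. \<Sum>t\<in>T. v t * graph_vec V T t s"
  have w: "?w \<in> V"
    using assms by (intro sum_fscale_in graph_vec_framed) (auto simp: framed_def)
  have "?w t = v t" if "t \<in> T" for t
  proof -
    have "?w t = (\<Sum>u\<in>T. v u * basis_vec u t)"
      using that assms by (intro sum.cong) (auto simp: graph_vec_framed)
    then show ?thesis using that assms by (simp add: sum_basis_vec)
  qed
  then have "v = ?w" if "v \<in> V"
    using framed_eqI[OF assms(1) that w] by simp
  moreover have "v \<in> V" if "v = ?w"
    by (subst that) (rule w)
  ultimately have "v \<in> V \<longleftrightarrow> v = ?w" by (rule iffI)
  then show ?thesis by (simp only: fun_eq_iff)
qed

lemma framed_expand:
  assumes "framed V T" "finite T" "v \<in> V"
  shows "v = (\<lambda>s. \<Sum>t\<in>T. v t * graph_vec V T t s)"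
  using framed_mem_iff[OF assms(1,2), of v] assms(3) by (simp only: fun_eq_iff)

lemma framed_dim:
  fixes V :: "('s \<Rightarrow> 'a::field) set"
  assumes "framed V T" "finite T"
  shows "fvs.dim V = card T"
proof -
  let ?g = "graph_vec V T"
  have inj: "inj_on ?g T"
  proof
    fix t u assume "t \<in> T" "u \<in> T" "?g t = ?g u"
    then have "basis_vec t t = (basis_vec u t :: 'a)" using graph_vec_framed(2)[OF assms(1)] by metis
    then show "t = u" by (auto simp: basis_vec_def split: if_splits)
  qed
  have "fvs.independent (?g ` T)"
  proof (rule fvs.independent_if_scalars_zero)
    show "finite (?g ` T)" using assms by simp
  next
    fix f x assume *: "(\<Sum>x\<in>?g ` T. fscale (f x) x) = 0" and "x \<in> ?g ` T"
    then obtain t where t: "t \<in> T" "x = ?g t" by blast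
    \<comment> \<open>Evaluating the relation at the coordinate \<open>t\<close> isolates one
      coefficient, because the frame vectors are dual to \<open>T\<close>.\<close>
    have "0 = (\<Sum>u\<in>T. fscale (f (?g u)) (?g u)) t"
      using * by (simp add: sum.reindex[OF inj])
    also have "\<dots> = (\<Sum>u\<in>T. f (?g u) * basis_vec u t)"
      unfolding sum_fun_apply fscale_def
      by (rule sum.cong) (use assms t graph_vec_framed(2)[OF assms(1)] in auto)
    also have "\<dots> = f (?g t)" using assms t by (simp add: sum_basis_vec)
    finally show "f x = 0" using t by simp
  qed
  moreover have "?g ` T \<subseteq> V" using graph_vec_framed(1)[OF assms(1)] by blast
  moreover have "V \<subseteq> fvs.span (?g ` T)"
  proof
    fix v assume "v \<in> V"
    have "(\<lambda>s. \<Sum>t\<in>T. v t * ?g t s) \<in> fvs.span (?g ` T)"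
      by (rule sum_fscale_in) (auto intro: fvs.span_base)
    then show "v \<in> fvs.span (?g ` T)"
      by (subst framed_expand[OF assms \<open>v \<in> V\<close>])
  qed
  ultimately show ?thesis using fvs.dim_unique card_image[OF inj] by blast
qed

text \<open>One step of Gaussian elimination with pivot \<open>graph_vec V T t u\<close>: the row of
  \<open>t\<close> is scaled to have entry \<open>1\<close> at \<open>u\<close>, and multiples of it
  are subtracted from the other rows to clear their entries at \<open>u\<close>.\<close>

lemma exchange_graph_vec:
  assumes F: "framed V T" and t: "t \<in> T" and u: "u \<notin> T" and nz: "graph_vec V T t u \<noteq> 0"
  defines "T' \<equiv> insert u (T - {t})"
  shows "framed V T'"
    and "graph_vec V T' u s = graph_vec V T t s / graph_vec V T t u"
    and "r \<in> T - {t} \<Longrightarrow> graph_vec V T' r s =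
           graph_vec V T r s - graph_vec V T r u * graph_vec V T t s / graph_vec V T t u"
proof -
  let ?g = "graph_vec V T"
  note g = graph_vec_framed[OF F]
  have sub: "fvs.subspace V" using F by (simp add: framed_def)
  have utn: "u \<noteq> t" using t u by auto
  \<comment> \<open>\<open>w\<close> is the normalised pivot row, and \<open>x r\<close> is the row
    of \<open>r\<close> after elimination.\<close>
  define w where "w = fscale (1 / ?g t u) (?g t)"
  define x where "x r = ?g r - fscale (?g r u) w" for r
  have wV: "w \<in> V" unfolding w_def using sub g t fvs.subspace_scale by blast
  have xV: "x r \<in> V" if "r \<in> T" for r
    unfolding x_def using sub g that wV by (meson fvs.subspace_diff fvs.subspace_scale)
  have wT: "w r = basis_vec u r" if "r \<in> T'" for r
    using that nz t g(2)[OF t] utn u unfolding w_def T'_def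
    by (auto simp: fscale_def basis_vec_def)
  have xT: "x r r' = basis_vec r r'" if "r \<in> T - {t}" "r' \<in> T'" for r r'
    using that nz t g(2) utn u wT[OF that(2)] unfolding x_def T'_def
    by (auto simp: fscale_def basis_vec_def)
  have "\<exists>v\<in>V. \<forall>t'\<in>T'. v t' = basis_vec r t'" if "r \<in> T'" for r
  proof (cases "r = u")
    case True then show ?thesis using wV wT by blast
  next
    case False then have "r \<in> T - {t}" using that by (auto simp: T'_def)
    then show ?thesis using xV xT by blast
  qed
  moreover have "v = 0" if v: "v \<in> V" "\<forall>r\<in>T'. v r = 0" for v
  proof -
    \<comment> \<open>A vector that vanishes on \<open>T'\<close> can be nonzero within
      \<open>T\<close> only at \<open>t\<close>, so it is a multiple of the row of \<open>t\<close>;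
      its entry at \<open>u\<close> then forces the factor to be zero.\<close>
    have "v = fscale (v t) (?g t)"
    proof (rule framed_eqI[OF F])
      show "fscale (v t) (?g t) \<in> V" using sub g t fvs.subspace_scale by blast
      fix r assume "r \<in> T"
      then show "v r = fscale (v t) (?g t) r"
        using g(2)[OF t] v(2) by (cases "r = t") (auto simp: T'_def fscale_def basis_vec_def)
    qed (use v in auto)
    then have "v u = v t * ?g t u" by (metis fscale_def)
    moreover have "v u = 0" using v by (auto simp: T'_def)
    ultimately have "v t = 0" using nz by simp
    then show ?thesis using \<open>v = fscale (v t) (?g t)\<close> by (simp add: fscale_def fun_eq_iff)
  qed
  ultimately show F': "framed V T'" using sub unfolding framed_def by blast
  have "graph_vec V T' u = w"
    by (rule graph_vec_eqI[OF F']) (use wV wT in \<open>auto simp: T'_def\<close>)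
  then show "graph_vec V T' u s = graph_vec V T t s / graph_vec V T t u"
    by (simp add: w_def fscale_def)
  assume r: "r \<in> T - {t}"
  have "graph_vec V T' r = x r"
    by (rule graph_vec_eqI[OF F']) (use r xV xT in \<open>auto simp: T'_def\<close>)
  then show "graph_vec V T' r s =
      graph_vec V T r s - graph_vec V T r u * graph_vec V T t s / graph_vec V T t u"
    by (simp add: w_def x_def fscale_def)
qed

text \<open>A maximal subset of \<open>T\<^sub>0\<close> admitting a dual family of vectors is a frame.\<close>

lemma ex_framed_subset:
  fixes V :: "('s \<Rightarrow> 'a::field) set"
  assumes V: "fvs.subspace V" and T0: "finite T0" "\<And>v. v \<in> V \<Longrightarrow> \<forall>t\<in>T0. v t = 0 \<Longrightarrow> v = 0"
  shows "\<exists>T\<subseteq>T0. framed V T"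
proof -
  define Q where "Q T \<longleftrightarrow> T \<subseteq> T0 \<and> (\<exists>M. \<forall>t\<in>T. M t \<in> V \<and> (\<forall>t'\<in>T. M t t' = (basis_vec t t' :: 'a)))" for T
  have "Q {}" by (simp add: Q_def)
  moreover have "card T \<le> card T0" if "Q T" for T
    using that T0(1) by (auto simp: Q_def card_mono)
  ultimately obtain T where T: "Q T" and max: "\<And>U. Q U \<Longrightarrow> card U \<le> card T"
    using ex_has_greatest_nat[of Q "{}" card "Suc (card T0)"] by (metis le_imp_less_Suc)
  then obtain M where M: "\<And>t. t \<in> T \<Longrightarrow> M t \<in> V" "\<And>t t'. t \<in> T \<Longrightarrow> t' \<in> T \<Longrightarrow> M t t' = basis_vec t t'"
    unfolding Q_def by blast
  have fT: "finite T" using T T0 finite_subset unfolding Q_def by blast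
  have "v = 0" if v: "v \<in> V" "\<forall>t\<in>T. v t = 0" for v
  proof (rule T0(2)[OF v(1)], rule ccontr)
    assume "\<not> (\<forall>t\<in>T0. v t = 0)"
    then obtain u where u: "u \<in> T0" "v u \<noteq> 0" by blast
    \<comment> \<open>As \<open>v\<close> vanishes on \<open>T\<close>, subtracting multiples of
      \<open>w\<close> corrects the entries at \<open>u\<close> without disturbing those in
      \<open>T\<close>. So \<open>insert u T\<close> has a dual family too, against
      maximality.\<close>
    define w where "w = fscale (1 / v u) v"
    define N where "N t = (if t = u then w else M t - fscale (M t u) w)" for t
    have uT: "u \<notin> T" using v u by auto
    have wV: "w \<in> V" using V v fvs.subspace_scale unfolding w_def by blast
    have "N t \<in> V" if "t \<in> insert u T" for t
      using that wV M V unfolding N_def by (auto intro: fvs.subspace_diff fvs.subspace_scale)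
    moreover have "N t t' = basis_vec t t'" if "t \<in> insert u T" "t' \<in> insert u T" for t t'
      using that u v uT M(2) unfolding N_def w_def by (auto simp: fscale_def basis_vec_def)
    ultimately have "Q (insert u T)" using T u unfolding Q_def by blast
    then show False using max[of "insert u T"] fT uT by simp
  qed
  then have "framed V T" using V M unfolding framed_def by blast
  then show ?thesis using T unfolding Q_def by blast
qed

lemma ex_framed:
  assumes "fvs.subspace V" "V \<subseteq> coord_space S" "finite S"
  shows "\<exists>T\<subseteq>S. framed V T"
  by (rule ex_framed_subset) (use assms in \<open>auto simp: coord_space_def fun_eq_iff\<close>)

text \<open>Identifies frames with the complement condition that defines the Grassmannian charts.
  From trivial intersection, the projection to \<open>T\<close> is injective, so some subset of
  \<open>T\<close> is a frame; its size is the dimension, hence it is all of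
  \<open>T\<close>.\<close>

lemma framed_iff:
  assumes V: "fvs.subspace V" "V \<subseteq> coord_space S" and S: "finite S" "T \<subseteq> S"
    and d: "fvs.dim V = card T"
  shows "framed V T \<longleftrightarrow> V \<inter> coord_space (S - T) = {0}"
proof
  assume "framed V T"
  then have "v = 0" if "v \<in> V \<inter> coord_space (S - T)" for v
    using that S(2) by (auto simp: framed_def coord_space_def)
  then show "V \<inter> coord_space (S - T) = {0}"
    using V(1) fvs.subspace_0 by (auto simp: coord_space_def)
next
  assume *: "V \<inter> coord_space (S - T) = {0}"
  have fT: "finite T" using S finite_subset by blast
  have "\<exists>U\<subseteq>T. framed V U"
  proof (rule ex_framed_subset[OF V(1) fT])
    fix v assume "v \<in> V" "\<forall>t\<in>T. v t = 0"
    then have "v \<in> V \<inter> coord_space (S - T)" using V(2) by (auto simp: coord_space_def)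
    then show "v = 0" using * by blast
  qed
  then obtain U where U: "U \<subseteq> T" "framed V U" by blast
  then have "card U = card T" using framed_dim d fT finite_subset by metis
  then have "U = T" using U fT card_subset_eq by blast
  then show "framed V T" using U by simp
qed

lemma framed_coord_space: "framed (coord_space S :: ('s \<Rightarrow> 'a::field) set) S"
  unfolding framed_def
  by (auto simp: fvs.subspace_def coord_space_def fscale_def fun_eq_iff basis_vec_def
      intro!: exI[of _ "basis_vec _"])

text \<open>An inclusion need only be tested on frame vectors, and each test is an equation of
  degree at most two in the entries of the two frames.\<close>

lemma framed_subset_iff:
  assumes "framed V T" "finite T" "framed W U" "finite U"
  shows "V \<subseteq> W \<longleftrightarrow> (\<forall>t\<in>T. \<forall>s. graph_vec V T t s =
     (\<Sum>u\<in>U. graph_vec V T t u * graph_vec W U u s))"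
proof -
  have "V \<subseteq> W \<longleftrightarrow> (\<forall>t\<in>T. graph_vec V T t \<in> W)"
  proof
    assume *: "\<forall>t\<in>T. graph_vec V T t \<in> W"
    show "V \<subseteq> W"
    proof
      fix v assume "v \<in> V"
      have "(\<lambda>s. \<Sum>t\<in>T. v t * graph_vec V T t s) \<in> W"
        using * assms(3) by (intro sum_fscale_in) (auto simp: framed_def)
      then show "v \<in> W" by (subst framed_expand[OF assms(1,2) \<open>v \<in> V\<close>])
    qed
  qed (use graph_vec_framed(1)[OF assms(1)] in auto)
  then show ?thesis using framed_mem_iff[OF assms(3,4)] by metis
qed

text \<open>A coordinate subspace has its own index set as its only frame. In a chart with any other
  frame the equality cannot hold, whence the condition \<open>T = U\<close> on the chart
  itself.\<close>

lemma framed_eq_coord_space_iff: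
  fixes V :: "('s \<Rightarrow> 'a::field) set"
  assumes "framed V T" "finite T"
  shows "V = coord_space U \<longleftrightarrow> T = U \<and> (\<forall>t\<in>T. \<forall>s. s \<notin> U \<longrightarrow> graph_vec V T t s = 0)"
proof
  assume V: "V = coord_space U"
  have g: "graph_vec V T t \<in> coord_space U" if "t \<in> T" for t
    using graph_vec_framed(1)[OF assms(1) that] V by simp
  have "t \<in> U" if "t \<in> T" for t
    using g[OF that] graph_vec_framed(2)[OF assms(1) that that]
    by (auto simp: coord_space_def basis_vec_def)
  moreover have "u \<in> T" if "u \<in> U" for u
  proof (rule ccontr)
    assume "u \<notin> T"
    then have "\<forall>t\<in>T. basis_vec u t = (0::'a)" by (auto simp: basis_vec_def)
    moreover have "basis_vec u \<in> V" using that V by (auto simp: coord_space_def basis_vec_def)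
    ultimately have "basis_vec u = (0 :: _ \<Rightarrow> 'a)" using assms(1) unfolding framed_def by blast
    then show False by (metis basis_vec_def zero_fun_apply zero_neq_one)
  qed
  ultimately show "T = U \<and> (\<forall>t\<in>T. \<forall>s. s \<notin> U \<longrightarrow> graph_vec V T t s = 0)"
    using g by (auto simp: coord_space_def)
next
  assume *: "T = U \<and> (\<forall>t\<in>T. \<forall>s. s \<notin> U \<longrightarrow> graph_vec V T t s = 0)"
  show "V = coord_space U"
  proof
    show "V \<subseteq> coord_space U"
    proof
      fix v assume "v \<in> V"
      then have v: "v s = (\<Sum>t\<in>T. v t * graph_vec V T t s)" for s
        using framed_mem_iff[OF assms] by blast
      have "v s = 0" if "s \<notin> U" for s
        by (subst v, rule sum.neutral) (use * that in auto)
      then show "v \<in> coord_space U" by (simp add: coord_space_def)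
    qed
    show "coord_space U \<subseteq> V"
    proof
      fix v :: "_ \<Rightarrow> 'a" assume v: "v \<in> coord_space U"
      have "v s = (\<Sum>t\<in>T. v t * graph_vec V T t s)" for s
      proof (cases "s \<in> T")
        case True
        then have "(\<Sum>t\<in>T. v t * graph_vec V T t s) = (\<Sum>t\<in>T. v t * basis_vec t s)"
          by (intro sum.cong) (auto simp: graph_vec_framed(2)[OF assms(1)])
        then show ?thesis using True assms by (simp add: sum_basis_vec)
      next
        case False
        then have "(\<Sum>t\<in>T. v t * graph_vec V T t s) = 0"
          by (intro sum.neutral) (use * in auto)
        then show ?thesis using False * v by (auto simp: coord_space_def)
      qed
      then show "v \<in> V" using framed_mem_iff[OF assms] by blast
    qed
  qed
qed

text \<open>The graph of the linear map with matrix \<open>m\<close> from the coordinates in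
  \<open>T\<close> to those in \<open>S - T\<close>; as \<open>m\<close> varies, this inverts the
  Grassmannian chart of \<open>T\<close>.\<close>

definition graph_space :: "'s set \<Rightarrow> 's set \<Rightarrow> ('s \<Rightarrow> 's \<Rightarrow> 'a::field) \<Rightarrow> ('s \<Rightarrow> 'a) set" where
  "graph_space S T m = {v \<in> coord_space S. \<forall>s\<in>S - T. v s = (\<Sum>t\<in>T. v t * m t s)}"

lemma
  assumes "finite T" "T \<subseteq> S"
  shows framed_graph_space: "framed (graph_space S T m) T"
    and graph_vec_graph_space: "t \<in> T \<Longrightarrow> s \<in> S - T \<Longrightarrow> graph_vec (graph_space S T m) T t s = m t s"
proof -
  \<comment> \<open>The rows of the matrix with the identity as its block over \<open>T\<close> and
    \<open>m\<close> as its block over \<open>S - T\<close>, extended by zero outside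
    \<open>S\<close>.\<close>
  define b where "b t s = (if s \<in> T then basis_vec t s else if s \<in> S then m t s else 0)" for t s
  have b: "b t \<in> graph_space S T m" if "t \<in> T" for t
  proof -
    have "(\<Sum>u\<in>T. b t u * m u s) = m t s" for s
    proof -
      have "(\<Sum>u\<in>T. b t u * m u s) = (\<Sum>u\<in>T. if t = u then m u s else 0)"
        by (rule sum.cong) (auto simp: b_def basis_vec_def)
      then show ?thesis using that assms by simp
    qed
    then show ?thesis using assms unfolding graph_space_def coord_space_def b_def
      by auto
  qed
  have "fvs.subspace (graph_space S T m)"
    unfolding fvs.subspace_def
    by (auto simp: graph_space_def coord_space_def fscale_def algebra_simps sum.distrib
        sum_distrib_left)
  moreover have "\<exists>v\<in>graph_space S T m. \<forall>t'\<in>T. v t' = basis_vec t t'" if "t \<in> T" for t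
    by (rule bexI[OF _ b[OF that]]) (auto simp: b_def)
  moreover have "v = 0" if "v \<in> graph_space S T m" "\<forall>t\<in>T. v t = 0" for v
  proof
    fix s show "v s = 0 s" using that
      by (cases "s \<in> T"; cases "s \<in> S") (auto simp: graph_space_def coord_space_def)
  qed
  ultimately show F: "framed (graph_space S T m) T" unfolding framed_def by blast
  assume "t \<in> T" "s \<in> S - T"
  moreover have "graph_vec (graph_space S T m) T t = b t" if "t \<in> T"
    by (rule graph_vec_eqI[OF F that b[OF that]]) (auto simp: b_def)
  ultimately show "graph_vec (graph_space S T m) T t s = m t s" by (auto simp: b_def)
qed

lemma graph_space_graph_vec:
  assumes F: "framed V T" "finite T" and V: "V \<subseteq> coord_space S"
    and m: "\<And>t s. t \<in> T \<Longrightarrow> s \<in> S - T \<Longrightarrow> m t s = graph_vec V T t s"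
  shows "graph_space S T m = V"
proof
  have eq: "(\<Sum>t\<in>T. v t * m t s) = (\<Sum>t\<in>T. v t * graph_vec V T t s)" if "s \<in> S - T" for v s
    by (rule sum.cong) (use m that in auto)
  show "V \<subseteq> graph_space S T m"
  proof
    fix v assume v: "v \<in> V"
    then have "\<forall>s. v s = (\<Sum>t\<in>T. v t * graph_vec V T t s)" using framed_mem_iff[OF F] by blast
    then have "\<forall>s\<in>S - T. v s = (\<Sum>t\<in>T. v t * m t s)" using eq by metis
    then show "v \<in> graph_space S T m" using v V unfolding graph_space_def by blast
  qed
  show "graph_space S T m \<subseteq> V"
  proof
    fix v assume v: "v \<in> graph_space S T m"
    have "v s = (\<Sum>t\<in>T. v t * graph_vec V T t s)" for s
    proof -
      consider "s \<in> T" | "s \<in> S - T" | "s \<notin> T" "s \<notin> S" by blast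
      then show ?thesis
      proof cases
        case 1
        then have "(\<Sum>t\<in>T. v t * graph_vec V T t s) = (\<Sum>t\<in>T. v t * basis_vec t s)"
          by (intro sum.cong) (auto simp: graph_vec_framed(2)[OF F(1)])
        then show ?thesis using 1 F(2) by (simp add: sum_basis_vec)
      next
        case 2
        then show ?thesis using v eq[OF 2] by (auto simp: graph_space_def)
      next
        case 3
        then have "(\<Sum>t\<in>T. v t * graph_vec V T t s) = 0"
          using V graph_vec_framed(1)[OF F(1)]
          by (intro sum.neutral) (fastforce simp: coord_space_def)
        then show ?thesis using v 3 by (simp add: graph_space_def coord_space_def)
      qed
    qed
    then show "v \<in> V" using framed_mem_iff[OF F] by blast
  qed
qed

text \<open>The entries of the frame vectors with respect to another frame \<open>T'\<close> are rational functions
  of the entries with respect to \<open>T\<close>: both frames are linked by exchanging one index at a time,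
  through frames of the given subspace \<open>V x\<close>.\<close>

lemma graph_vec_change_frame:
  fixes V :: "'p \<Rightarrow> ('s \<Rightarrow> 'a::field) set" and c :: "'p \<Rightarrow> 'c \<Rightarrow> 'a"
  assumes k: "is_subfield k" and e: "\<And>t s. polyfun k (e t s)" and x: "x \<in> X" and fin: "finite T" "finite T'"
    and V: "\<And>y. y \<in> X \<Longrightarrow> framed (V y) T"
      "\<And>y t s. y \<in> X \<Longrightarrow> t \<in> T \<Longrightarrow> graph_vec (V y) T t s = e t s (c y)"
    and T': "framed (V x) T'"
  shows "\<exists>q p. polyfun k q \<and> (\<forall>t s. polyfun k (p t s)) \<and> q (c x) \<noteq> 0 \<and>
     (\<forall>y\<in>X. q (c y) \<noteq> 0 \<longrightarrow> framed (V y) T' \<and>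
        (\<forall>t\<in>T'. \<forall>s. graph_vec (V y) T' t s = p t s (c y) / q (c y)))"
  using fin(2) T'
proof (induction "card (T' - T)" arbitrary: T')
  case 0
  \<comment> \<open>Both are frames of the one space \<open>V x\<close>, so their sizes agree with
    its dimension.\<close>
  have "card T' = card T" using framed_dim V(1)[OF x] fin 0 by metis
  moreover have "T' \<subseteq> T" using 0 fin by simp
  ultimately have "T' = T" using fin card_subset_eq by blast
  then show ?case using V e k
    by (intro exI[of _ "\<lambda>_. 1"] exI[of _ e]) (auto intro: polyfun_1)
next
  case (Suc n)
  note F = \<open>framed (V x) T'\<close>
  obtain t0 where t0: "t0 \<in> T'" "t0 \<notin> T" using Suc(2) by (metis DiffE card_eq_0_iff equals0I nat.distinct(1))
  \<comment> \<open>Otherwise the frame vector of \<open>t0\<close> would vanish on all of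
    \<open>T\<close>: on \<open>T \<inter> T'\<close> it does so by duality, as \<open>t0\<close> is
    not in \<open>T\<close>. It would then be zero, although its entry at \<open>t0\<close> is
    \<open>1\<close>.\<close>
  have "\<exists>u\<in>T - T'. graph_vec (V x) T' t0 u \<noteq> 0"
  proof (rule ccontr)
    assume "\<not> ?thesis"
    then have "graph_vec (V x) T' t0 u = 0" if "u \<in> T" for u
      using that graph_vec_framed(2)[OF F t0(1)] t0 by (cases "u \<in> T'") (auto simp: basis_vec_def)
    then have "graph_vec (V x) T' t0 = 0"
      using V(1)[OF x] graph_vec_framed(1)[OF F t0(1)] unfolding framed_def by blast
    then show False using graph_vec_framed(2)[OF F t0(1) t0(1)] by (simp add: basis_vec_def)
  qed
  then obtain u where u: "u \<in> T" "u \<notin> T'" and nz: "graph_vec (V x) T' t0 u \<noteq> 0" by blast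
  \<comment> \<open>\<open>T''\<close> agrees with \<open>T\<close> in one more index, so the
    induction hypothesis applies to it; the exchange of \<open>u\<close> for \<open>t0\<close> then
    leads back from \<open>T''\<close> to \<open>T'\<close>. The pivot of this return step is
    nonzero at \<open>x\<close>, which is what the denominator needs.\<close>
  define T'' where "T'' = insert u (T' - {t0})"
  have F'': "framed (V x) T''" unfolding T''_def by (rule exchange_graph_vec[OF F t0(1) u(2) nz])
  have swap: "insert t0 (T'' - {u}) = T'" using t0 u by (auto simp: T''_def)
  have uT'': "u \<in> T''" "t0 \<notin> T''" using t0 u by (auto simp: T''_def)
  have "graph_vec (V x) T'' u t0 = graph_vec (V x) T' t0 t0 / graph_vec (V x) T' t0 u"
    unfolding T''_def by (rule exchange_graph_vec[OF F t0(1) u(2) nz])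
  then have nz'': "graph_vec (V x) T'' u t0 \<noteq> 0"
    using graph_vec_framed(2)[OF F t0(1) t0(1)] nz by (simp add: basis_vec_def)
  have "T'' - T = (T' - T) - {t0}" using t0 u by (auto simp: T''_def)
  then have "n = card (T'' - T)" using Suc(2,3) t0 by simp
  moreover have "finite T''" using Suc(3) by (simp add: T''_def)
  ultimately obtain q p where q: "polyfun k q" "q (c x) \<noteq> 0" and p: "\<And>t s. polyfun k (p t s)"
    and qp: "\<And>y. y \<in> X \<Longrightarrow> q (c y) \<noteq> 0 \<Longrightarrow> framed (V y) T''"
      "\<And>y t s. y \<in> X \<Longrightarrow> q (c y) \<noteq> 0 \<Longrightarrow> t \<in> T'' \<Longrightarrow> graph_vec (V y) T'' t s = p t s (c y) / q (c y)"
    using Suc(1)[of T''] F'' by blast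
  \<comment> \<open>The pivot of the return exchange is \<open>p u t0 / q\<close>. Clearing it from
    the exchange formulas gives the new denominator \<open>q * p u t0\<close> and the numerators
    below.\<close>
  define q' where "q' z = q z * p u t0 z" for z
  define p' where "p' t s z = (if t = t0 then p u s z * q z
      else p t s z * p u t0 z - p t t0 z * p u s z)" for t s z
  have "polyfun k q'" unfolding q'_def by (intro polyfun_intros k q p)
  moreover have "polyfun k (p' t s)" for t s
    unfolding p'_def by (cases "t = t0") (auto intro!: polyfun_intros k q p)
  moreover have "q' (c x) \<noteq> 0"
    using q nz'' qp(2)[OF x q(2) uT''(1)] by (simp add: q'_def)
  moreover have "framed (V y) T' \<and> (\<forall>t\<in>T'. \<forall>s. graph_vec (V y) T' t s = p' t s (c y) / q' (c y))"
    if y: "y \<in> X" "q' (c y) \<noteq> 0" for y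
  proof -
    have qy: "q (c y) \<noteq> 0" "p u t0 (c y) \<noteq> 0" using y by (auto simp: q'_def)
    note Fy = qp(1)[OF y(1) qy(1)]
    have nzy: "graph_vec (V y) T'' u t0 \<noteq> 0" using qp(2)[OF y(1) qy(1) uT''(1)] qy by simp
    note ex = exchange_graph_vec[OF Fy uT'' nzy, unfolded swap]
    have "graph_vec (V y) T' t s = p' t s (c y) / q' (c y)" if "t \<in> T'" for t s
    proof (cases "t = t0")
      case True
      then show ?thesis using ex(2)[of s] qp(2)[OF y(1) qy(1) uT''(1)] qy
        by (simp add: p'_def q'_def)
    next
      case False
      then have t: "t \<in> T'' - {u}" "t \<in> T''" using that u by (auto simp: T''_def)
      show ?thesis using ex(3)[OF t(1), of s] qp(2)[OF y(1) qy(1) uT''(1)] qp(2)[OF y(1) qy(1) t(2)] qy False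
        by (simp add: p'_def q'_def field_simps)
    qed
    then show ?thesis using ex(1) by blast
  qed
  ultimately show ?case by blast
qed

section \<open>Closed subvarieties of products of Grassmannians\<close>

locale grassmannian_data =
  fixes A :: "'n set" and S :: "'n \<Rightarrow> 's set" and d :: "'n \<Rightarrow> nat"
  assumes finite_index: "finite A" and finite_coords: "\<And>\<alpha>. \<alpha> \<in> A \<Longrightarrow> finite (S \<alpha>)"
begin

definition frames :: "('n \<Rightarrow> 's set) set" where
  "frames = (\<Pi>\<^sub>E \<alpha>\<in>A. {t. t \<subseteq> S \<alpha> \<and> card t = d \<alpha>})"

definition chart_vars :: "('n \<Rightarrow> 's set) \<Rightarrow> ('n \<times> 's \<times> 's) set" where
  "chart_vars T = {(\<alpha>, t, s). \<alpha> \<in> A \<and> t \<in> T \<alpha> \<and> s \<in> S \<alpha> - T \<alpha>}"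

abbreviation gchart :: "('n \<Rightarrow> 's set) \<Rightarrow> ('n \<Rightarrow> ('s \<Rightarrow> 'a::field) set, 'n \<times> 's \<times> 's, 'a) chart" where
  "gchart \<equiv> grassmannian_chart A S d"

abbreviation gpoints :: "('n \<Rightarrow> ('s \<Rightarrow> 'a::field) set) set" where
  "gpoints \<equiv> \<Pi>\<^sub>E \<alpha>\<in>A. grassmannian (S \<alpha>) (d \<alpha>)"

lemma frames_D:
  assumes "T \<in> frames" "\<alpha> \<in> A"
  shows "T \<alpha> \<subseteq> S \<alpha>" "card (T \<alpha>) = d \<alpha>" "finite (T \<alpha>)"
  using assms finite_coords[OF assms(2)] finite_subset by (auto simp: frames_def PiE_iff)

lemma finite_frames: "finite frames"
  unfolding frames_def
  by (rule finite_PiE[OF finite_index])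
    (auto intro: finite_subset[OF _ finite_Pow_iff[THEN iffD2, OF finite_coords]])

lemma finite_chart_vars:
  assumes "T \<in> frames"
  shows "finite (chart_vars T)"
proof (rule finite_subset)
  show "chart_vars T \<subseteq> (SIGMA \<alpha>:A. T \<alpha> \<times> S \<alpha>)" by (auto simp: chart_vars_def)
  show "finite (SIGMA \<alpha>:A. T \<alpha> \<times> S \<alpha>)"
    using assms finite_index finite_coords frames_D by (intro finite_SigmaI finite_cartesian_product) auto
qed

lemma cvars_gchart: "cvars (gchart T) = chart_vars T"
  by (simp add: grassmannian_chart_def Let_def chart_vars_def)

lemma ccoord_gchart:
  "ccoord (gchart T) V (\<alpha>, t, s) =
    (if (\<alpha>, t, s) \<in> chart_vars T then graph_vec (V \<alpha>) (T \<alpha>) t s else 0)"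
  by (simp add: grassmannian_chart_def Let_def chart_vars_def)

lemma cdom_gchart:
  assumes "T \<in> frames"
  shows "V \<in> cdom (gchart T) \<longleftrightarrow> V \<in> gpoints \<and> (\<forall>\<alpha>\<in>A. framed (V \<alpha>) (T \<alpha>))"
proof -
  have "framed (V \<alpha>) (T \<alpha>) \<longleftrightarrow> V \<alpha> \<inter> coord_space (S \<alpha> - T \<alpha>) = {0}"
    if "V \<in> gpoints" "\<alpha> \<in> A" for \<alpha>
    using that frames_D[OF assms that(2)] finite_coords
    by (intro framed_iff) (auto simp: PiE_iff grassmannian_def)
  then show ?thesis by (auto simp: grassmannian_chart_def Let_def)
qed

text \<open>The full matrix of frame vectors recovered from chart coordinates, which store only the
  block over \<open>S \<alpha> - T \<alpha>\<close>. The identity block and the zeros are added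
  back, so that formulas with sums need no case distinction.\<close>

definition entry :: "('n \<Rightarrow> 's set) \<Rightarrow> 'n \<Rightarrow> 's \<Rightarrow> 's \<Rightarrow> ('n \<times> 's \<times> 's \<Rightarrow> 'a::field) \<Rightarrow> 'a" where
  "entry T \<alpha> t s x = (if s \<in> T \<alpha> then basis_vec t s else if s \<in> S \<alpha> then x (\<alpha>, t, s) else 0)"

lemma polyfun_entry: "is_subfield k \<Longrightarrow> polyfun k (entry T \<alpha> t s)"
  unfolding entry_def basis_vec_def
  by (cases "s \<in> T \<alpha>"; cases "s \<in> S \<alpha>"; cases "s = t") (auto intro: polyfun_intros)

lemma polyfun_entry_subst:
  "is_subfield k \<Longrightarrow> (\<And>c. polyfun k (\<lambda>z. g z c)) \<Longrightarrow> polyfun k (\<lambda>z. entry T \<alpha> t s (g z))"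
  by (rule polyfun_subst[OF _ polyfun_entry])

lemma graph_vec_entry:
  assumes "T \<in> frames" "V \<in> cdom (gchart T)" "\<alpha> \<in> A" "t \<in> T \<alpha>"
  shows "graph_vec (V \<alpha>) (T \<alpha>) t s = entry T \<alpha> t s (ccoord (gchart T) V)"
proof -
  have F: "framed (V \<alpha>) (T \<alpha>)" and "V \<alpha> \<subseteq> coord_space (S \<alpha>)"
    using assms by (auto simp: cdom_gchart PiE_iff grassmannian_def)
  then have "graph_vec (V \<alpha>) (T \<alpha>) t \<in> coord_space (S \<alpha>)"
    using graph_vec_framed(1)[OF F assms(4)] by blast
  then show ?thesis using graph_vec_framed(2)[OF F assms(4)] assms
    by (auto simp: entry_def ccoord_gchart chart_vars_def coord_space_def)
qed

text \<open>The inverse of the coordinate map. It is defined at every coordinate vector, so each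
  chart of the product of Grassmannians is a full affine space.\<close>

definition graph_family :: "('n \<Rightarrow> 's set) \<Rightarrow> ('n \<times> 's \<times> 's \<Rightarrow> 'a::field) \<Rightarrow> 'n \<Rightarrow> ('s \<Rightarrow> 'a) set" where
  "graph_family T x = (\<lambda>\<alpha>\<in>A. graph_space (S \<alpha>) (T \<alpha>) (\<lambda>t s. x (\<alpha>, t, s)))"

lemma graph_family_cdom:
  assumes "T \<in> frames"
  shows "graph_family T x \<in> cdom (gchart T)"
proof -
  have F: "framed (graph_space (S \<alpha>) (T \<alpha>) (\<lambda>t s. x (\<alpha>, t, s))) (T \<alpha>)" if "\<alpha> \<in> A" for \<alpha>
    using frames_D[OF assms that] by (intro framed_graph_space)
  then have "graph_space (S \<alpha>) (T \<alpha>) (\<lambda>t s. x (\<alpha>, t, s)) \<in> grassmannian (S \<alpha>) (d \<alpha>)"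
    if "\<alpha> \<in> A" for \<alpha>
    using framed_dim[OF F[OF that]] frames_D[OF assms that] that
    by (auto simp: grassmannian_def framed_def graph_space_def)
  then show ?thesis using F by (auto simp: cdom_gchart[OF assms] graph_family_def)
qed

lemma ccoord_graph_family:
  assumes "T \<in> frames" "x \<in> coord_space (chart_vars T)"
  shows "ccoord (gchart T) (graph_family T x) = x"
proof
  fix j :: "'n \<times> 's \<times> 's"
  obtain \<alpha> t s where [simp]: "j = (\<alpha>, t, s)" by (cases j)
  show "ccoord (gchart T) (graph_family T x) j = x j"
  proof (cases "j \<in> chart_vars T")
    case True
    then have *: "\<alpha> \<in> A" "t \<in> T \<alpha>" "s \<in> S \<alpha> - T \<alpha>" by (auto simp: chart_vars_def)
    then show ?thesis
      using True graph_vec_graph_space[of "T \<alpha>" "S \<alpha>" t s "\<lambda>t s. x (\<alpha>, t, s)"] frames_D[OF assms(1) *(1)]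
      by (auto simp: ccoord_gchart graph_family_def)
  next
    case False
    then show ?thesis using assms(2) by (simp add: ccoord_gchart coord_space_def)
  qed
qed

lemma graph_family_ccoord:
  assumes "T \<in> frames" "V \<in> cdom (gchart T)"
  shows "graph_family T (ccoord (gchart T) V) = V"
proof
  fix \<alpha>
  have V: "V \<in> gpoints" "\<forall>\<alpha>\<in>A. framed (V \<alpha>) (T \<alpha>)" using assms by (auto simp: cdom_gchart)
  show "graph_family T (ccoord (gchart T) V) \<alpha> = V \<alpha>"
  proof (cases "\<alpha> \<in> A")
    case True
    then have "graph_space (S \<alpha>) (T \<alpha>) (\<lambda>t s. ccoord (gchart T) V (\<alpha>, t, s)) = V \<alpha>"
      using V frames_D[OF assms(1) True]
      by (intro graph_space_graph_vec)
        (auto simp: ccoord_gchart chart_vars_def PiE_iff grassmannian_def)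
    then show ?thesis using True by (simp add: graph_family_def)
  next
    case False
    then show ?thesis using V by (auto simp: graph_family_def PiE_def extensional_def)
  qed
qed

lemma ccoord_in: "ccoord (gchart T) V \<in> coord_space (chart_vars T)"
  by (auto simp: coord_space_def ccoord_gchart)

text \<open>As the chart is a full affine space, a subset described by a condition on coordinates
  has as its image all solutions of that condition.\<close>

lemma image_ccoord:
  assumes T: "T \<in> frames" and P: "\<And>V. V \<in> cdom (gchart T) \<Longrightarrow> V \<in> Z \<longleftrightarrow> P (ccoord (gchart T) V)"
  shows "ccoord (gchart T) ` (cdom (gchart T) \<inter> Z) = {x \<in> coord_space (chart_vars T). P x}"
proof -
  have "x \<in> ccoord (gchart T) ` (cdom (gchart T) \<inter> Z)" if "x \<in> coord_space (chart_vars T)" "P x" for x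
    using that P[OF graph_family_cdom[OF T]] graph_family_cdom[OF T] ccoord_graph_family[OF T]
    by (metis IntI image_eqI)
  then show ?thesis using P ccoord_in by blast
qed

lemma gpoints_cdom:
  assumes "V \<in> gpoints"
  shows "\<exists>T\<in>frames. V \<in> cdom (gchart T)"
proof -
  have "\<exists>t. t \<subseteq> S \<alpha> \<and> card t = d \<alpha> \<and> framed (V \<alpha>) t" if \<alpha>: "\<alpha> \<in> A" for \<alpha>
  proof -
    have V: "fvs.subspace (V \<alpha>)" "V \<alpha> \<subseteq> coord_space (S \<alpha>)" "fvs.dim (V \<alpha>) = d \<alpha>"
      using assms that by (auto simp: PiE_iff grassmannian_def)
    obtain t where "t \<subseteq> S \<alpha>" "framed (V \<alpha>) t"
      using ex_framed[OF V(1,2) finite_coords[OF \<alpha>]] by blast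
    then show ?thesis using framed_dim V finite_coords[OF \<alpha>] finite_subset by metis
  qed
  then obtain T where T: "\<And>\<alpha>. \<alpha> \<in> A \<Longrightarrow> T \<alpha> \<subseteq> S \<alpha> \<and> card (T \<alpha>) = d \<alpha> \<and> framed (V \<alpha>) (T \<alpha>)"
    by metis
  then have "restrict T A \<in> frames" by (auto simp: frames_def)
  moreover from this have "V \<in> cdom (gchart (restrict T A))"
    using T assms by (auto simp: cdom_gchart)
  ultimately show ?thesis by blast
qed

lemma regular_at_change_chart:
  fixes k :: "'a::field set"
  assumes k: "is_subfield k" and T: "T \<in> frames" "T' \<in> frames"
    and x: "x \<in> cdom (gchart T) \<inter> cdom (gchart T') \<inter> Z"
  shows "regular_at k (Chart (cdom (gchart T) \<inter> Z) (chart_vars T) (ccoord (gchart T)))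
    (Chart (cdom (gchart T') \<inter> Z) (chart_vars T') (ccoord (gchart T'))) (\<lambda>y. y) x"
proof -
  let ?c = "ccoord (gchart T) :: _ \<Rightarrow> _ \<Rightarrow> 'a" and ?X = "cdom (gchart T) \<inter> Z"
  have "\<forall>\<alpha>\<in>A. \<exists>q p. polyfun k q \<and> (\<forall>t s. polyfun k (p t s)) \<and> q (?c x) \<noteq> 0 \<and>
     (\<forall>y\<in>?X. q (?c y) \<noteq> 0 \<longrightarrow> framed (y \<alpha>) (T' \<alpha>) \<and>
        (\<forall>t\<in>T' \<alpha>. \<forall>s. graph_vec (y \<alpha>) (T' \<alpha>) t s = p t s (?c y) / q (?c y)))"
  proof
    fix \<alpha> assume \<alpha>: "\<alpha> \<in> A"
    show "\<exists>q p. polyfun k q \<and> (\<forall>t s. polyfun k (p t s)) \<and> q (?c x) \<noteq> 0 \<and>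
     (\<forall>y\<in>?X. q (?c y) \<noteq> 0 \<longrightarrow> framed (y \<alpha>) (T' \<alpha>) \<and>
        (\<forall>t\<in>T' \<alpha>. \<forall>s. graph_vec (y \<alpha>) (T' \<alpha>) t s = p t s (?c y) / q (?c y)))"
    proof (rule graph_vec_change_frame[where e = "entry T \<alpha>" and V = "\<lambda>y. y \<alpha>" and T = "T \<alpha>"])
      show "polyfun k (entry T \<alpha> t s)" for t s by (rule polyfun_entry[OF k])
      show "framed (y \<alpha>) (T \<alpha>)" if "y \<in> ?X" for y
        using that \<alpha> by (simp add: cdom_gchart T)
      show "graph_vec (y \<alpha>) (T \<alpha>) t s = entry T \<alpha> t s (?c y)" if "y \<in> ?X" "t \<in> T \<alpha>" for y t s
        using that by (intro graph_vec_entry T \<alpha>) auto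
    qed (use k x \<alpha> frames_D(3)[OF T(1) \<alpha>] frames_D(3)[OF T(2) \<alpha>] in \<open>auto simp: cdom_gchart T\<close>)
  qed
  then obtain q p where q: "\<And>\<alpha>. \<alpha> \<in> A \<Longrightarrow> polyfun k (q \<alpha>) \<and> q \<alpha> (?c x) \<noteq> 0"
    and p: "\<And>\<alpha> t s. \<alpha> \<in> A \<Longrightarrow> polyfun k (p \<alpha> t s)"
    and qp: "\<And>\<alpha> y. \<alpha> \<in> A \<Longrightarrow> y \<in> ?X \<Longrightarrow> q \<alpha> (?c y) \<noteq> 0 \<Longrightarrow> framed (y \<alpha>) (T' \<alpha>) \<and>
        (\<forall>t\<in>T' \<alpha>. \<forall>s. graph_vec (y \<alpha>) (T' \<alpha>) t s = p \<alpha> t s (?c y) / q \<alpha> (?c y))"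
    by metis
  \<comment> \<open>Each of the finitely many components comes with its own denominator. Their
    product is used for all of them, and the numerators of the component \<open>\<alpha>\<close> are
    multiplied by the remaining factors.\<close>
  define P where "P = (\<lambda>(\<alpha>, t, s) z. if \<alpha> \<in> A then p \<alpha> t s z * (\<Prod>\<beta>\<in>A - {\<alpha>}. q \<beta> z) else 0)"
  show ?thesis
  proof (rule regular_atI[where q = "\<lambda>z. \<Prod>\<alpha>\<in>A. q \<alpha> z" and p = P], goal_cases)
    case 1 then show ?case using x by simp
  next
    case 2 then show ?case using q by (intro polyfun_prod k) auto
  next
    case (3 j)
    obtain \<alpha> t s where "j = (\<alpha>, t, s)" by (cases j)
    then show ?case using p q
      by (cases "\<alpha> \<in> A") (auto simp: P_def intro!: polyfun_intros k)
  next
    case 4 then show ?case using q finite_index by simp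
  next
    case (5 y)
    then have "\<forall>\<alpha>\<in>A. q \<alpha> (?c y) \<noteq> 0" using finite_index by simp
    then show ?case using 5(1) qp by (auto simp: cdom_gchart T)
  next
    case (6 y j)
    then have nz: "\<forall>\<alpha>\<in>A. q \<alpha> (?c y) \<noteq> 0" using finite_index by simp
    obtain \<alpha> t s where j: "j = (\<alpha>, t, s)" by (cases j)
    then have \<alpha>: "\<alpha> \<in> A" "t \<in> T' \<alpha>" "j \<in> chart_vars T'"
      using 6(3) by (auto simp: cvars_gchart chart_vars_def)
    have "(\<Prod>\<alpha>\<in>A. q \<alpha> (?c y)) = q \<alpha> (?c y) * (\<Prod>\<beta>\<in>A - {\<alpha>}. q \<beta> (?c y))"
      by (rule prod.remove[OF finite_index \<alpha>(1)])
    moreover have "(\<Prod>\<beta>\<in>A - {\<alpha>}. q \<beta> (?c y)) \<noteq> 0" using nz finite_index by simp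
    moreover have "graph_vec (y \<alpha>) (T' \<alpha>) t s = p \<alpha> t s (?c y) / q \<alpha> (?c y)"
      using qp[of \<alpha> y] \<alpha> nz 6(1) by simp
    ultimately show ?case
      using \<alpha> j by (simp add: ccoord_gchart P_def)
  qed
qed

text \<open>\<open>R\<close> lists required inclusions between components and \<open>Q\<close> the
  components prescribed to be coordinate subspaces. Brick manifolds are of this form, and nothing
  else about them enters the proof that they are varieties.\<close>

definition closed_locus :: "('n \<times> 'n) set \<Rightarrow> ('n \<times> 's set) set \<Rightarrow> ('n \<Rightarrow> ('s \<Rightarrow> 'a::field) set) set" where
  "closed_locus R Q = {V \<in> gpoints. (\<forall>(\<alpha>, \<beta>)\<in>R. V \<alpha> \<subseteq> V \<beta>) \<and> (\<forall>(\<alpha>, U)\<in>Q. V \<alpha> = coord_space U)}"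

definition inclusion_eq ::
  "('n \<Rightarrow> 's set) \<Rightarrow> 'n \<Rightarrow> 'n \<Rightarrow> 's \<Rightarrow> 's \<Rightarrow> ('n \<times> 's \<times> 's \<Rightarrow> 'a::field) \<Rightarrow> 'a" where
  "inclusion_eq T \<alpha> \<beta> t s x =
     entry T \<alpha> t s x - (\<Sum>u\<in>T \<beta>. entry T \<alpha> t u x * entry T \<beta> u s x)"

text \<open>The second family consists of constants. In a chart whose frame differs from a
  prescribed index set it contributes the equation \<open>1 = 0\<close>, since the locus does not
  meet that chart.\<close>

definition locus_eqs ::
  "('n \<times> 'n) set \<Rightarrow> ('n \<times> 's set) set \<Rightarrow> ('n \<Rightarrow> 's set) \<Rightarrow> (('n \<times> 's \<times> 's \<Rightarrow> 'a::field) \<Rightarrow> 'a) set" where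
  "locus_eqs R Q T =
    (\<lambda>(\<alpha>, \<beta>, t, s). inclusion_eq T \<alpha> \<beta> t s) ` {(\<alpha>, \<beta>, t, s). (\<alpha>, \<beta>) \<in> R \<and> t \<in> T \<alpha>} \<union>
    (\<lambda>(\<alpha>, U) x. if T \<alpha> = U then 0 else 1) ` Q \<union>
    (\<lambda>(\<alpha>, U, t, s). entry T \<alpha> t s) ` {(\<alpha>, U, t, s). (\<alpha>, U) \<in> Q \<and> t \<in> T \<alpha> \<and> s \<notin> U}"

lemma polyfun_inclusion_eq: "is_subfield k \<Longrightarrow> polyfun k (inclusion_eq T \<alpha> \<beta> t s)"
  unfolding inclusion_eq_def by (intro polyfun_intros polyfun_entry)

lemma polyfun_locus_eqs: "is_subfield k \<Longrightarrow> f \<in> locus_eqs R Q T \<Longrightarrow> polyfun k f"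
  unfolding locus_eqs_def by (auto intro: polyfun_inclusion_eq polyfun_entry polyfun_0 polyfun_1)

lemma closed_locus_iff:
  fixes V :: "'n \<Rightarrow> ('s \<Rightarrow> 'a::field) set"
  assumes RQ: "R \<subseteq> A \<times> A" "Q \<subseteq> A \<times> UNIV" and T: "T \<in> frames" and V: "V \<in> cdom (gchart T)"
  shows "V \<in> closed_locus R Q \<longleftrightarrow> (\<forall>f\<in>locus_eqs R Q T. f (ccoord (gchart T) V) = 0)"
proof -
  let ?c = "ccoord (gchart T) V"
  have F: "framed (V \<alpha>) (T \<alpha>)" "finite (T \<alpha>)" if "\<alpha> \<in> A" for \<alpha>
    using V that frames_D[OF T that] by (auto simp: cdom_gchart[OF T])
  note g = graph_vec_entry[OF T V]
  have 1: "V \<alpha> \<subseteq> V \<beta> \<longleftrightarrow> (\<forall>t\<in>T \<alpha>. \<forall>s. entry T \<alpha> t s ?c - (\<Sum>u\<in>T \<beta>. entry T \<alpha> t u ?c * entry T \<beta> u s ?c) = 0)"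
    if "(\<alpha>, \<beta>) \<in> R" for \<alpha> \<beta>
  proof -
    have ab: "\<alpha> \<in> A" "\<beta> \<in> A" using that RQ by auto
    show ?thesis
      by (simp add: framed_subset_iff[OF F[OF ab(1)] F[OF ab(2)]] g ab cong: sum.cong)
  qed
  have 2: "V \<alpha> = coord_space U \<longleftrightarrow> T \<alpha> = U \<and> (\<forall>t\<in>T \<alpha>. \<forall>s. s \<notin> U \<longrightarrow> entry T \<alpha> t s ?c = 0)"
    if "(\<alpha>, U) \<in> Q" for \<alpha> U
  proof -
    have a: "\<alpha> \<in> A" using that RQ by auto
    show ?thesis by (simp add: framed_eq_coord_space_iff[OF F[OF a]] g a)
  qed
  have "V \<in> closed_locus R Q \<longleftrightarrow>
      (\<forall>\<alpha> \<beta>. (\<alpha>, \<beta>) \<in> R \<longrightarrow> V \<alpha> \<subseteq> V \<beta>) \<and> (\<forall>\<alpha> U. (\<alpha>, U) \<in> Q \<longrightarrow> V \<alpha> = coord_space U)"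
    using V by (simp add: closed_locus_def cdom_gchart[OF T] Ball_def split_paired_All)
  also have "(\<forall>\<alpha> \<beta>. (\<alpha>, \<beta>) \<in> R \<longrightarrow> V \<alpha> \<subseteq> V \<beta>) \<longleftrightarrow>
      (\<forall>\<alpha> \<beta>. (\<alpha>, \<beta>) \<in> R \<longrightarrow> (\<forall>t\<in>T \<alpha>. \<forall>s. inclusion_eq T \<alpha> \<beta> t s ?c = 0))"
    unfolding inclusion_eq_def by (intro iff_allI imp_cong refl 1)
  also have "(\<forall>\<alpha> U. (\<alpha>, U) \<in> Q \<longrightarrow> V \<alpha> = coord_space U) \<longleftrightarrow>
      (\<forall>\<alpha> U. (\<alpha>, U) \<in> Q \<longrightarrow> T \<alpha> = U \<and> (\<forall>t\<in>T \<alpha>. \<forall>s. s \<notin> U \<longrightarrow> entry T \<alpha> t s ?c = 0))"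
    by (intro iff_allI imp_cong refl 2)
  also have "\<dots> \<longleftrightarrow> (\<forall>\<alpha> U. (\<alpha>, U) \<in> Q \<longrightarrow> (if T \<alpha> = U then 0 else 1) = (0 :: 'a)) \<and>
      (\<forall>\<alpha> U. (\<alpha>, U) \<in> Q \<longrightarrow> (\<forall>t\<in>T \<alpha>. \<forall>s. s \<notin> U \<longrightarrow> entry T \<alpha> t s ?c = 0))"
    by (auto split: if_splits)
  finally show ?thesis
    unfolding locus_eqs_def ball_Un ball_simps
    by (simp only: Ball_def split_paired_All mem_Collect_eq prod.case) blast
qed

text \<open>A point of the first chart and one of the second coincide exactly if their components
  are contained in each other, and both inclusions are polynomial in the joint coordinates. The
  equations of the locus are then needed in one chart only.\<close>

lemma diagonal_closed:
  fixes k :: "'a::field set"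
  assumes k: "is_subfield k" and RQ: "R \<subseteq> A \<times> A" "Q \<subseteq> A \<times> UNIV" and T: "T \<in> frames" "T' \<in> frames"
  defines "Z \<equiv> closed_locus R Q"
  shows "affine_closed k (chart_vars T <+> chart_vars T')
    ((\<lambda>x. case_sum (ccoord (gchart T) x) (ccoord (gchart T') x :: _ \<Rightarrow> 'a)) `
      (cdom (gchart T) \<inter> Z \<inter> (cdom (gchart T') \<inter> Z)))"
proof -
  \<comment> \<open>\<open>L\<close> and \<open>R'\<close> read off the coordinates in the first and
    in the second chart; \<open>D\<close> and \<open>D'\<close> express the two inclusions.\<close>
  define L where "L = (\<lambda>(z :: ('n \<times> 's \<times> 's) + ('n \<times> 's \<times> 's) \<Rightarrow> 'a) j. z (Inl j))"
  define R' where "R' = (\<lambda>(z :: ('n \<times> 's \<times> 's) + ('n \<times> 's \<times> 's) \<Rightarrow> 'a) j. z (Inr j))"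
  define D where "D = (\<lambda>\<alpha> t s z.
      entry T \<alpha> t s (L z) - (\<Sum>u\<in>T' \<alpha>. entry T \<alpha> t u (L z) * entry T' \<alpha> u s (R' z)))"
  define D' where "D' = (\<lambda>\<alpha> t s z.
      entry T' \<alpha> t s (R' z) - (\<Sum>u\<in>T \<alpha>. entry T' \<alpha> t u (R' z) * entry T \<alpha> u s (L z)))"
  define G where "G = (\<lambda>(\<alpha>, t, s). D \<alpha> t s) ` {(\<alpha>, t, s). \<alpha> \<in> A \<and> t \<in> T \<alpha>} \<union>
    (\<lambda>(\<alpha>, t, s). D' \<alpha> t s) ` {(\<alpha>, t, s). \<alpha> \<in> A \<and> t \<in> T' \<alpha>} \<union>
    (\<lambda>f z. f (L z)) ` locus_eqs R Q T"
  have LR: "polyfun k (\<lambda>z. L z j)" "polyfun k (\<lambda>z. R' z j)" for j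
    unfolding L_def R'_def by (intro polyfun_intros k)+
  have "polyfun k (D \<alpha> t s)" "polyfun k (D' \<alpha> t s)" for \<alpha> t s
    unfolding D_def D'_def by (intro polyfun_intros polyfun_entry_subst LR k)+
  then have G: "polyfun k f" if "f \<in> G" for f
    using that polyfun_subst[OF k polyfun_locus_eqs[OF k] LR(1)] unfolding G_def by auto
  have eq: "V = W \<longleftrightarrow>
      (\<forall>\<alpha>\<in>A. \<forall>t\<in>T \<alpha>. \<forall>s. entry T \<alpha> t s (ccoord (gchart T) V) =
        (\<Sum>u\<in>T' \<alpha>. entry T \<alpha> t u (ccoord (gchart T) V) * entry T' \<alpha> u s (ccoord (gchart T') W))) \<and>
      (\<forall>\<alpha>\<in>A. \<forall>t\<in>T' \<alpha>. \<forall>s. entry T' \<alpha> t s (ccoord (gchart T') W) =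
        (\<Sum>u\<in>T \<alpha>. entry T' \<alpha> t u (ccoord (gchart T') W) * entry T \<alpha> u s (ccoord (gchart T) V)))"
    if V: "V \<in> cdom (gchart T)" and W: "W \<in> cdom (gchart T')" for V W :: "'n \<Rightarrow> ('s \<Rightarrow> 'a) set"
  proof -
    have FV: "framed (V \<alpha>) (T \<alpha>)" "finite (T \<alpha>)" and FW: "framed (W \<alpha>) (T' \<alpha>)" "finite (T' \<alpha>)"
      if "\<alpha> \<in> A" for \<alpha>
      using V W that frames_D[OF T(1) that] frames_D[OF T(2) that] by (auto simp: cdom_gchart T)
    have "V = W \<longleftrightarrow> (\<forall>\<alpha>\<in>A. V \<alpha> \<subseteq> W \<alpha>) \<and> (\<forall>\<alpha>\<in>A. W \<alpha> \<subseteq> V \<alpha>)"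
    proof -
      have "V \<in> gpoints" "W \<in> gpoints" using V W by (auto simp: cdom_gchart T)
      then have "V = W \<longleftrightarrow> (\<forall>\<alpha>\<in>A. V \<alpha> = W \<alpha>)" using PiE_ext[of V A _ W] by blast
      then show ?thesis by blast
    qed
    also have "(\<forall>\<alpha>\<in>A. V \<alpha> \<subseteq> W \<alpha>) \<longleftrightarrow>
      (\<forall>\<alpha>\<in>A. \<forall>t\<in>T \<alpha>. \<forall>s. entry T \<alpha> t s (ccoord (gchart T) V) =
        (\<Sum>u\<in>T' \<alpha>. entry T \<alpha> t u (ccoord (gchart T) V) * entry T' \<alpha> u s (ccoord (gchart T') W)))"
      by (intro ball_cong refl)
        (simp add: framed_subset_iff[OF FV FW] graph_vec_entry[OF T(1) V] graph_vec_entry[OF T(2) W]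
          cong: sum.cong)
    also have "(\<forall>\<alpha>\<in>A. W \<alpha> \<subseteq> V \<alpha>) \<longleftrightarrow>
      (\<forall>\<alpha>\<in>A. \<forall>t\<in>T' \<alpha>. \<forall>s. entry T' \<alpha> t s (ccoord (gchart T') W) =
        (\<Sum>u\<in>T \<alpha>. entry T' \<alpha> t u (ccoord (gchart T') W) * entry T \<alpha> u s (ccoord (gchart T) V)))"
      by (intro ball_cong refl)
        (simp add: framed_subset_iff[OF FW FV] graph_vec_entry[OF T(1) V] graph_vec_entry[OF T(2) W]
          cong: sum.cong)
    finally show ?thesis .
  qed
  let ?e = "\<lambda>V W. case_sum (ccoord (gchart T) V) (ccoord (gchart T') W :: _ \<Rightarrow> 'a)"
  have LR_e: "L (?e V W) = ccoord (gchart T) V" "R' (?e V W) = ccoord (gchart T') W" for V W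
    by (auto simp: L_def R'_def)
  have key: "(\<forall>f\<in>G. f (?e V W) = 0) \<longleftrightarrow> V = W \<and> V \<in> Z"
    if V: "V \<in> cdom (gchart T)" and W: "W \<in> cdom (gchart T')" for V W
  proof -
    have 1: "V = W \<longleftrightarrow> (\<forall>\<alpha>\<in>A. \<forall>t\<in>T \<alpha>. \<forall>s. D \<alpha> t s (?e V W) = 0) \<and>
        (\<forall>\<alpha>\<in>A. \<forall>t\<in>T' \<alpha>. \<forall>s. D' \<alpha> t s (?e V W) = 0)"
      unfolding D_def D'_def LR_e right_minus_eq by (rule eq[OF V W])
    have 2: "(\<forall>f\<in>(\<lambda>(\<alpha>, t, s). E \<alpha> t s) ` {(\<alpha>, t, s). \<alpha> \<in> A \<and> t \<in> U \<alpha>}. f z = 0) \<longleftrightarrow>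
        (\<forall>\<alpha>\<in>A. \<forall>t\<in>U \<alpha>. \<forall>s. E \<alpha> t s z = 0)" for E :: "_ \<Rightarrow> _ \<Rightarrow> _ \<Rightarrow> _ \<Rightarrow> 'a" and U z
      by (simp only: ball_simps) (simp only: Ball_def split_paired_All mem_Collect_eq prod.case, blast)
    have 3: "(\<forall>f\<in>(\<lambda>f z. f (L z)) ` locus_eqs R Q T. f (?e V W) = 0) \<longleftrightarrow>
        (\<forall>f\<in>locus_eqs R Q T. f (ccoord (gchart T) V) = 0)"
      by (simp add: LR_e)
    have "(\<forall>f\<in>G. f (?e V W) = 0) \<longleftrightarrow>
        V = W \<and> (\<forall>f\<in>locus_eqs R Q T. f (ccoord (gchart T) V) = 0)"
      by (simp only: G_def ball_Un 2 3 1)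
    then show ?thesis unfolding Z_def closed_locus_iff[OF RQ T(1) V] .
  qed
  have "z \<in> (\<lambda>x. ?e x x) ` (cdom (gchart T) \<inter> Z \<inter> (cdom (gchart T') \<inter> Z))"
    if z: "z \<in> coord_space (chart_vars T <+> chart_vars T')" "\<forall>f\<in>G. f z = 0" for z
  proof -
    have "L z \<in> coord_space (chart_vars T)" "R' z \<in> coord_space (chart_vars T')"
      using z(1) by (auto simp: L_def R'_def coord_space_def)
    \<comment> \<open>Any solution comes from a pair of points, one in each chart, rebuilt from its
      two halves; the equations force these points to be equal.\<close>
    then have "?e (graph_family T (L z)) (graph_family T' (R' z)) = z"
      by (auto simp: fun_eq_iff ccoord_graph_family T L_def R'_def split: sum.splits)
    note e = this
    have "(\<forall>f\<in>G. f (?e (graph_family T (L z)) (graph_family T' (R' z))) = 0)"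
      unfolding e by (rule z(2))
    then have VW: "graph_family T (L z) = graph_family T' (R' z)" "graph_family T (L z) \<in> Z"
      unfolding key[OF graph_family_cdom[OF T(1)] graph_family_cdom[OF T(2)]] by auto
    show ?thesis
    proof (rule image_eqI)
      show "z = ?e (graph_family T (L z)) (graph_family T (L z))" using e VW(1) by simp
      show "graph_family T (L z) \<in> cdom (gchart T) \<inter> Z \<inter> (cdom (gchart T') \<inter> Z)"
        using VW graph_family_cdom[OF T(1), of "L z"] graph_family_cdom[OF T(2), of "R' z"] by simp
    qed
  qed
  moreover have "?e x x \<in> coord_space (chart_vars T <+> chart_vars T')" for x
    by (auto simp: coord_space_def ccoord_gchart split: sum.splits)
  moreover have "\<forall>f\<in>G. f (?e x x) = 0" if "x \<in> cdom (gchart T) \<inter> Z \<inter> (cdom (gchart T') \<inter> Z)" for x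
    using that by (subst key) auto
  ultimately have "(\<lambda>x. ?e x x) ` (cdom (gchart T) \<inter> Z \<inter> (cdom (gchart T') \<inter> Z)) =
      {z \<in> coord_space (chart_vars T <+> chart_vars T'). \<forall>f\<in>G. f z = 0}"
    by (intro equalityI subsetI) auto
  from affine_closedI[OF G this] show ?thesis .
qed

lemma is_variety_closed_locus:
  fixes k :: "'a::field set"
  assumes k: "is_subfield k" and RQ: "R \<subseteq> A \<times> A" "Q \<subseteq> A \<times> UNIV"
  shows "is_variety k (subvariety (grassmannian_product A S d) (closed_locus R Q) ::
    ('n \<Rightarrow> ('s \<Rightarrow> 'a) set, _, 'a) variety)"
proof -
  let ?Z = "closed_locus R Q :: ('n \<Rightarrow> ('s \<Rightarrow> 'a) set) set"
  let ?X = "subvariety (grassmannian_product A S d) ?Z"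
  let ?C = "\<lambda>T. Chart (cdom (gchart T) \<inter> ?Z) (chart_vars T) (ccoord (gchart T))"
  have atlas: "atlas ?X = ?C ` frames"
    by (auto simp: subvariety_def grassmannian_product_def frames_def cvars_gchart)
  have points: "points ?X = ?Z" by (simp add: subvariety_def)
  have 1: "points ?X = (\<Union>C\<in>atlas ?X. cdom C)"
    unfolding points atlas using gpoints_cdom by (fastforce simp: closed_locus_def)
  have 2: "inj_on (ccoord (?C T)) (cdom (?C T))" if "T \<in> frames" for T
    by (rule inj_on_inverseI[of _ "graph_family T"]) (use that graph_family_ccoord in auto)
  have 3: "affine_closed k (cvars (?C T)) (ccoord (?C T) ` cdom (?C T))" if "T \<in> frames" for T
    by (rule affine_closedI[of "locus_eqs R Q T"])
      (use polyfun_locus_eqs[OF k] image_ccoord[OF that closed_locus_iff[OF RQ that]] in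
        \<open>auto simp: cvars_gchart\<close>)
  have 4: "regular_at k (?C T) (?C T') (\<lambda>y. y) x"
    if "T \<in> frames" "T' \<in> frames" "x \<in> cdom (?C T) \<inter> cdom (?C T')" for T T' x
    by (rule regular_at_change_chart[OF k]) (use that in auto)
  have 5: "affine_closed k (cvars (?C T) <+> cvars (?C T'))
        ((\<lambda>x. case_sum (ccoord (?C T) x) (ccoord (?C T') x)) ` (cdom (?C T) \<inter> cdom (?C T')))"
    if "T \<in> frames" "T' \<in> frames" for T T'
    using diagonal_closed[OF k RQ that] by (simp add: cvars_gchart)
  have 6: "finite (cvars (?C T))" if "T \<in> frames" for T
    using finite_chart_vars[OF that] by (simp add: cvars_gchart)
  have "finite (atlas ?X)" unfolding atlas using finite_frames by simp
  moreover note 1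
  moreover have "\<forall>C\<in>atlas ?X. finite (cvars C) \<and> inj_on (ccoord C) (cdom C) \<and>
      affine_closed k (cvars C) (ccoord C ` cdom C)"
    unfolding atlas ball_simps by (intro ballI conjI 2 3 6)
  moreover have "\<forall>C\<in>atlas ?X. \<forall>D\<in>atlas ?X. \<forall>x \<in> cdom C \<inter> cdom D. regular_at k C D (\<lambda>y. y) x"
    unfolding atlas ball_simps by (intro ballI 4)
  moreover have "\<forall>C\<in>atlas ?X. \<forall>D\<in>atlas ?X. affine_closed k (cvars C <+> cvars D)
      ((\<lambda>x. case_sum (ccoord C x) (ccoord D x)) ` (cdom C \<inter> cdom D))"
    unfolding atlas ball_simps by (intro ballI 5)
  ultimately show ?thesis unfolding is_variety_def by (intro conjI)
qed

end

section \<open>Gluing subspaces along injections of coordinates\<close>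

definition cut :: "'s set \<Rightarrow> ('s \<Rightarrow> 'a::zero) \<Rightarrow> 's \<Rightarrow> 'a" where
  "cut S u = (\<lambda>s. if s \<in> S then u s else 0)"

text \<open>Conditions on pullbacks involve no existential quantifier, unlike images. Membership in
  a nested gluing therefore unfolds to conditions on composed pullbacks. The truncation by
  \<open>cut\<close> discards the meaningless values outside the index set.\<close>

definition glue :: "'r set \<Rightarrow> 's set \<Rightarrow> ('s \<Rightarrow> 'r) \<Rightarrow> 't set \<Rightarrow> ('t \<Rightarrow> 'r) \<Rightarrow>
    ('s \<Rightarrow> 'a::zero) set \<Rightarrow> ('t \<Rightarrow> 'a) set \<Rightarrow> ('r \<Rightarrow> 'a) set" where
  "glue S S1 h1 S2 h2 A B =
     {u \<in> coord_space S. cut S1 (\<lambda>s. u (h1 s)) \<in> A \<and> cut S2 (\<lambda>s. u (h2 s)) \<in> B}"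

lemma glue_mono: "A \<subseteq> A' \<Longrightarrow> B \<subseteq> B' \<Longrightarrow> glue S S1 h1 S2 h2 A B \<subseteq> glue S S1 h1 S2 h2 A' B'"
  by (auto simp: glue_def)

lemma glue_subset: "glue S S1 h1 S2 h2 A B \<subseteq> coord_space S"
  by (auto simp: glue_def)

lemma push_apply:
  assumes "finite S" "inj_on h S"
  shows "(\<Sum>g\<in>S. fscale (v g) (basis_vec (h g))) s = (if s \<in> h ` S then v (inv_into S h s) else (0::'a::field))"
proof (cases "s \<in> h ` S")
  case True
  then obtain r where r: "r \<in> S" "s = h r" by blast
  have "(\<Sum>g\<in>S. fscale (v g) (basis_vec (h g))) s = (\<Sum>g\<in>S. if r = g then v g else 0)"
    unfolding sum_fun_apply
    by (rule sum.cong) (use r assms(2) in \<open>auto simp: fscale_def basis_vec_def inj_on_def\<close>)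
  then show ?thesis using r assms by simp
next
  case False
  then have "(\<Sum>g\<in>S. fscale (v g) (basis_vec (h g))) s = 0"
    unfolding sum_fun_apply
    by (intro sum.neutral) (auto simp: fscale_def basis_vec_def)
  then show ?thesis using False by simp
qed

locale gluing =
  fixes S :: "'r set" and S1 :: "'s set" and h1 :: "'s \<Rightarrow> 'r" and S2 :: "'t set" and h2 :: "'t \<Rightarrow> 'r"
  assumes fin: "finite S1" "finite S2" and inj: "inj_on h1 S1" "inj_on h2 S2"
    and disj: "h1 ` S1 \<inter> h2 ` S2 = {}" and S: "S = h1 ` S1 \<union> h2 ` S2"
begin

text \<open>The explicit isomorphism from pairs of vectors to vectors on \<open>S\<close>; its
  inverse is the pair of truncated pullbacks.\<close>

definition join :: "('s \<Rightarrow> 'a::zero) \<Rightarrow> ('t \<Rightarrow> 'a) \<Rightarrow> 'r \<Rightarrow> 'a" where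
  "join v w r = (if r \<in> h1 ` S1 then v (inv_into S1 h1 r)
     else if r \<in> h2 ` S2 then w (inv_into S2 h2 r) else 0)"

lemma join_simps:
  "s \<in> S1 \<Longrightarrow> join v w (h1 s) = v s" "t \<in> S2 \<Longrightarrow> join v w (h2 t) = w t"
  "r \<notin> S \<Longrightarrow> join v w r = 0"
  using inj disj S by (auto simp: join_def)

lemma cut_join:
  assumes "v \<in> coord_space S1" "w \<in> coord_space S2"
  shows "cut S1 (\<lambda>s. join v w (h1 s)) = v" "cut S2 (\<lambda>s. join v w (h2 s)) = w"
  using assms by (auto simp: cut_def fun_eq_iff join_simps coord_space_def)

lemma join_in_glue:
  assumes "v \<in> A" "w \<in> B" "A \<subseteq> coord_space S1" "B \<subseteq> coord_space S2"
  shows "join v w \<in> glue S S1 h1 S2 h2 A B"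
proof -
  have "v \<in> coord_space S1" "w \<in> coord_space S2" using assms by auto
  note c = cut_join[OF this]
  have "join v w \<in> coord_space S" by (simp add: coord_space_def join_simps)
  then show ?thesis using assms(1,2) unfolding glue_def mem_Collect_eq c by blast
qed

lemma join_cut:
  assumes "u \<in> coord_space S"
  shows "join (cut S1 (\<lambda>s. u (h1 s))) (cut S2 (\<lambda>s. u (h2 s))) = u"
proof
  fix r show "join (cut S1 (\<lambda>s. u (h1 s))) (cut S2 (\<lambda>s. u (h2 s))) r = u r"
  proof (cases "r \<in> S")
    case True then show ?thesis using S by (auto simp: join_simps cut_def)
  next
    case False then show ?thesis using assms by (simp add: join_simps coord_space_def)
  qed
qed

lemma push_eq_join:
  fixes v :: "'s \<Rightarrow> 'a::field"
  shows "(\<Sum>g\<in>S1. fscale (v g) (basis_vec (h1 g))) + (\<Sum>g\<in>S2. fscale (w g) (basis_vec (h2 g))) = join v w"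
  using disj by (auto simp: fun_eq_iff push_apply fin inj join_def)

text \<open>The link from the images in the definitions of the composition and of the relabelling to
  gluing. Without the containments the truncated pullback of the image of a member of
  \<open>A\<close> could fall outside \<open>A\<close>.\<close>

lemma image_eq_glue:
  fixes A :: "('s \<Rightarrow> 'a::field) set"
  assumes "A \<subseteq> coord_space S1" "B \<subseteq> coord_space S2"
  shows "(\<lambda>(v, w). (\<Sum>g\<in>S1. fscale (v g) (basis_vec (h1 g))) +
      (\<Sum>g\<in>S2. fscale (w g) (basis_vec (h2 g)))) ` (A \<times> B) = glue S S1 h1 S2 h2 A B"
  unfolding push_eq_join
proof
  show "(\<lambda>(v, w). join v w) ` (A \<times> B) \<subseteq> glue S S1 h1 S2 h2 A B"
    using assms join_in_glue by auto
  show "glue S S1 h1 S2 h2 A B \<subseteq> (\<lambda>(v, w). join v w) ` (A \<times> B)"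
  proof
    fix u assume u: "u \<in> glue S S1 h1 S2 h2 A B"
    then have "u \<in> coord_space S" and AB: "cut S1 (\<lambda>s. u (h1 s)) \<in> A" "cut S2 (\<lambda>s. u (h2 s)) \<in> B"
      by (auto simp: glue_def)
    then have "u = join (cut S1 (\<lambda>s. u (h1 s))) (cut S2 (\<lambda>s. u (h2 s)))"
      using join_cut[symmetric] by blast
    then show "u \<in> (\<lambda>(v, w). join v w) ` (A \<times> B)"
      using AB by (intro image_eqI[of _ _ "(cut S1 (\<lambda>s. u (h1 s)), cut S2 (\<lambda>s. u (h2 s)))"]) auto
  qed
qed

lemma glue_coord_space:
  assumes "P \<subseteq> S1" "Q \<subseteq> S2"
  shows "glue S S1 h1 S2 h2 (coord_space P) (coord_space Q) =
    (coord_space (h1 ` P \<union> h2 ` Q) :: ('r \<Rightarrow> 'b::zero) set)"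
proof -
  have *: "h1 s \<in> h1 ` P \<union> h2 ` Q \<longleftrightarrow> s \<in> P" if "s \<in> S1" for s
    using that inj_on_image_mem_iff[OF inj(1) that assms(1)] disj assms by blast
  have **: "h2 s \<in> h1 ` P \<union> h2 ` Q \<longleftrightarrow> s \<in> Q" if "s \<in> S2" for s
    using that inj_on_image_mem_iff[OF inj(2) that assms(2)] disj assms by blast
  have ***: "h1 ` P \<union> h2 ` Q \<subseteq> S" using assms S by auto
  show ?thesis
  proof (intro equalityI subsetI)
    fix u :: "'r \<Rightarrow> 'b::zero"
    assume u: "u \<in> glue S S1 h1 S2 h2 (coord_space P) (coord_space Q)"
    have "u r = 0" if r: "r \<notin> h1 ` P \<union> h2 ` Q" for r
    proof (cases "r \<in> S")
      case True
      then consider s where "s \<in> S1" "r = h1 s" "s \<notin> P" | s where "s \<in> S2" "r = h2 s" "s \<notin> Q"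
        using S * ** r by blast
      then show ?thesis
        by cases (use u in \<open>auto simp: glue_def coord_space_def cut_def split: if_splits\<close>)
    next
      case False then show ?thesis using u by (auto simp: glue_def coord_space_def)
    qed
    then show "u \<in> coord_space (h1 ` P \<union> h2 ` Q)" by (auto simp: coord_space_def)
  next
    fix u :: "'r \<Rightarrow> 'b::zero"
    assume "u \<in> coord_space (h1 ` P \<union> h2 ` Q)"
    then have u: "\<And>r. r \<notin> h1 ` P \<union> h2 ` Q \<Longrightarrow> u r = 0" by (simp add: coord_space_def)
    have "u (h1 s) = 0" if "s \<in> S1" "s \<notin> P" for s using u * that by blast
    moreover have "u (h2 s) = 0" if "s \<in> S2" "s \<notin> Q" for s using u ** that by blast
    moreover have "u r = 0" if "r \<notin> S" for r using u *** that by blast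
    ultimately show "u \<in> glue S S1 h1 S2 h2 (coord_space P) (coord_space Q)"
      by (auto simp: glue_def coord_space_def cut_def)
  qed
qed

lemma subspace_glue:
  fixes A :: "('s \<Rightarrow> 'a::field) set"
  assumes "fvs.subspace A" "fvs.subspace B"
  shows "fvs.subspace (glue S S1 h1 S2 h2 A B)"
proof -
  have c1: "cut S1 (\<lambda>s. (0 :: 'r \<Rightarrow> 'a) (h1 s)) = 0" "cut S2 (\<lambda>s. (0 :: 'r \<Rightarrow> 'a) (h2 s)) = 0"
    by (auto simp: cut_def)
  have c2: "cut S1 (\<lambda>s. (x + y) (h1 s)) = cut S1 (\<lambda>s. x (h1 s)) + cut S1 (\<lambda>s. y (h1 s))"
    "cut S2 (\<lambda>s. (x + y) (h2 s)) = cut S2 (\<lambda>s. x (h2 s)) + cut S2 (\<lambda>s. y (h2 s))" for x y :: "'r \<Rightarrow> 'a"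
    by (auto simp: cut_def)
  have c3: "cut S1 (\<lambda>s. fscale c x (h1 s)) = fscale c (cut S1 (\<lambda>s. x (h1 s)))"
    "cut S2 (\<lambda>s. fscale c x (h2 s)) = fscale c (cut S2 (\<lambda>s. x (h2 s)))" for c and x :: "'r \<Rightarrow> 'a"
    by (auto simp: cut_def fscale_def)
  have cs: "fvs.subspace (coord_space S :: ('r \<Rightarrow> 'a) set)"
    using framed_coord_space unfolding framed_def by blast
  show ?thesis
    by (rule fvs.subspaceI)
      (simp_all only: glue_def mem_Collect_eq c1 c2 c3 fvs.subspace_0[OF assms(1)] fvs.subspace_0[OF assms(2)]
        fvs.subspace_0[OF cs] fvs.subspace_add[OF assms(1)] fvs.subspace_add[OF assms(2)] fvs.subspace_add[OF cs]
        fvs.subspace_scale[OF assms(1)] fvs.subspace_scale[OF assms(2)] fvs.subspace_scale[OF cs] simp_thms)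
qed

text \<open>The matrix of a direct sum is block diagonal: the frames are united, and the entries are
  those of the summands, or zero between different blocks. Hence gluing merely copies
  coordinates.\<close>

lemma
  fixes A :: "('s \<Rightarrow> 'a::field) set"
  assumes A: "framed A T1" "A \<subseteq> coord_space S1" "T1 \<subseteq> S1"
    and B: "framed B T2" "B \<subseteq> coord_space S2" "T2 \<subseteq> S2"
  shows framed_glue: "framed (glue S S1 h1 S2 h2 A B) (h1 ` T1 \<union> h2 ` T2)"
    and graph_vec_glue: "t \<in> h1 ` T1 \<union> h2 ` T2 \<Longrightarrow>
      graph_vec (glue S S1 h1 S2 h2 A B) (h1 ` T1 \<union> h2 ` T2) t s =
       (if t \<in> h1 ` S1 \<and> s \<in> h1 ` S1 then graph_vec A T1 (inv_into S1 h1 t) (inv_into S1 h1 s)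
        else if t \<in> h2 ` S2 \<and> s \<in> h2 ` S2 then graph_vec B T2 (inv_into S2 h2 t) (inv_into S2 h2 s)
        else 0)"
proof -
  let ?G = "glue S S1 h1 S2 h2 A B" and ?T = "h1 ` T1 \<union> h2 ` T2"
  have sub: "fvs.subspace A" "fvs.subspace B" using A B by (auto simp: framed_def)
  have zero: "0 \<in> A" "0 \<in> B" using sub fvs.subspace_0 by auto
  have d: "h1 s \<noteq> h2 t" if "s \<in> S1" "t \<in> S2" for s t using disj that by blast
  have i1: "h1 s = h1 t \<longleftrightarrow> s = t" if "s \<in> S1" "t \<in> S1" for s t using inj(1) that by (auto simp: inj_on_def)
  have i2: "h2 s = h2 t \<longleftrightarrow> s = t" if "s \<in> S2" "t \<in> S2" for s t using inj(2) that by (auto simp: inj_on_def)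
  \<comment> \<open>The frame vectors of each summand, extended by zero along the other one.\<close>
  define x1 where "x1 t = join (graph_vec A T1 t) 0" for t
  define x2 where "x2 t = join 0 (graph_vec B T2 t)" for t
  have x1: "x1 t \<in> ?G" if "t \<in> T1" for t
    unfolding x1_def by (rule join_in_glue) (use graph_vec_framed(1)[OF A(1) that] zero A B in auto)
  have x2: "x2 t \<in> ?G" if "t \<in> T2" for t
    unfolding x2_def by (rule join_in_glue) (use graph_vec_framed(1)[OF B(1) that] zero A B in auto)
  have x1T: "x1 t r = basis_vec (h1 t) r" if "t \<in> T1" "r \<in> ?T" for t r
    using that(2)
  proof
    assume "r \<in> h1 ` T1"
    then obtain s where "s \<in> T1" "r = h1 s" by blast
    then show ?thesis
      using that(1) graph_vec_framed(2)[OF A(1) that(1)] i1[of s t] subsetD[OF A(3)]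
      by (simp add: x1_def join_simps basis_vec_def)
  next
    assume "r \<in> h2 ` T2"
    then obtain s where "s \<in> T2" "r = h2 s" by blast
    then show ?thesis
      using that(1) A(3) B(3) d[of t s] subsetD[OF A(3), of t] subsetD[OF B(3), of s]
      by (simp add: x1_def join_simps basis_vec_def)
  qed
  have x2T: "x2 t r = basis_vec (h2 t) r" if "t \<in> T2" "r \<in> ?T" for t r
    using that(2)
  proof
    assume "r \<in> h2 ` T2"
    then obtain s where "s \<in> T2" "r = h2 s" by blast
    then show ?thesis
      using that(1) graph_vec_framed(2)[OF B(1) that(1)] i2[of s t] subsetD[OF B(3)]
      by (simp add: x2_def join_simps basis_vec_def)
  next
    assume "r \<in> h1 ` T1"
    then obtain s where "s \<in> T1" "r = h1 s" by blast
    then show ?thesis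
      using that(1) A(3) B(3) d[of s t] subsetD[OF A(3), of s] subsetD[OF B(3), of t]
      by (simp add: x2_def join_simps basis_vec_def)
  qed
  have dual: "\<exists>v\<in>?G. \<forall>t'\<in>?T. v t' = basis_vec t t'" if "t \<in> ?T" for t
    using that
  proof
    assume "t \<in> h1 ` T1"
    then obtain t' where "t' \<in> T1" "t = h1 t'" by blast
    then show ?thesis using x1T by (intro bexI[OF _ x1[of t']]) auto
  next
    assume "t \<in> h2 ` T2"
    then obtain t' where "t' \<in> T2" "t = h2 t'" by blast
    then show ?thesis using x2T by (intro bexI[OF _ x2[of t']]) auto
  qed
  have inj0: "u = 0" if u: "u \<in> ?G" "\<forall>t\<in>?T. u t = 0" for u
  proof -
    have uS: "u \<in> coord_space S" and AB: "cut S1 (\<lambda>s. u (h1 s)) \<in> A" "cut S2 (\<lambda>s. u (h2 s)) \<in> B"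
      using u(1) by (auto simp: glue_def)
    have "\<forall>t\<in>T1. cut S1 (\<lambda>s. u (h1 s)) t = 0" "\<forall>t\<in>T2. cut S2 (\<lambda>s. u (h2 s)) t = 0"
      using u(2) by (auto simp: cut_def)
    then have "cut S1 (\<lambda>s. u (h1 s)) = 0" "cut S2 (\<lambda>s. u (h2 s)) = 0"
      using A(1) B(1) AB unfolding framed_def by blast+
    then have "join 0 0 = u" using join_cut[OF uS] by simp
    moreover have "join 0 0 = (0 :: 'r \<Rightarrow> 'a)" by (simp add: join_def fun_eq_iff)
    ultimately show ?thesis by simp
  qed
  have "\<forall>t\<in>?T. \<exists>v\<in>?G. \<forall>t'\<in>?T. v t' = basis_vec t t'" by (rule ballI) (rule dual)
  moreover have "\<forall>v\<in>?G. (\<forall>t\<in>?T. v t = 0) \<longrightarrow> v = 0" using inj0 by blast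
  ultimately show F: "framed ?G ?T"
    unfolding framed_def by (intro conjI subspace_glue[OF sub])
  assume t: "t \<in> ?T"
  then consider t' where "t' \<in> T1" "t = h1 t'" | t' where "t' \<in> T2" "t = h2 t'" by blast
  then show "graph_vec ?G ?T t s =
       (if t \<in> h1 ` S1 \<and> s \<in> h1 ` S1 then graph_vec A T1 (inv_into S1 h1 t) (inv_into S1 h1 s)
        else if t \<in> h2 ` S2 \<and> s \<in> h2 ` S2 then graph_vec B T2 (inv_into S2 h2 t) (inv_into S2 h2 s)
        else 0)"
  proof cases
    case 1
    have "graph_vec ?G ?T t = x1 t'"
      by (rule graph_vec_eqI[OF F t x1[OF 1(1)]]) (use x1T[OF 1(1)] 1 in auto)
    moreover have "t' \<in> S1" using 1 A(3) by blast
    moreover from this have "t \<in> h1 ` S1" "t \<notin> h2 ` S2" "inv_into S1 h1 t = t'"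
      using 1 inj disj by (blast, blast, simp)
    ultimately show ?thesis by (simp add: x1_def join_def)
  next
    case 2
    have "graph_vec ?G ?T t = x2 t'"
      by (rule graph_vec_eqI[OF F t x2[OF 2(1)]]) (use x2T[OF 2(1)] 2 in auto)
    moreover have "t' \<in> S2" using 2 B(3) by blast
    moreover from this have "t \<in> h2 ` S2" "t \<notin> h1 ` S1" "inv_into S2 h2 t = t'"
      using 2 inj disj by (blast, blast, simp)
    moreover have "s \<in> h1 ` S1 \<Longrightarrow> s \<notin> h2 ` S2" using disj by blast
    ultimately show ?thesis by (simp add: x2_def join_def)
  qed
qed

lemma dim_glue:
  fixes A :: "('s \<Rightarrow> 'a::field) set"
  assumes A: "fvs.subspace A" "A \<subseteq> coord_space S1" and B: "fvs.subspace B" "B \<subseteq> coord_space S2"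
  shows "fvs.dim (glue S S1 h1 S2 h2 A B) = fvs.dim A + fvs.dim B"
proof -
  obtain T1 where T1: "T1 \<subseteq> S1" "framed A T1" using ex_framed[OF A fin(1)] by blast
  obtain T2 where T2: "T2 \<subseteq> S2" "framed B T2" using ex_framed[OF B fin(2)] by blast
  have f: "finite T1" "finite T2" using T1 T2 fin finite_subset by blast+
  have "fvs.dim (glue S S1 h1 S2 h2 A B) = card (h1 ` T1 \<union> h2 ` T2)"
    by (rule framed_dim[OF framed_glue]) (use T1 T2 A B f in auto)
  also have "\<dots> = card (h1 ` T1) + card (h2 ` T2)"
    by (rule card_Un_disjoint) (use f T1 T2 disj in auto)
  also have "\<dots> = card T1 + card T2"
    using T1 T2 inj by (simp add: card_image inj_on_subset)
  finally show ?thesis using framed_dim[OF T1(2) f(1)] framed_dim[OF T2(2) f(2)] by simp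
qed

end

section \<open>Convex subsets of finite ordinals\<close>

lemma finite_ordinalD:
  assumes "finite_ordinal I"
  shows "finite (Field I)" "Field I \<noteq> {}" "x \<in> Field I \<Longrightarrow> (x, x) \<in> I"
    "(x, y) \<in> I \<Longrightarrow> (y, z) \<in> I \<Longrightarrow> (x, z) \<in> I" "(x, y) \<in> I \<Longrightarrow> (y, x) \<in> I \<Longrightarrow> x = y"
    "x \<in> Field I \<Longrightarrow> y \<in> Field I \<Longrightarrow> (x, y) \<in> I \<or> (y, x) \<in> I"
    "(x, y) \<in> I \<Longrightarrow> x \<in> Field I" "(x, y) \<in> I \<Longrightarrow> y \<in> Field I"
proof -
  have lin: "Linear_order I" using assms by (simp add: finite_ordinal_def)
  then have refl: "refl_on (Field I) I" and trans: "trans I" and antisym: "antisym I"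
    and total: "total_on (Field I) I"
    by (auto simp: order_on_defs)
  show "finite (Field I)" "Field I \<noteq> {}" using assms by (auto simp: finite_ordinal_def)
  show r: "(x, x) \<in> I" if "x \<in> Field I" for x using refl that by (rule refl_onD)
  show "(x, y) \<in> I \<Longrightarrow> (y, z) \<in> I \<Longrightarrow> (x, z) \<in> I" using trans by (rule transD)
  show "(x, y) \<in> I \<Longrightarrow> (y, x) \<in> I \<Longrightarrow> x = y" using antisym by (rule antisymD)
  show "(x, y) \<in> I \<or> (y, x) \<in> I" if "x \<in> Field I" "y \<in> Field I"
    using total that r[OF that(1)] unfolding total_on_def by (cases "x = y") auto
  show "(x, y) \<in> I \<Longrightarrow> x \<in> Field I" by (rule FieldI1)
  show "(x, y) \<in> I \<Longrightarrow> y \<in> Field I" by (rule FieldI2)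
qed

lemma finite_ordinalI:
  assumes "finite X" "X \<noteq> {}" "\<And>x y. (x, y) \<in> I \<Longrightarrow> x \<in> X \<and> y \<in> X" "\<And>x. x \<in> X \<Longrightarrow> (x, x) \<in> I"
    "\<And>x y z. (x, y) \<in> I \<Longrightarrow> (y, z) \<in> I \<Longrightarrow> (x, z) \<in> I" "\<And>x y. (x, y) \<in> I \<Longrightarrow> (y, x) \<in> I \<Longrightarrow> x = y"
    "\<And>x y. x \<in> X \<Longrightarrow> y \<in> X \<Longrightarrow> (x, y) \<in> I \<or> (y, x) \<in> I"
  shows "finite_ordinal I" "Field I = X"
proof -
  show F: "Field I = X" using assms(3,4) by (auto simp: Field_def)
  show "finite_ordinal I"
    unfolding finite_ordinal_def order_on_defs F
  proof (intro conjI)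
    show "I \<subseteq> X \<times> X" using assms(3) by auto
    show "refl_on X I" using assms(4) by (auto simp: refl_on_def)
    show "trans I" by (rule transI) (rule assms(5))
    show "antisym I" by (rule antisymI) (rule assms(6))
    show "total_on X I" using assms(7) by (auto simp: total_on_def)
  qed (use assms(1,2) in auto)
qed

lemma finite_ordinal_converse:
  assumes "finite_ordinal I"
  shows "finite_ordinal (I\<inverse>)"
  using assms by (simp add: finite_ordinal_def)

lemma finite_ordinal_Restr:
  assumes "finite_ordinal I" "X \<subseteq> Field I" "X \<noteq> {}"
  shows "finite_ordinal (Restr I X)" "Field (Restr I X) = X"
proof -
  note D = finite_ordinalD[OF assms(1)]
  have "finite X" using assms D(1) finite_subset by blast
  moreover note \<open>X \<noteq> {}\<close>
  moreover have "x \<in> X \<and> y \<in> X" if "(x, y) \<in> Restr I X" for x y using that by blast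
  moreover have "(x, x) \<in> Restr I X" if "x \<in> X" for x using that D(3) assms(2) by blast
  moreover have "(x, z) \<in> Restr I X" if "(x, y) \<in> Restr I X" "(y, z) \<in> Restr I X" for x y z
    using that D(4)[of x y z] by blast
  moreover have "x = y" if "(x, y) \<in> Restr I X" "(y, x) \<in> Restr I X" for x y
    using that D(5)[of x y] by blast
  moreover have "(x, y) \<in> Restr I X \<or> (y, x) \<in> Restr I X" if "x \<in> X" "y \<in> X" for x y
    using that D(6)[of x y] assms(2) by blast
  ultimately show "finite_ordinal (Restr I X)" by (rule finite_ordinalI(1)[of X])
  show "Field (Restr I X) = X"
  proof
    show "Field (Restr I X) \<subseteq> X" by (auto simp: Field_def)
    show "X \<subseteq> Field (Restr I X)"
    proof
      fix x assume "x \<in> X"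
      then have "(x, x) \<in> Restr I X" using D(3) assms(2) by blast
      then show "x \<in> Field (Restr I X)" by (rule FieldI1)
    qed
  qed
qed

lemma ord_min:
  assumes "finite_ordinal I"
  shows "ord_min I \<in> Field I" "x \<in> Field I \<Longrightarrow> (ord_min I, x) \<in> I"
proof -
  note D = finite_ordinalD[OF assms]
  have "\<exists>m\<in>X. \<forall>x\<in>X. (m, x) \<in> I" if "finite X" "X \<noteq> {}" "X \<subseteq> Field I" for X
    using that
  proof (induction X rule: finite_ne_induct)
    case (singleton x) then show ?case using D by auto
  next
    case (insert x X)
    then obtain m where m: "m \<in> X" "\<forall>x\<in>X. (m, x) \<in> I" by auto
    have x: "x \<in> Field I" "m \<in> Field I" using insert \<open>m \<in> X\<close> by auto
    consider "(m, x) \<in> I" | "(x, m) \<in> I" using D(6)[OF x] by blast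
    then show ?case
    proof cases
      case 1
      then show ?thesis using m by blast
    next
      case 2
      then have "(x, y) \<in> I" if "y \<in> X" for y using D(4)[OF 2] m(2) that by blast
      then show ?thesis using D(3)[OF x(1)] by blast
    qed
  qed
  from this[OF D(1,2) subset_refl] obtain m where m: "m \<in> Field I" "\<forall>x\<in>Field I. (m, x) \<in> I" by blast
  have "ord_min I = m"
    unfolding ord_min_def
  proof (rule the_equality)
    fix n assume "n \<in> Field I \<and> (\<forall>x\<in>Field I. (n, x) \<in> I)"
    then show "n = m" using m D(5)[of n m] by blast
  qed (use m in blast)
  then show "ord_min I \<in> Field I" "x \<in> Field I \<Longrightarrow> (ord_min I, x) \<in> I" using m by auto
qed

lemma ord_min_eqI:
  assumes "finite_ordinal I" "m \<in> Field I" "\<And>x. x \<in> Field I \<Longrightarrow> (m, x) \<in> I"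
  shows "ord_min I = m"
  using assms(2,3) ord_min[OF assms(1)] finite_ordinalD(5)[OF assms(1)] by blast

text \<open>Reversal of the order transfers facts from minima to maxima, and further on from
  successors to predecessors.\<close>

lemma ord_max_converse: "ord_max I = ord_min (I\<inverse>)"
  by (simp add: ord_max_def ord_min_def)

lemma ord_max:
  assumes "finite_ordinal I"
  shows "ord_max I \<in> Field I" "x \<in> Field I \<Longrightarrow> (x, ord_max I) \<in> I"
  using ord_min[OF finite_ordinal_converse[OF assms]] by (auto simp: ord_max_converse)

lemma ord_max_eqI:
  assumes "finite_ordinal I" "m \<in> Field I" "\<And>x. x \<in> Field I \<Longrightarrow> (x, m) \<in> I"
  shows "ord_max I = m"
  using assms(2,3) ord_max[OF assms(1)] finite_ordinalD(5)[OF assms(1)] by blast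

lemma Gap_iff: "(u, v) \<in> Gap I \<longleftrightarrow> ord_lt I u v \<and> \<not> (\<exists>w. ord_lt I u w \<and> ord_lt I w v)"
  by (simp add: Gap_def)

lemma Gap_converse: "Gap (I\<inverse>) = (Gap I)\<inverse>"
  by (auto simp: Gap_def ord_lt_def)

lemma Gap_Field: "(u, v) \<in> Gap I \<Longrightarrow> u \<in> Field I \<and> v \<in> Field I"
  by (auto simp: Gap_def ord_lt_def Field_def)

lemma finite_Gap: "finite_ordinal I \<Longrightarrow> finite (Gap I)"
  by (rule finite_subset[of _ "Field I \<times> Field I"]) (auto dest: Gap_Field finite_ordinalD(1))

lemma Gap_le:
  assumes "finite_ordinal I" "(u, v) \<in> Gap I" "x \<in> Field I"
  shows "(x, u) \<in> I \<or> (v, x) \<in> I" and "(x, u) \<in> I \<Longrightarrow> (v, x) \<notin> I"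
proof -
  note D = finite_ordinalD[OF assms(1)]
  have uv: "u \<in> Field I" "v \<in> Field I" using Gap_Field[OF assms(2)] by auto
  show "(x, u) \<in> I \<or> (v, x) \<in> I"
    using assms(2,3) D(3)[OF assms(3)] D(6)[OF assms(3) uv(1)] D(6)[OF assms(3) uv(2)]
    unfolding Gap_iff ord_lt_def by blast
  show "(x, u) \<in> I \<Longrightarrow> (v, x) \<notin> I"
    using assms(2) D(4,5) unfolding Gap_iff ord_lt_def by blast
qed

lemma Gap_unique:
  assumes "finite_ordinal I"
  shows "(u, v) \<in> Gap I \<Longrightarrow> (u, v') \<in> Gap I \<Longrightarrow> v = v'"
    and "(u, v) \<in> Gap I \<Longrightarrow> (u', v) \<in> Gap I \<Longrightarrow> u = u'"
proof -
  note D = finite_ordinalD[OF assms]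
  show "(u, v) \<in> Gap I \<Longrightarrow> (u, v') \<in> Gap I \<Longrightarrow> v = v'"
    using D(6)[of v v'] D(8)[of u v] D(8)[of u v'] unfolding Gap_iff ord_lt_def by blast
  show "(u, v) \<in> Gap I \<Longrightarrow> (u', v) \<in> Gap I \<Longrightarrow> u = u'"
    using D(6)[of u u'] D(7)[of u v] D(7)[of u' v] unfolding Gap_iff ord_lt_def by blast
qed

lemma ord_succ_eq: "finite_ordinal I \<Longrightarrow> (u, v) \<in> Gap I \<Longrightarrow> ord_succ I u = v"
  unfolding ord_succ_def using Gap_unique(1) by (intro the_equality)

lemma ord_pred_eq: "finite_ordinal I \<Longrightarrow> (u, v) \<in> Gap I \<Longrightarrow> ord_pred I v = u"
  unfolding ord_pred_def using Gap_unique(2) by (intro the_equality)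

lemma ord_succ:
  assumes I: "finite_ordinal I" and u: "u \<in> Field I" "u \<noteq> ord_max I"
  shows "(u, ord_succ I u) \<in> Gap I"
proof -
  note D = finite_ordinalD[OF I]
  let ?X = "{x. ord_lt I u x}"
  have X: "?X \<subseteq> Field I" "?X \<noteq> {}"
    using u ord_max[OF I] by (auto simp: ord_lt_def Field_def)
  \<comment> \<open>The successor is found as the minimum of the elements strictly above
    \<open>u\<close>; these exist because \<open>u\<close> is not the maximum.\<close>
  define v where "v = ord_min (Restr I ?X)"
  have v: "v \<in> ?X" "\<And>x. x \<in> ?X \<Longrightarrow> (v, x) \<in> I"
    using ord_min[OF finite_ordinal_Restr(1)[OF I X]] finite_ordinal_Restr(2)[OF I X]
    unfolding v_def by auto
  have "(u, v) \<in> Gap I"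
    unfolding Gap_iff using v D(5) by (auto simp: ord_lt_def)
  then show ?thesis using ord_succ_eq[OF I] by simp
qed

lemma ord_pred_converse: "ord_pred I = ord_succ (I\<inverse>)"
  by (simp add: ord_pred_def ord_succ_def Gap_converse fun_eq_iff)

lemma ord_pred:
  assumes "finite_ordinal I" "v \<in> Field I" "v \<noteq> ord_min I"
  shows "(ord_pred I v, v) \<in> Gap I"
  using ord_succ[OF finite_ordinal_converse[OF assms(1)], of v] assms
  by (simp add: ord_pred_converse ord_max_converse Gap_converse)

text \<open>A gap is determined by its upper end, which can be any element except the minimum. This
  is the dimension count for \<open>G(I)\<close>.\<close>

lemma card_Gap:
  assumes "finite_ordinal I"
  shows "Suc (card (Gap I)) = card (Field I)"
proof -
  have "bij_betw snd (Gap I) (Field I - {ord_min I})"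
  proof (rule bij_betwI')
    fix x y assume "x \<in> Gap I" "y \<in> Gap I"
    then show "snd x = snd y \<longleftrightarrow> x = y" using Gap_unique(2)[OF assms] by (cases x; cases y) auto
  next
    fix x assume x: "x \<in> Gap I"
    obtain u v where "x = (u, v)" by (cases x)
    then show "snd x \<in> Field I - {ord_min I}"
      using x Gap_Field[of u v I] ord_min(2)[OF assms, of u] finite_ordinalD(5)[OF assms]
      by (auto simp: Gap_iff ord_lt_def)
  next
    fix y assume "y \<in> Field I - {ord_min I}"
    then show "\<exists>x\<in>Gap I. y = snd x" using ord_pred[OF assms] by force
  qed
  then have "Suc (card (Gap I)) = Suc (card (Field I - {ord_min I}))" by (simp add: bij_betw_same_card)
  also have "\<dots> = card (Field I)"
    by (rule card_Suc_Diff1[OF finite_ordinalD(1)[OF assms] ord_min(1)[OF assms]])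
  finally show ?thesis .
qed

section \<open>Convex, initial and final subsets and their end points\<close>

definition convex_in :: "'i rel \<Rightarrow> 'i set \<Rightarrow> bool" where
  "convex_in I X \<longleftrightarrow> X \<subseteq> Field I \<and> (\<forall>a\<in>X. \<forall>b\<in>X. \<forall>c. (a, c) \<in> I \<longrightarrow> (c, b) \<in> I \<longrightarrow> c \<in> X)"

definition down_closed :: "'i rel \<Rightarrow> 'i set \<Rightarrow> bool" where
  "down_closed I X \<longleftrightarrow> X \<subseteq> Field I \<and> (\<forall>b\<in>X. \<forall>c. (c, b) \<in> I \<longrightarrow> c \<in> X)"

definition up_closed :: "'i rel \<Rightarrow> 'i set \<Rightarrow> bool" where
  "up_closed I X \<longleftrightarrow> X \<subseteq> Field I \<and> (\<forall>a\<in>X. \<forall>c. (a, c) \<in> I \<longrightarrow> c \<in> X)"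

lemma down_closed_convex: "down_closed I X \<Longrightarrow> convex_in I X"
  and up_closed_convex: "up_closed I X \<Longrightarrow> convex_in I X"
  by (auto simp: down_closed_def up_closed_def convex_in_def)

definition lo :: "'i rel \<Rightarrow> 'i set \<Rightarrow> 'i" where "lo I X = ord_min (Restr I X)"
definition hi :: "'i rel \<Rightarrow> 'i set \<Rightarrow> 'i" where "hi I X = ord_max (Restr I X)"

lemma lo_hi:
  assumes "finite_ordinal I" "X \<subseteq> Field I" "X \<noteq> {}"
  shows "lo I X \<in> X" "hi I X \<in> X" "x \<in> X \<Longrightarrow> (lo I X, x) \<in> I" "x \<in> X \<Longrightarrow> (x, hi I X) \<in> I"
  using ord_min[OF finite_ordinal_Restr(1)[OF assms]] ord_max[OF finite_ordinal_Restr(1)[OF assms]]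
    finite_ordinal_Restr(2)[OF assms]
  unfolding lo_def hi_def by auto

lemma lo_eqI:
  assumes "finite_ordinal I" "X \<subseteq> Field I" "m \<in> X" "\<And>x. x \<in> X \<Longrightarrow> (m, x) \<in> I"
  shows "lo I X = m"
proof -
  have "X \<noteq> {}" using assms(3) by blast
  note l = lo_hi[OF assms(1,2) this]
  show ?thesis using finite_ordinalD(5)[OF assms(1) l(3)[OF assms(3)] assms(4)[OF l(1)]] .
qed

lemma hi_eqI:
  assumes "finite_ordinal I" "X \<subseteq> Field I" "m \<in> X" "\<And>x. x \<in> X \<Longrightarrow> (x, m) \<in> I"
  shows "hi I X = m"
proof -
  have "X \<noteq> {}" using assms(3) by blast
  note l = lo_hi[OF assms(1,2) this]
  show ?thesis using finite_ordinalD(5)[OF assms(1) assms(4)[OF l(2)] l(4)[OF assms(3)]] .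
qed

lemma interval_lo_hi:
  assumes "finite_ordinal I" "convex_in I X" "X \<noteq> {}"
  shows "ord_interval I (lo I X) (hi I X) = X"
proof -
  have "X \<subseteq> Field I" using assms by (simp add: convex_in_def)
  note l = lo_hi[OF assms(1) this assms(3)]
  show ?thesis using assms(2) l unfolding ord_interval_def convex_in_def by blast
qed

lemma interval:
  assumes I: "finite_ordinal I" and ab: "(a, b) \<in> I"
  shows "convex_in I (ord_interval I a b)" "ord_interval I a b \<noteq> {}"
    "lo I (ord_interval I a b) = a" "hi I (ord_interval I a b) = b"
proof -
  note D = finite_ordinalD[OF I]
  show c: "convex_in I (ord_interval I a b)"
    using D(4,7) unfolding convex_in_def ord_interval_def by blast
  then have X: "ord_interval I a b \<subseteq> Field I" by (simp add: convex_in_def)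
  have a: "a \<in> ord_interval I a b" and b: "b \<in> ord_interval I a b"
    using ab D(3,7,8) by (auto simp: ord_interval_def)
  then show "ord_interval I a b \<noteq> {}" by blast
  show "lo I (ord_interval I a b) = a" "hi I (ord_interval I a b) = b"
    by (rule lo_eqI[OF I X a] hi_eqI[OF I X b]; simp add: ord_interval_def)+
qed

lemma proper_intervals_lo_hi:
  assumes "finite_ordinal I" "convex_in I X" "X \<noteq> {}" "X \<noteq> Field I"
  shows "(lo I X, hi I X) \<in> proper_intervals I"
proof -
  have "X \<subseteq> Field I" using assms(2) by (simp add: convex_in_def)
  note l = lo_hi[OF assms(1) this assms(3)]
  show ?thesis using interval_lo_hi[OF assms(1-3)] l(3)[OF l(2)] assms(4)
    by (simp add: proper_intervals_def)
qed

lemma finite_proper_intervals: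
  assumes "finite_ordinal I"
  shows "finite (proper_intervals I)"
  by (rule finite_subset[of _ "Field I \<times> Field I"])
     (use finite_ordinalD(1)[OF assms] in \<open>auto simp: proper_intervals_def intro: FieldI1 FieldI2\<close>)

lemma Gap_Restr:
  assumes "convex_in I X"
  shows "Gap (Restr I X) = {(u, v) \<in> Gap I. u \<in> X \<and> v \<in> X}"
  using assms unfolding Gap_def ord_lt_def convex_in_def by fast

lemma Gint_eq:
  assumes "finite_ordinal I" "(a, b) \<in> I"
  shows "Gint I a b = coord_space {(u, v) \<in> Gap I. u \<in> ord_interval I a b \<and> v \<in> ord_interval I a b}"
  unfolding Gint_def Gsp_def Gap_Restr[OF interval(1)[OF assms]] ..

text \<open>For a gap \<open>(u, v)\<close>, \<open>v\<close> is at most the successor of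
  \<open>b\<close> exactly if \<open>u\<close> is at most \<open>b\<close>. The shift by one in the
  boundary condition is absorbed by testing only the lower end of a gap, and this form also makes
  sense for the empty and for the full segment.\<close>

lemma Gint_initial:
  assumes I: "finite_ordinal I" and b: "b \<in> Field I" "b \<noteq> ord_max I"
  shows "Gint I (ord_min I) (ord_succ I b) = coord_space {g \<in> Gap I. fst g \<in> ord_interval I (ord_min I) b}"
proof -
  let ?s = "ord_succ I b"
  note D = finite_ordinalD[OF I]
  have s: "(b, ?s) \<in> Gap I" by (rule ord_succ[OF I b])
  have m: "(ord_min I, x) \<in> I" if "x \<in> Field I" for x by (rule ord_min(2)[OF I that])
  have "u \<in> ord_interval I (ord_min I) ?s \<and> v \<in> ord_interval I (ord_min I) ?s \<longleftrightarrow>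
      u \<in> ord_interval I (ord_min I) b" if g: "(u, v) \<in> Gap I" for u v
  proof -
    have uv: "u \<in> Field I" "v \<in> Field I" "(u, v) \<in> I" "u \<noteq> v" using Gap_Field[OF g] g by (auto simp: Gap_iff ord_lt_def)
    have "(v, ?s) \<in> I \<longleftrightarrow> (u, b) \<in> I"
    proof
      assume "(u, b) \<in> I"
      show "(v, ?s) \<in> I"
        using Gap_le[OF I g, of b] \<open>(u, b) \<in> I\<close> s Gap_unique(1)[OF I g] D(3,4,5) uv b
        unfolding Gap_iff ord_lt_def by metis
    next
      assume "(v, ?s) \<in> I"
      then have "\<not> (?s, u) \<in> I" using uv D(4,5) by blast
      then show "(u, b) \<in> I" using Gap_le(1)[OF I s uv(1)] by blast
    qed
    then show ?thesis using uv m D(4) unfolding ord_interval_def by blast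
  qed
  note key = this
  have "?s \<in> Field I" using Gap_Field[OF s] by simp
  then show ?thesis
    by (subst Gint_eq[OF I m], simp)
      (intro arg_cong[where f = coord_space] Collect_cong, unfold split_beta prod.collapse,
        rule conj_cong, simp, simp add: key)
qed

text \<open>Dually, the shift to the predecessor is absorbed by testing only the upper end of a
  gap.\<close>

lemma Gint_final:
  assumes I: "finite_ordinal I" and a: "a \<in> Field I" "a \<noteq> ord_min I"
  shows "Gint I (ord_pred I a) (ord_max I) = coord_space {g \<in> Gap I. snd g \<in> ord_interval I a (ord_max I)}"
proof -
  let ?s = "ord_pred I a"
  note D = finite_ordinalD[OF I]
  have s: "(?s, a) \<in> Gap I" by (rule ord_pred[OF I a])
  have m: "(x, ord_max I) \<in> I" if "x \<in> Field I" for x by (rule ord_max(2)[OF I that])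
  have "u \<in> ord_interval I ?s (ord_max I) \<and> v \<in> ord_interval I ?s (ord_max I) \<longleftrightarrow>
      v \<in> ord_interval I a (ord_max I)" if g: "(u, v) \<in> Gap I" for u v
  proof -
    have uv: "u \<in> Field I" "v \<in> Field I" "(u, v) \<in> I" "u \<noteq> v" using Gap_Field[OF g] g by (auto simp: Gap_iff ord_lt_def)
    have "(?s, u) \<in> I \<longleftrightarrow> (a, v) \<in> I"
    proof
      assume "(a, v) \<in> I"
      show "(?s, u) \<in> I"
        using Gap_le[OF I g, of a] \<open>(a, v) \<in> I\<close> s Gap_unique(2)[OF I g] D(3,4,5) uv a
        unfolding Gap_iff ord_lt_def by metis
    next
      assume "(?s, u) \<in> I"
      then have "\<not> (v, ?s) \<in> I" using uv D(4,5) by blast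
      then show "(a, v) \<in> I" using Gap_le(1)[OF I s uv(2)] by blast
    qed
    then show ?thesis using uv m D(4) unfolding ord_interval_def by blast
  qed
  note key = this
  have "?s \<in> Field I" using Gap_Field[OF s] by simp
  then show ?thesis
    by (subst Gint_eq[OF I m], simp)
      (intro arg_cong[where f = coord_space] Collect_cong, unfold split_beta prod.collapse,
        rule conj_cong, simp, simp add: key)
qed

section \<open>Brick manifolds as families indexed by convex sets\<close>

definition brick_ext :: "'i rel \<Rightarrow> ('i, 'a::field) subspaces \<Rightarrow> 'i set \<Rightarrow> ('i \<times> 'i \<Rightarrow> 'a) set" where
  "brick_ext I V X = (if X = {} then {0} else if X = Field I then Gsp I else V (lo I X, hi I X))"

text \<open>The last two conditions are the boundary conditions on initial and final intervals. They also
  contain \<open>F {} = 0\<close> and \<open>F (Field I) = G(I)\<close>.\<close>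

definition brick_family :: "'i rel \<Rightarrow> ('i set \<Rightarrow> ('i \<times> 'i \<Rightarrow> 'a::field) set) \<Rightarrow> bool" where
  "brick_family I F \<longleftrightarrow>
     (\<forall>X. convex_in I X \<longrightarrow> fvs.subspace (F X) \<and> F X \<subseteq> coord_space (Gap I)) \<and>
     (\<forall>X. convex_in I X \<longrightarrow> X \<noteq> Field I \<longrightarrow> fvs.dim (F X) = card X) \<and>
     (\<forall>X x. convex_in I X \<longrightarrow> convex_in I (insert x X) \<longrightarrow> F X \<subseteq> F (insert x X)) \<and>
     (\<forall>X. down_closed I X \<longrightarrow> F X = coord_space {g \<in> Gap I. fst g \<in> X}) \<and>
     (\<forall>X. up_closed I X \<longrightarrow> F X = coord_space {g \<in> Gap I. snd g \<in> X})"

lemma brick_familyD: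
  assumes "brick_family I F"
  shows "convex_in I X \<Longrightarrow> fvs.subspace (F X)" "convex_in I X \<Longrightarrow> F X \<subseteq> coord_space (Gap I)"
    "convex_in I X \<Longrightarrow> X \<noteq> Field I \<Longrightarrow> fvs.dim (F X) = card X"
    "convex_in I X \<Longrightarrow> convex_in I (insert x X) \<Longrightarrow> F X \<subseteq> F (insert x X)"
    "down_closed I X \<Longrightarrow> F X = coord_space {g \<in> Gap I. fst g \<in> X}"
    "up_closed I X \<Longrightarrow> F X = coord_space {g \<in> Gap I. snd g \<in> X}"
  using assms by (simp_all add: brick_family_def)

lemma coord_space_empty: "coord_space {} = {0 :: 's \<Rightarrow> 'a::zero}"
  by (auto simp: coord_space_def fun_eq_iff)

lemma proper_intervals_iff:
  "(a, b) \<in> proper_intervals I \<longleftrightarrow> (a, b) \<in> I \<and> ord_interval I a b \<noteq> Field I"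
  by (simp add: proper_intervals_def)

lemma brick_ext_interval:
  assumes "finite_ordinal I" "(a, b) \<in> proper_intervals I"
  shows "brick_ext I V (ord_interval I a b) = V (a, b)"
  using assms interval[OF assms(1), of a b] by (simp add: brick_ext_def proper_intervals_iff)

lemma brick_ext_empty: "brick_ext I V {} = {0}"
  by (simp add: brick_ext_def)

lemma brick_ext_Field: "finite_ordinal I \<Longrightarrow> brick_ext I V (Field I) = coord_space (Gap I)"
  using finite_ordinalD(2) by (auto simp: brick_ext_def Gsp_def)

lemma bricks_iff:
  fixes V :: "('i, 'a::field) subspaces"
  shows
  "V \<in> bricks I \<longleftrightarrow>
     (\<forall>i j. (i, j) \<in> proper_intervals I \<longrightarrow> V (i, j) \<in> grassmannian (Gap I) (card (ord_interval I i j))) \<and>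
     V \<in> extensional (proper_intervals I) \<and>
     (\<forall>i j. (i, j) \<in> proper_intervals I \<longrightarrow> i \<noteq> ord_min I \<longrightarrow> (ord_pred I i, j) \<in> proper_intervals I
        \<longrightarrow> V (i, j) \<subseteq> V (ord_pred I i, j)) \<and>
     (\<forall>i j. (i, j) \<in> proper_intervals I \<longrightarrow> j \<noteq> ord_max I \<longrightarrow> (i, ord_succ I j) \<in> proper_intervals I
        \<longrightarrow> V (i, j) \<subseteq> V (i, ord_succ I j)) \<and>
     (\<forall>j. (ord_min I, j) \<in> proper_intervals I
        \<longrightarrow> V (ord_min I, j) = Gint I (ord_min I) (ord_succ I j)) \<and>
     (\<forall>i. (i, ord_max I) \<in> proper_intervals I
        \<longrightarrow> V (i, ord_max I) = Gint I (ord_pred I i) (ord_max I))"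
proof -
  have 1: "V \<in> (\<Pi>\<^sub>E (i, j)\<in>proper_intervals I. grassmannian (Gap I) (card (ord_interval I i j))) \<longleftrightarrow>
     (\<forall>i j. (i, j) \<in> proper_intervals I \<longrightarrow> V (i, j) \<in> grassmannian (Gap I) (card (ord_interval I i j))) \<and>
     V \<in> extensional (proper_intervals I)"
    unfolding PiE_iff by auto
  have 2: "(\<forall>(i, j)\<in>A. P i j) \<longleftrightarrow> (\<forall>i j. (i, j) \<in> A \<longrightarrow> P i j)" for A :: "('i \<times> 'i) set" and P
    by auto
  show ?thesis
    unfolding bricks_def mem_Collect_eq 1 unfolding 2 imp_conjL by (rule conj_assoc)
qed

text \<open>A point that can be added to a nonempty convex set without losing convexity is a
  neighbour of one of its ends, as otherwise an element in between would have to belong to the set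
  already. So inclusions for one-point enlargements are the two kinds of inclusions in the
  definition of a brick manifold.\<close>

lemma convex_insertE:
  assumes I: "finite_ordinal I" and X: "convex_in I X" "convex_in I (insert x X)" "X \<noteq> {}" "x \<notin> X"
  obtains "(x, lo I X) \<in> Gap I" "lo I (insert x X) = x" "hi I (insert x X) = hi I X"
    | "(hi I X, x) \<in> Gap I" "hi I (insert x X) = x" "lo I (insert x X) = lo I X"
proof -
  note D = finite_ordinalD[OF I]
  have XF: "X \<subseteq> Field I" "insert x X \<subseteq> Field I" using X(1,2) unfolding convex_in_def by blast+
  note l = lo_hi[OF I XF(1) X(3)]
  have F: "lo I X \<in> Field I" "hi I X \<in> Field I" "x \<in> Field I" using l XF by auto
  have ne: "lo I X \<noteq> x" "hi I X \<noteq> x" using l X(4) by auto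
  have X2: "c \<in> insert x X" if "a \<in> insert x X" "b \<in> insert x X" "(a, c) \<in> I" "(c, b) \<in> I" for a b c
    using X(2) that unfolding convex_in_def by blast
  show ?thesis
  proof (cases "(x, lo I X) \<in> I")
    case True
    have "\<not> (\<exists>w. ord_lt I x w \<and> ord_lt I w (lo I X))"
    proof
      assume "\<exists>w. ord_lt I x w \<and> ord_lt I w (lo I X)"
      then obtain w where w: "(x, w) \<in> I" "x \<noteq> w" "(w, lo I X) \<in> I" "w \<noteq> lo I X"
        by (auto simp: ord_lt_def)
      then have "w \<in> X" using X2[of x "lo I X" w] l(1) by auto
      then show False using l(3)[of w] D(5) w by blast
    qed
    then have "(x, lo I X) \<in> Gap I" using True ne by (simp add: Gap_iff ord_lt_def)
    moreover have "lo I (insert x X) = x"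
      by (rule lo_eqI[OF I XF(2)]) (use D(3)[OF F(3)] D(4)[OF True l(3)] in auto)
    moreover have "hi I (insert x X) = hi I X"
      by (rule hi_eqI[OF I XF(2)]) (use l D(4)[OF True l(3)[OF l(2)]] in auto)
    ultimately show ?thesis by (rule that(1))
  next
    case False
    then have lx: "(lo I X, x) \<in> I" using D(6)[OF F(1,3)] by blast
    have hx: "(hi I X, x) \<in> I"
    proof (rule ccontr)
      assume "(hi I X, x) \<notin> I"
      then have "(x, hi I X) \<in> I" using D(6)[OF F(2,3)] by blast
      then have "x \<in> X" using X(1) lx l unfolding convex_in_def by blast
      then show False using X(4) by blast
    qed
    have "\<not> (\<exists>w. ord_lt I (hi I X) w \<and> ord_lt I w x)"
    proof
      assume "\<exists>w. ord_lt I (hi I X) w \<and> ord_lt I w x"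
      then obtain w where w: "(hi I X, w) \<in> I" "x \<noteq> w" "(w, x) \<in> I" "w \<noteq> hi I X"
        by (auto simp: ord_lt_def)
      then have "w \<in> X" using X2[of "hi I X" x w] l(2) by auto
      then show False using l(4)[of w] D(5) w by blast
    qed
    then have "(hi I X, x) \<in> Gap I" using hx ne by (simp add: Gap_iff ord_lt_def)
    moreover have "hi I (insert x X) = x"
      by (rule hi_eqI[OF I XF(2)]) (use D(3)[OF F(3)] D(4)[OF l(4) hx] in auto)
    moreover have "lo I (insert x X) = lo I X"
      by (rule lo_eqI[OF I XF(2)]) (use l lx in auto)
    ultimately show ?thesis by (rule that(2))
  qed
qed

lemma down_closed_lo:
  assumes I: "finite_ordinal I" and X: "down_closed I X" "X \<noteq> {}"
  shows "lo I X = ord_min I" "X \<noteq> Field I \<Longrightarrow> hi I X \<noteq> ord_max I"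
proof -
  have XF: "X \<subseteq> Field I" using X by (simp add: down_closed_def)
  note l = lo_hi[OF I XF X(2)]
  have "(ord_min I, lo I X) \<in> I" using ord_min(2)[OF I] l(1) XF by blast
  then have "ord_min I \<in> X" using X(1) l(1) unfolding down_closed_def by blast
  then show "lo I X = ord_min I" using XF ord_min(2)[OF I] by (intro lo_eqI[OF I]) auto
  assume "X \<noteq> Field I"
  then obtain y where y: "y \<in> Field I" "y \<notin> X" using XF by blast
  show "hi I X \<noteq> ord_max I"
  proof
    assume "hi I X = ord_max I"
    then have "(y, hi I X) \<in> I" using ord_max(2)[OF I y(1)] by simp
    then show False using X(1) l(2) y(2) unfolding down_closed_def by blast
  qed
qed

lemma up_closed_hi:
  assumes I: "finite_ordinal I" and X: "up_closed I X" "X \<noteq> {}"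
  shows "hi I X = ord_max I" "X \<noteq> Field I \<Longrightarrow> lo I X \<noteq> ord_min I"
proof -
  have XF: "X \<subseteq> Field I" using X by (simp add: up_closed_def)
  note l = lo_hi[OF I XF X(2)]
  have "(hi I X, ord_max I) \<in> I" using ord_max(2)[OF I] l(2) XF by blast
  then have "ord_max I \<in> X" using X(1) l(2) unfolding up_closed_def by blast
  then show "hi I X = ord_max I" using XF ord_max(2)[OF I] by (intro hi_eqI[OF I]) auto
  assume "X \<noteq> Field I"
  then obtain y where y: "y \<in> Field I" "y \<notin> X" using XF by blast
  show "lo I X \<noteq> ord_min I"
  proof
    assume "lo I X = ord_min I"
    then have "(lo I X, y) \<in> I" using ord_min(2)[OF I y(1)] by simp
    then show False using X(1) l(1) y(2) unfolding up_closed_def by blast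
  qed
qed

text \<open>Each defining condition is translated separately; the two added values satisfy the
  conditions for free, except that the dimension of the whole space is left unconstrained.\<close>

lemma bricks_imp_brick_family:
  fixes V :: "('i, 'a::field) subspaces"
  assumes I: "finite_ordinal I" and V: "V \<in> bricks I"
  shows "brick_family I (brick_ext I V)"
proof -
  note D = finite_ordinalD[OF I]
  note B = V[unfolded bricks_iff]
  have gr: "V (lo I X, hi I X) \<in> grassmannian (Gap I) (card X)"
    if "convex_in I X" "X \<noteq> {}" "X \<noteq> Field I" for X
    using B proper_intervals_lo_hi[OF I that] interval_lo_hi[OF I that(1,2)] by metis
  have cs: "fvs.subspace (coord_space S :: ('i \<times> 'i \<Rightarrow> 'a) set)" for S
    using framed_coord_space unfolding framed_def by blast
  have 1: "fvs.subspace (brick_ext I V X)" "brick_ext I V X \<subseteq> coord_space (Gap I)" if "convex_in I X" for X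
    using gr[OF that] cs[of "Gap I"] by (auto simp: brick_ext_def grassmannian_def Gsp_def coord_space_def)
  have "fvs.dim {0 :: 'i \<times> 'i \<Rightarrow> 'a} = 0"
    using framed_dim[OF framed_coord_space, of "{}"] by (simp add: coord_space_empty)
  then have 2: "fvs.dim (brick_ext I V X) = card X" if "convex_in I X" "X \<noteq> Field I" for X
    using gr[OF that(1) _ that(2)] that(2) by (auto simp: brick_ext_def grassmannian_def)
  have 3: "brick_ext I V X \<subseteq> brick_ext I V (insert x X)"
    if X: "convex_in I X" "convex_in I (insert x X)" for X x
  proof -
    \<comment> \<open>Apart from the trivial case \<open>x \<in> X\<close>, two cases are not
      covered by the definition, which relates proper intervals only. They hold because
      \<open>0\<close> lies in every subspace and \<open>G(I)\<close> contains all of them.\<close>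
    consider "x \<in> X" | "X = {}" | "insert x X = Field I" | "x \<notin> X" "X \<noteq> {}" "insert x X \<noteq> Field I" by blast
    then show ?thesis
    proof cases
      case 1 then show ?thesis by (simp add: insert_absorb)
    next
      case 2
      have "0 \<in> brick_ext I V (insert x X)" using fvs.subspace_0[OF 1(1)[OF X(2)]] .
      then show ?thesis using 2 by (simp add: brick_ext_empty)
    next
      case 3 then show ?thesis using 1(2)[OF X(1)] brick_ext_Field[OF I] by metis
    next
      case 4
      have XF: "X \<noteq> Field I" using 4 X(2) by (auto simp: convex_in_def)
      have p: "(lo I X, hi I X) \<in> proper_intervals I"
        by (rule proper_intervals_lo_hi[OF I X(1) 4(2) XF])
      have p': "(lo I (insert x X), hi I (insert x X)) \<in> proper_intervals I"
        by (rule proper_intervals_lo_hi[OF I X(2) _ 4(3)]) simp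
      have "V (lo I X, hi I X) \<subseteq> V (lo I (insert x X), hi I (insert x X))"
        using I X 4(2,1)
      proof (cases rule: convex_insertE)
        case 1
        have "ord_pred I (lo I X) = x" using ord_pred_eq[OF I 1(1)] .
        moreover have "lo I X \<noteq> ord_min I"
          using 1(1) ord_min(2)[OF I] Gap_Field[OF 1(1)] D(5) unfolding Gap_iff ord_lt_def by metis
        ultimately show ?thesis using B p p' 1(2,3) by metis
      next
        case 2
        have "ord_succ I (hi I X) = x" using ord_succ_eq[OF I 2(1)] .
        moreover have "hi I X \<noteq> ord_max I"
          using 2(1) ord_max(2)[OF I] Gap_Field[OF 2(1)] D(5) unfolding Gap_iff ord_lt_def by metis
        ultimately show ?thesis using B p p' 2(2,3) by metis
      qed
      then show ?thesis using 4 XF by (simp add: brick_ext_def)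
    qed
  qed
  have 4: "brick_ext I V X = coord_space {g \<in> Gap I. fst g \<in> X}" if X: "down_closed I X" for X
  proof -
    consider "X = {}" | "X = Field I" | "X \<noteq> {}" "X \<noteq> Field I" by blast
    then show ?thesis
    proof cases
      case 1 then show ?thesis by (simp add: brick_ext_empty coord_space_empty)
    next
      case 2
      then have "{g \<in> Gap I. fst g \<in> X} = Gap I" using Gap_Field by fastforce
      then show ?thesis using 2 brick_ext_Field[OF I] by metis
    next
      case 3
      have c: "convex_in I X" by (rule down_closed_convex[OF X])
      have p: "(ord_min I, hi I X) \<in> proper_intervals I"
        using proper_intervals_lo_hi[OF I c 3] down_closed_lo(1)[OF I X 3(1)] by simp
      have "hi I X \<in> Field I" using p D(8) by (auto simp: proper_intervals_iff)
      then have "Gint I (ord_min I) (ord_succ I (hi I X)) = coord_space {g \<in> Gap I. fst g \<in> X}"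
        using Gint_initial[OF I _ down_closed_lo(2)[OF I X 3]] interval_lo_hi[OF I c 3(1)]
          down_closed_lo(1)[OF I X 3(1)] by simp
      then show ?thesis using B p 3 down_closed_lo(1)[OF I X 3(1)] by (simp add: brick_ext_def)
    qed
  qed
  have 5: "brick_ext I V X = coord_space {g \<in> Gap I. snd g \<in> X}" if X: "up_closed I X" for X
  proof -
    consider "X = {}" | "X = Field I" | "X \<noteq> {}" "X \<noteq> Field I" by blast
    then show ?thesis
    proof cases
      case 1 then show ?thesis by (simp add: brick_ext_empty coord_space_empty)
    next
      case 2
      then have "{g \<in> Gap I. snd g \<in> X} = Gap I" using Gap_Field by fastforce
      then show ?thesis using 2 brick_ext_Field[OF I] by metis
    next
      case 3
      have c: "convex_in I X" by (rule up_closed_convex[OF X])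
      have p: "(lo I X, ord_max I) \<in> proper_intervals I"
        using proper_intervals_lo_hi[OF I c 3] up_closed_hi(1)[OF I X 3(1)] by simp
      have "lo I X \<in> Field I" using p D(7) by (auto simp: proper_intervals_iff)
      then have "Gint I (ord_pred I (lo I X)) (ord_max I) = coord_space {g \<in> Gap I. snd g \<in> X}"
        using Gint_final[OF I _ up_closed_hi(2)[OF I X 3]] interval_lo_hi[OF I c 3(1)]
          up_closed_hi(1)[OF I X 3(1)] by simp
      then show ?thesis using B p 3 up_closed_hi(1)[OF I X 3(1)] by (simp add: brick_ext_def)
    qed
  qed
  show ?thesis unfolding brick_family_def using 1 2 3 4 5 by simp
qed

text \<open>With this converse, being a point of the brick manifold can be checked on convex sets,
  as is done for compositions and relabellings. Extensionality is a separate hypothesis because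
  \<open>brick_ext\<close> does not see the values outside the proper intervals.\<close>

lemma brick_family_imp_bricks:
  assumes I: "finite_ordinal I" and V: "V \<in> extensional (proper_intervals I)"
    and F: "brick_family I (brick_ext I V)"
  shows "V \<in> bricks I"
proof -
  note D = finite_ordinalD[OF I]
  note F = brick_familyD[OF F]
  have Ve: "V (i, j) = brick_ext I V (ord_interval I i j)" if "(i, j) \<in> proper_intervals I" for i j
    using brick_ext_interval[OF I that, of V] by simp
  have conv: "convex_in I (ord_interval I i j)" "(i, j) \<in> I" "ord_interval I i j \<noteq> Field I"
    "i \<in> Field I" "j \<in> Field I"
    if "(i, j) \<in> proper_intervals I" for i j
    using that interval(1)[OF I, of i j] D(7,8) by (auto simp: proper_intervals_iff)
  have 1: "V (i, j) \<in> grassmannian (Gap I) (card (ord_interval I i j))"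
    if p: "(i, j) \<in> proper_intervals I" for i j
    unfolding Ve[OF p] grassmannian_def using F(1-3)[OF conv(1)[OF p]] conv(3)[OF p] by simp
  have 2: "V (i, j) \<subseteq> V (ord_pred I i, j)"
    if p: "(i, j) \<in> proper_intervals I" "i \<noteq> ord_min I" "(ord_pred I i, j) \<in> proper_intervals I" for i j
  proof -
    have g: "(ord_pred I i, i) \<in> Gap I" using ord_pred[OF I conv(4)[OF p(1)] p(2)] .
    have "ord_interval I (ord_pred I i) j = insert (ord_pred I i) (ord_interval I i j)"
    proof (intro equalityI subsetI)
      fix x assume x: "x \<in> ord_interval I (ord_pred I i) j"
      then have xF: "x \<in> Field I" using D(7) by (auto simp: ord_interval_def)
      then show "x \<in> insert (ord_pred I i) (ord_interval I i j)"
        using Gap_le(1)[OF I g xF] x D(5) by (auto simp: ord_interval_def)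
    next
      fix x assume "x \<in> insert (ord_pred I i) (ord_interval I i j)"
      then show "x \<in> ord_interval I (ord_pred I i) j"
        using g D(4)[of "ord_pred I i" i x] D(3)[OF conv(4)[OF p(3)]] conv(2)[OF p(3)]
        by (auto simp: ord_interval_def Gap_iff ord_lt_def)
    qed
    then show ?thesis
      unfolding Ve[OF p(1)] Ve[OF p(3)] using F(4)[OF conv(1)[OF p(1)]] conv(1)[OF p(3)] by simp
  qed
  have 3: "V (i, j) \<subseteq> V (i, ord_succ I j)"
    if p: "(i, j) \<in> proper_intervals I" "j \<noteq> ord_max I" "(i, ord_succ I j) \<in> proper_intervals I" for i j
  proof -
    have g: "(j, ord_succ I j) \<in> Gap I" using ord_succ[OF I conv(5)[OF p(1)] p(2)] .
    have "ord_interval I i (ord_succ I j) = insert (ord_succ I j) (ord_interval I i j)"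
    proof (intro equalityI subsetI)
      fix x assume x: "x \<in> ord_interval I i (ord_succ I j)"
      then have xF: "x \<in> Field I" using D(7) by (auto simp: ord_interval_def)
      then show "x \<in> insert (ord_succ I j) (ord_interval I i j)"
        using Gap_le(1)[OF I g xF] x D(5) by (auto simp: ord_interval_def)
    next
      fix x assume "x \<in> insert (ord_succ I j) (ord_interval I i j)"
      then show "x \<in> ord_interval I i (ord_succ I j)"
        using g D(4)[of x j "ord_succ I j"] D(3)[OF conv(5)[OF p(3)]] conv(2)[OF p(3)]
        by (auto simp: ord_interval_def Gap_iff ord_lt_def)
    qed
    then show ?thesis
      unfolding Ve[OF p(1)] Ve[OF p(3)] using F(4)[OF conv(1)[OF p(1)]] conv(1)[OF p(3)] by simp
  qed
  have 4: "V (ord_min I, j) = Gint I (ord_min I) (ord_succ I j)"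
    if p: "(ord_min I, j) \<in> proper_intervals I" for j
  proof -
    have "down_closed I (ord_interval I (ord_min I) j)"
      using D(4,7) ord_min(2)[OF I] unfolding down_closed_def ord_interval_def by blast
    \<comment> \<open>Otherwise the interval would be the whole ordinal; hence the successor in the
      boundary condition exists.\<close>
    moreover have "j \<noteq> ord_max I"
      using conv(3)[OF p] ord_min(2)[OF I] ord_max(2)[OF I] D(7) by (auto simp: ord_interval_def)
    ultimately show ?thesis
      unfolding Ve[OF p] using Gint_initial[OF I conv(5)[OF p]] F(5) by metis
  qed
  have 5: "V (i, ord_max I) = Gint I (ord_pred I i) (ord_max I)"
    if p: "(i, ord_max I) \<in> proper_intervals I" for i
  proof -
    have "up_closed I (ord_interval I i (ord_max I))"
      using D(4,8) ord_max(2)[OF I] unfolding up_closed_def ord_interval_def by blast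
    moreover have "i \<noteq> ord_min I"
      using conv(3)[OF p] ord_min(2)[OF I] ord_max(2)[OF I] D(7) by (auto simp: ord_interval_def)
    ultimately show ?thesis
      unfolding Ve[OF p] using Gint_final[OF I conv(4)[OF p]] F(6) by metis
  qed
  show ?thesis unfolding bricks_iff using V 1 2 3 4 5 by simp
qed

text \<open>Every proper interval is a nonempty proper convex set, at which \<open>brick_ext\<close>
  returns the original value.\<close>

lemma bricks_eqI:
  assumes I: "finite_ordinal I" and V: "V \<in> extensional (proper_intervals I)" "W \<in> extensional (proper_intervals I)"
    and eq: "\<And>X. convex_in I X \<Longrightarrow> X \<noteq> {} \<Longrightarrow> X \<noteq> Field I \<Longrightarrow> brick_ext I V X = brick_ext I W X"
  shows "V = W"
proof (rule extensionalityI[OF V])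
  fix p assume p: "p \<in> proper_intervals I"
  obtain a b where ab: "p = (a, b)" by (cases p)
  then have "(a, b) \<in> I" "ord_interval I a b \<noteq> Field I" using p by (auto simp: proper_intervals_iff)
  then show "V p = W p"
    using eq[of "ord_interval I a b"] interval[OF I, of a b] brick_ext_interval[OF I, of a b V]
      brick_ext_interval[OF I, of a b W] p ab by simp
qed

lemma bricks_extensional: "V \<in> bricks I \<Longrightarrow> V \<in> extensional (proper_intervals I)"
  by (simp add: bricks_iff)

section \<open>Brick manifolds as closed subvarieties of products of Grassmannians\<close>

definition brick_incl :: "'i rel \<Rightarrow> (('i \<times> 'i) \<times> ('i \<times> 'i)) set" where
  "brick_incl I = {((i, j), (i', j')). (i, j) \<in> proper_intervals I \<and> (i', j') \<in> proper_intervals I \<and>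
     (i \<noteq> ord_min I \<and> i' = ord_pred I i \<and> j' = j \<or> j \<noteq> ord_max I \<and> i' = i \<and> j' = ord_succ I j)}"

definition brick_fixed :: "'i rel \<Rightarrow> (('i \<times> 'i) \<times> ('i \<times> 'i) set) set" where
  "brick_fixed I = {((i, j), U). (i, j) \<in> proper_intervals I \<and>
     (i = ord_min I \<and> U = Gap (Restr I (ord_interval I (ord_min I) (ord_succ I j))) \<or>
      j = ord_max I \<and> U = Gap (Restr I (ord_interval I (ord_pred I i) (ord_max I))))}"

lemma grassmannian_data_bricks:
  "finite_ordinal I \<Longrightarrow> grassmannian_data (proper_intervals I) (\<lambda>_. Gap I)"
  by unfold_locales (auto intro: finite_proper_intervals finite_Gap)

text \<open>The inclusions between neighbouring intervals and the two boundary conditions are of the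
  two kinds allowed for a closed locus, because each \<open>Gint\<close> is a coordinate
  subspace.\<close>

lemma bricks_closed_locus:
  assumes "finite_ordinal I"
  shows "bricks I = grassmannian_data.closed_locus (proper_intervals I) (\<lambda>_. Gap I)
    (\<lambda>(i, j). card (ord_interval I i j)) (brick_incl I) (brick_fixed I)"
proof -
  interpret grassmannian_data "proper_intervals I" "\<lambda>_. Gap I" "\<lambda>(i, j). card (ord_interval I i j)"
    by (rule grassmannian_data_bricks[OF assms])
  have "V \<in> bricks I \<longleftrightarrow> V \<in> closed_locus (brick_incl I) (brick_fixed I)" for V :: "('a, 'b) subspaces"
  proof -
    have "V \<in> gpoints \<longleftrightarrow>
        (\<forall>i j. (i, j) \<in> proper_intervals I \<longrightarrow> V (i, j) \<in> grassmannian (Gap I) (card (ord_interval I i j))) \<and>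
        V \<in> extensional (proper_intervals I)"
      by (simp only: PiE_iff Ball_def split_paired_All prod.case)
    moreover have "(\<forall>(\<alpha>, \<beta>)\<in>brick_incl I. V \<alpha> \<subseteq> V \<beta>) \<longleftrightarrow>
        (\<forall>i j. (i, j) \<in> proper_intervals I \<longrightarrow> i \<noteq> ord_min I \<longrightarrow> (ord_pred I i, j) \<in> proper_intervals I
          \<longrightarrow> V (i, j) \<subseteq> V (ord_pred I i, j)) \<and>
        (\<forall>i j. (i, j) \<in> proper_intervals I \<longrightarrow> j \<noteq> ord_max I \<longrightarrow> (i, ord_succ I j) \<in> proper_intervals I
          \<longrightarrow> V (i, j) \<subseteq> V (i, ord_succ I j))"
    proof -
      have "(\<forall>(\<alpha>, \<beta>)\<in>brick_incl I. P \<alpha> \<beta>) \<longleftrightarrow>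
        (\<forall>i j. (i, j) \<in> proper_intervals I \<longrightarrow> i \<noteq> ord_min I \<longrightarrow> (ord_pred I i, j) \<in> proper_intervals I
          \<longrightarrow> P (i, j) (ord_pred I i, j)) \<and>
        (\<forall>i j. (i, j) \<in> proper_intervals I \<longrightarrow> j \<noteq> ord_max I \<longrightarrow> (i, ord_succ I j) \<in> proper_intervals I
          \<longrightarrow> P (i, j) (i, ord_succ I j))" for P
        unfolding brick_incl_def by fastforce
      then show ?thesis .
    qed
    moreover have "(\<forall>(\<alpha>, U)\<in>brick_fixed I. V \<alpha> = coord_space U) \<longleftrightarrow>
        (\<forall>j. (ord_min I, j) \<in> proper_intervals I \<longrightarrow> V (ord_min I, j) = Gint I (ord_min I) (ord_succ I j)) \<and>
        (\<forall>i. (i, ord_max I) \<in> proper_intervals I \<longrightarrow> V (i, ord_max I) = Gint I (ord_pred I i) (ord_max I))"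
      by (auto simp: brick_fixed_def Gint_def Gsp_def)
    ultimately show ?thesis
      by (simp only: bricks_iff closed_locus_def mem_Collect_eq conj_assoc)
  qed
  then show ?thesis by blast
qed

lemma points_brick_variety: "points (brick_variety I) = bricks I"
  by (simp add: brick_variety_def subvariety_def)

lemma is_variety_brick_variety:
  assumes "is_subfield k" "finite_ordinal I"
  shows "is_variety k (brick_variety I)"
  unfolding brick_variety_def bricks_closed_locus[OF assms(2)]
  by (rule grassmannian_data.is_variety_closed_locus[OF grassmannian_data_bricks[OF assms(2)] assms(1)])
    (auto simp: brick_incl_def brick_fixed_def)

lemma brick_family_cong:
  assumes "\<And>X. convex_in I X \<Longrightarrow> F X = G X" "brick_family I G"
  shows "brick_family I F"
  using assms(2) assms(1) down_closed_convex[of I] up_closed_convex[of I] unfolding brick_family_def by simp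

lemma down_closed_Field: "down_closed I (Field I)" "down_closed I {}"
  by (auto simp: down_closed_def intro: FieldI1)

text \<open>The whole ordinal and the empty set are initial segments, so the values there follow
  from the boundary conditions. The dimension at the whole ordinal is the one exception to the rule
  \<open>card X\<close>.\<close>

lemma brick_family_Field:
  fixes F :: "'i set \<Rightarrow> ('i \<times> 'i \<Rightarrow> 'a::field) set"
  assumes "finite_ordinal I" "brick_family I F"
  shows "F (Field I) = coord_space (Gap I)" "F {} = {0}" "fvs.dim (F (Field I)) = card (Field I) - 1"
proof -
  have "{g \<in> Gap I. fst g \<in> Field I} = Gap I" using Gap_Field by fastforce
  then show 1: "F (Field I) = coord_space (Gap I)"
    using brick_familyD(5)[OF assms(2) down_closed_Field(1)] by simp
  show "F {} = {0}"
    using brick_familyD(5)[OF assms(2) down_closed_Field(2)] by (simp add: coord_space_empty)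
  show "fvs.dim (F (Field I)) = card (Field I) - 1"
    unfolding 1 framed_dim[OF framed_coord_space finite_Gap[OF assms(1)]]
    using card_Gap[OF assms(1)] by simp
qed

section \<open>The composition of brick manifolds\<close>

locale insertion =
  fixes I :: "'i rel" and i :: 'i and J :: "'i rel"
  assumes I: "finite_ordinal I" and J: "finite_ordinal J"
    and disjoint: "Field I \<inter> Field J = {}" and i: "i \<in> Field I"
begin

abbreviation K :: "'i rel" where "K \<equiv> ord_insert I i J"

lemma not_both: "x \<in> Field J \<Longrightarrow> x \<notin> Field I"
  using disjoint by blast

lemma i_J: "i \<notin> Field J" using disjoint i by blast

text \<open>The order on the insertion is split by the origin of the two elements: within
  \<open>I\<close> and within \<open>J\<close> nothing changes, and an element of \<open>J\<close>
  compares with one of \<open>I\<close> as \<open>i\<close> does.\<close>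

lemma K_II: "x \<in> Field I \<Longrightarrow> x \<noteq> i \<Longrightarrow> y \<in> Field I \<Longrightarrow> y \<noteq> i \<Longrightarrow> (x, y) \<in> K \<longleftrightarrow> (x, y) \<in> I"
  using not_both FieldI1[of x y J] by (auto simp: ord_insert_def)

lemma K_JJ: "x \<in> Field J \<Longrightarrow> y \<in> Field J \<Longrightarrow> (x, y) \<in> K \<longleftrightarrow> (x, y) \<in> J"
  using not_both[of x] not_both[of y] FieldI1[of x y I] FieldI1[of x i I] FieldI2[of i y I]
  by (auto simp: ord_insert_def ord_lt_def)

lemma K_IJ: "x \<in> Field I \<Longrightarrow> x \<noteq> i \<Longrightarrow> y \<in> Field J \<Longrightarrow> (x, y) \<in> K \<longleftrightarrow> (x, i) \<in> I"
  using not_both[of x] not_both[of y] FieldI1[of x y J] FieldI2[of x y I] FieldI2[of i y I]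
  by (auto simp: ord_insert_def ord_lt_def)

lemma K_JI: "x \<in> Field J \<Longrightarrow> y \<in> Field I \<Longrightarrow> y \<noteq> i \<Longrightarrow> (x, y) \<in> K \<longleftrightarrow> (i, y) \<in> I"
  using not_both[of x] not_both[of y] FieldI2[of x y J] FieldI1[of x y I] FieldI1[of x i I]
  by (auto simp: ord_insert_def ord_lt_def)

lemma K_in: "(x, y) \<in> K \<Longrightarrow> x \<in> (Field I - {i}) \<union> Field J \<and> y \<in> (Field I - {i}) \<union> Field J"
  by (auto simp: ord_insert_def ord_lt_def intro: FieldI1 FieldI2)

lemmas K_simps = K_II K_JJ K_IJ K_JI

lemma K_cases:
  assumes "x \<in> (Field I - {i}) \<union> Field J"
  obtains "x \<in> Field I" "x \<noteq> i" "x \<notin> Field J" | "x \<in> Field J" "x \<notin> Field I" "x \<noteq> i"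
  using assms disjoint i by blast

lemmas DI = finite_ordinalD[OF I] and DJ = finite_ordinalD[OF J]

lemma between_i: "(x, i) \<in> I \<Longrightarrow> (i, x) \<in> I \<Longrightarrow> x = i"
  by (rule DI(5))

lemma finite_ordinal_K: "finite_ordinal K" and Field_K: "Field K = (Field I - {i}) \<union> Field J"
proof -
  let ?X = "(Field I - {i}) \<union> Field J"
  have 1: "finite ?X" "?X \<noteq> {}" using DI(1) DJ(1,2) by auto
  have 2: "x \<in> ?X \<and> y \<in> ?X" if "(x, y) \<in> K" for x y by (rule K_in[OF that])
  have 3: "(x, x) \<in> K" if "x \<in> ?X" for x
    using that DI(3) DJ(3) by (cases rule: K_cases) (auto simp: K_simps)
  have 4: "(x, z) \<in> K" if xy: "(x, y) \<in> K" and yz: "(y, z) \<in> K" for x y z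
  proof -
    have X: "x \<in> ?X" "y \<in> ?X" "z \<in> ?X" using 2[OF xy] 2[OF yz] by auto
    show ?thesis
      using X(1)
    proof (cases rule: K_cases)
      case x: 1
      from X(2) show ?thesis
      proof (cases rule: K_cases)
        case y: 1
        from X(3) show ?thesis
          by (cases rule: K_cases) (use x y xy yz DI(4)[of x y z] DI(4)[of x y i] DI(4)[of x i z] in \<open>auto simp: K_simps\<close>)
      next
        case y: 2
        from X(3) show ?thesis
          by (cases rule: K_cases) (use x y xy yz DI(4)[of x y z] DI(4)[of x y i] DI(4)[of x i z] in \<open>auto simp: K_simps\<close>)
      qed
    next
      case x: 2
      from X(2) show ?thesis
      proof (cases rule: K_cases)
        case y: 1
        from X(3) show ?thesis
          by (cases rule: K_cases) (use x y xy yz DI(4)[of i y z] between_i[of y] in \<open>auto simp: K_simps\<close>)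
      next
        case y: 2
        from X(3) show ?thesis
          by (cases rule: K_cases) (use x y xy yz DJ(4) in \<open>auto simp: K_simps\<close>)
      qed
    qed
  qed
  have 5: "x = y" if xy: "(x, y) \<in> K" "(y, x) \<in> K" for x y
  proof -
    have X: "x \<in> ?X" "y \<in> ?X" using 2[OF xy(1)] by auto
    show ?thesis
      using X(1)
    proof (cases rule: K_cases)
      case x: 1
      from X(2) show ?thesis
        by (cases rule: K_cases) (use x xy DI(5) between_i in \<open>auto simp: K_simps\<close>)
    next
      case x: 2
      from X(2) show ?thesis
        by (cases rule: K_cases) (use x xy DJ(5) between_i in \<open>auto simp: K_simps\<close>)
    qed
  qed
  have 6: "(x, y) \<in> K \<or> (y, x) \<in> K" if X: "x \<in> ?X" "y \<in> ?X" for x y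
    using X(1)
  proof (cases rule: K_cases)
    case x: 1
    from X(2) show ?thesis
      by (cases rule: K_cases) (use x DI(6) i in \<open>auto simp: K_simps\<close>)
  next
    case x: 2
    from X(2) show ?thesis
      by (cases rule: K_cases) (use x DI(6) DJ(6) i in \<open>auto simp: K_simps\<close>)
  qed
  show "finite_ordinal K" by (rule finite_ordinalI(1)[OF 1 2 3 4 5 6])
  show "Field K = ?X" by (rule finite_ordinalI(2)[OF 1 2 3 4 5 6])
qed

lemmas DK = finite_ordinalD[OF finite_ordinal_K]

lemma max_J: "ord_max J \<in> Field J" "y \<in> Field J \<Longrightarrow> (y, ord_max J) \<in> J"
  and min_J: "ord_min J \<in> Field J" "y \<in> Field J \<Longrightarrow> (ord_min J, y) \<in> J"
  using ord_max[OF J] ord_min[OF J] by auto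

lemma max_min_J: "ord_max J \<notin> Field I" "ord_min J \<notin> Field I" "ord_max J \<noteq> i" "ord_min J \<noteq> i"
  using max_J min_J not_both i by auto

lemma gap_map_Gap:
  assumes g: "g \<in> Gap I"
  shows "gap_map i J g \<in> Gap K"
proof -
  obtain u v where uv: "g = (u, v)" by (cases g)
  then have g': "(u, v) \<in> Gap I" using g by simp
  have F: "u \<in> Field I" "v \<in> Field I" "u \<noteq> v" "(u, v) \<in> I"
    using Gap_Field[OF g'] g' by (auto simp: Gap_iff ord_lt_def)
  note le = Gap_le[OF I g']
  define u' where "u' = (if u = i then ord_max J else u)"
  define v' where "v' = (if v = i then ord_min J else v)"
  have lt: "ord_lt K u' v'"
    using F max_J min_J max_min_J by (auto simp: u'_def v'_def ord_lt_def K_simps)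
  have "\<not> (ord_lt K u' w \<and> ord_lt K w v')" for w
  proof
    assume "ord_lt K u' w \<and> ord_lt K w v'"
    then have w: "(u', w) \<in> K" "u' \<noteq> w" "(w, v') \<in> K" "w \<noteq> v'" by (auto simp: ord_lt_def)
    then have "w \<in> (Field I - {i}) \<union> Field J" using K_in by blast
    then show False
    proof (cases rule: K_cases)
      case 1
      then have "(u, w) \<in> I" "(w, v) \<in> I"
        using w F max_J min_J by (auto simp: u'_def v'_def K_simps split: if_splits)
      moreover have "w \<noteq> u" "w \<noteq> v" using w 1 by (auto simp: u'_def v'_def)
      ultimately show False using g' by (auto simp: Gap_iff ord_lt_def)
    next
      case 2
      have ui: "u = i \<Longrightarrow> False"
      proof -
        assume "u = i"
        then have "(ord_max J, w) \<in> J" "ord_max J \<noteq> w" using w 2 max_J by (auto simp: u'_def K_simps)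
        then show False using DJ(5) max_J(2)[OF 2(1)] by blast
      qed
      have vi: "v = i \<Longrightarrow> False"
      proof -
        assume "v = i"
        then have "(w, ord_min J) \<in> J" "ord_min J \<noteq> w" using w 2 min_J by (auto simp: v'_def K_simps)
        then show False using DJ(5) min_J(2)[OF 2(1)] by blast
      qed
      have "(u, i) \<in> I" "(i, v) \<in> I"
        using w 2 F ui vi by (auto simp: u'_def v'_def K_simps split: if_splits)
      then show False using g' ui vi by (auto simp: Gap_iff ord_lt_def)
    qed
  qed
  then show ?thesis using lt uv by (auto simp: gap_map_def Gap_iff u'_def v'_def)
qed

lemma Gap_J_K: "g \<in> Gap J \<Longrightarrow> g \<in> Gap K"
proof -
  assume g: "g \<in> Gap J"
  obtain u v where uv: "g = (u, v)" by (cases g)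
  then have g': "(u, v) \<in> Gap J" using g by simp
  have F: "u \<in> Field J" "v \<in> Field J" "u \<noteq> v" "(u, v) \<in> J"
    using Gap_Field[OF g'] g' by (auto simp: Gap_iff ord_lt_def)
  have "\<not> (ord_lt K u w \<and> ord_lt K w v)" for w
  proof
    assume "ord_lt K u w \<and> ord_lt K w v"
    then have w: "(u, w) \<in> K" "u \<noteq> w" "(w, v) \<in> K" "w \<noteq> v" by (auto simp: ord_lt_def)
    then have "w \<in> (Field I - {i}) \<union> Field J" using K_in by blast
    then show False
    proof (cases rule: K_cases)
      case 1 then show False using w F between_i by (auto simp: K_simps)
    next
      case 2 then show False using w F g' by (auto simp: K_simps Gap_iff ord_lt_def)
    qed
  qed
  then show ?thesis using F uv by (auto simp: Gap_iff ord_lt_def K_simps)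
qed

text \<open>A gap with both ends in \<open>J\<close> is a gap of \<open>J\<close>. If just one end
  lies in \<open>J\<close>, it must be an extreme element of \<open>J\<close>, and replacing it by
  \<open>i\<close> gives a gap of \<open>I\<close>. With both ends in \<open>I\<close>, the point
  \<open>i\<close> cannot lie between them, since all of \<open>J\<close> would.\<close>

lemma Gap_K: "Gap K = gap_map i J ` Gap I \<union> Gap J"
proof (intro equalityI subsetI)
  fix g assume g: "g \<in> Gap K"
  obtain u v where uv: "g = (u, v)" by (cases g)
  then have g': "(u, v) \<in> Gap K" using g by simp
  have K: "(u, v) \<in> K" "u \<noteq> v" and between: "\<And>w. (u, w) \<in> K \<Longrightarrow> (w, v) \<in> K \<Longrightarrow> w = u \<or> w = v"
    using g' by (auto simp: Gap_iff ord_lt_def)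
  have F: "u \<in> (Field I - {i}) \<union> Field J" "v \<in> (Field I - {i}) \<union> Field J" using K_in[OF K(1)] by auto
  have imgI: "g \<in> gap_map i J ` Gap I" if "(a, b) \<in> Gap I" "gap_map i J (a, b) = g" for a b
    using that by blast
  have GI: "(a, b) \<in> Gap I" if "(a, b) \<in> I" "a \<noteq> b" "\<And>w. (a, w) \<in> I \<Longrightarrow> (w, b) \<in> I \<Longrightarrow> w = a \<or> w = b" for a b
    using that by (auto simp: Gap_iff ord_lt_def)
  from F(1) show "g \<in> gap_map i J ` Gap I \<union> Gap J"
  proof (cases rule: K_cases)
    case u: 1
    from F(2) show ?thesis
    proof (cases rule: K_cases)
      case v: 1
      have "(u, v) \<in> Gap I"
      proof (rule GI)
        fix w assume w: "(u, w) \<in> I" "(w, v) \<in> I"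
        have wF: "w \<in> Field I" using w DI(7) by blast
        have "w \<noteq> i"
        proof
          assume "w = i"
          then have "(u, ord_min J) \<in> K" "(ord_min J, v) \<in> K" using w u v min_J by (auto simp: K_simps)
          then show False using between u v min_J by blast
        qed
        then show "w = u \<or> w = v" using between[of w] w u v wF by (simp add: K_simps)
      qed (use K u v in \<open>auto simp: K_simps\<close>)
      then show ?thesis using imgI[of u v] u v uv by (auto simp: gap_map_def)
    next
      case v: 2
      have "v = ord_min J"
      proof (rule ccontr)
        assume "v \<noteq> ord_min J"
        moreover have "(u, ord_min J) \<in> K" "(ord_min J, v) \<in> K" using K u v min_J by (auto simp: K_simps)
        ultimately show False using between[of "ord_min J"] u min_J by auto
      qed
      moreover have "(u, i) \<in> Gap I"
      proof (rule GI)
        fix w assume w: "(u, w) \<in> I" "(w, i) \<in> I"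
        have wF: "w \<in> Field I" using w DI(7) by blast
        show "w = u \<or> w = i"
          using between[of w] w u v wF by (cases "w = i") (auto simp: K_simps)
      qed (use K u v in \<open>auto simp: K_simps\<close>)
      ultimately show ?thesis using imgI[of u i] u v uv by (auto simp: gap_map_def)
    qed
  next
    case u: 2
    from F(2) show ?thesis
    proof (cases rule: K_cases)
      case v: 1
      have "u = ord_max J"
      proof (rule ccontr)
        assume "u \<noteq> ord_max J"
        moreover have "(u, ord_max J) \<in> K" "(ord_max J, v) \<in> K" using K u v max_J by (auto simp: K_simps)
        ultimately show False using between[of "ord_max J"] v max_J by auto
      qed
      moreover have "(i, v) \<in> Gap I"
      proof (rule GI)
        fix w assume w: "(i, w) \<in> I" "(w, v) \<in> I"
        have wF: "w \<in> Field I" using w DI(7) by blast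
        show "w = i \<or> w = v"
          using between[of w] w u v wF by (cases "w = i") (auto simp: K_simps)
      qed (use K u v in \<open>auto simp: K_simps\<close>)
      ultimately show ?thesis using imgI[of i v] u v uv by (auto simp: gap_map_def)
    next
      case v: 2
      have "w = u \<or> w = v" if "(u, w) \<in> J" "(w, v) \<in> J" for w
        using between[of w] that u v DJ(7)[OF that(2)] by (auto simp: K_simps)
      then have "(u, v) \<in> Gap J" using K u v by (auto simp: Gap_iff ord_lt_def K_simps)
      then show ?thesis using uv by simp
    qed
  qed
qed (use gap_map_Gap Gap_J_K in auto)

sublocale G: gluing "Gap K" "Gap I" "gap_map i J" "Gap J" "\<lambda>g. g"
proof
  have F: "fst g \<in> Field I" "snd g \<in> Field I" "fst g \<noteq> snd g" if "g \<in> Gap I" for g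
    using that Gap_Field[of "fst g" "snd g" I] by (auto simp: Gap_def ord_lt_def)
  show "inj_on (gap_map i J) (Gap I)"
  proof
    fix g h assume gh: "g \<in> Gap I" "h \<in> Gap I" "gap_map i J g = gap_map i J h"
    then show "g = h"
      using F[of g] F[of h] max_min_J by (cases g; cases h) (auto simp: gap_map_def split: if_splits)
  qed
  \<comment> \<open>The ends of a gap of \<open>I\<close> differ, so at least one is not
    \<open>i\<close> and stays in \<open>Field I\<close>, whereas both ends of a gap of
    \<open>J\<close> lie in \<open>Field J\<close>.\<close>
  show "gap_map i J ` Gap I \<inter> (\<lambda>g. g) ` Gap J = {}"
  proof -
    have "gap_map i J g \<notin> Gap J" if g: "g \<in> Gap I" for g
    proof
      assume "gap_map i J g \<in> Gap J"
      then show False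
        using F[OF g] Gap_Field[of "fst (gap_map i J g)" "snd (gap_map i J g)" J] not_both
        by (cases g) (auto simp: gap_map_def split: if_splits)
    qed
    then show ?thesis by auto
  qed
qed (use finite_Gap I J Gap_K in auto)

abbreviation gl where "gl \<equiv> glue (Gap K) (Gap I) (gap_map i J) (Gap J) (\<lambda>g. g)"

lemma insert_iso_image:
  assumes "A \<subseteq> coord_space (Gap I)" "B \<subseteq> coord_space (Gap J)"
  shows "insert_iso I i J ` (A \<times> B) = gl A B"
  using G.image_eq_glue[OF assms] by (simp add: insert_iso_def)

text \<open>The trace of a subset on \<open>I\<close>. Requiring all of \<open>J\<close>, and not
  just some element of it, before \<open>i\<close> is included agrees with the dimensions: a proper
  part of \<open>J\<close> contributes its full cardinality, all of \<open>J\<close> contributes one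
  less.\<close>

definition collapse :: "'i set \<Rightarrow> 'i set" where
  "collapse X = {x \<in> Field I. if x = i then Field J \<subseteq> X else x \<in> X}"

lemma collapse_simps:
  "i \<in> collapse X \<longleftrightarrow> Field J \<subseteq> X" "x \<noteq> i \<Longrightarrow> x \<in> collapse X \<longleftrightarrow> x \<in> Field I \<and> x \<in> X"
  using i by (auto simp: collapse_def)

lemma collapse_Field: "collapse X \<subseteq> Field I" by (auto simp: collapse_def)

lemma down_closed_collapse:
  assumes X: "down_closed K X"
  shows "down_closed I (collapse X)" "down_closed J (X \<inter> Field J)"
proof -
  have X': "c \<in> X" if "b \<in> X" "(c, b) \<in> K" for b c using X that unfolding down_closed_def by blast
  have "c \<in> collapse X" if b: "b \<in> collapse X" and c: "(c, b) \<in> I" for b c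
  proof -
    have F: "b \<in> Field I" "c \<in> Field I" using c DI(7,8) by auto
    show ?thesis
    proof (cases "c = i")
      case ci: True
      show ?thesis
      proof (cases "b = i")
        case True then show ?thesis using b ci by simp
      next
        case False
        then have "y \<in> X" if "y \<in> Field J" for y
          using X'[of b y] b c ci F that by (auto simp: collapse_simps K_simps)
        then show ?thesis using ci by (auto simp: collapse_simps)
      qed
    next
      case ci: False
      show ?thesis
      proof (cases "b = i")
        case True
        then have "ord_min J \<in> X" using b min_J by (auto simp: collapse_simps)
        then have "c \<in> X" using X'[of "ord_min J" c] c True ci F min_J by (auto simp: K_simps)
        then show ?thesis using ci F by (simp add: collapse_simps)
      next
        case False
        then show ?thesis using X'[of b c] b c ci F by (auto simp: collapse_simps K_simps)
      qed
    qed
  qed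
  then show "down_closed I (collapse X)" using collapse_Field by (auto simp: down_closed_def)
  have "c \<in> X \<inter> Field J" if "b \<in> X \<inter> Field J" "(c, b) \<in> J" for b c
    using X'[of b c] that DJ(7)[OF that(2)] by (auto simp: K_simps)
  then show "down_closed J (X \<inter> Field J)" unfolding down_closed_def by blast
qed

lemma up_closed_collapse:
  assumes X: "up_closed K X"
  shows "up_closed I (collapse X)" "up_closed J (X \<inter> Field J)"
proof -
  have X': "c \<in> X" if "b \<in> X" "(b, c) \<in> K" for b c using X that unfolding up_closed_def by blast
  have "c \<in> collapse X" if b: "b \<in> collapse X" and c: "(b, c) \<in> I" for b c
  proof -
    have F: "b \<in> Field I" "c \<in> Field I" using c DI(7,8) by auto
    show ?thesis
    proof (cases "c = i")
      case ci: True
      show ?thesis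
      proof (cases "b = i")
        case True then show ?thesis using b ci by simp
      next
        case False
        then have "y \<in> X" if "y \<in> Field J" for y
          using X'[of b y] b c ci F that by (auto simp: collapse_simps K_simps)
        then show ?thesis using ci by (auto simp: collapse_simps)
      qed
    next
      case ci: False
      show ?thesis
      proof (cases "b = i")
        case True
        then have "ord_min J \<in> X" using b min_J by (auto simp: collapse_simps)
        then have "c \<in> X" using X'[of "ord_min J" c] c True ci F min_J by (auto simp: K_simps)
        then show ?thesis using ci F by (simp add: collapse_simps)
      next
        case False
        then show ?thesis using X'[of b c] b c ci F by (auto simp: collapse_simps K_simps)
      qed
    qed
  qed
  then show "up_closed I (collapse X)" using collapse_Field by (auto simp: up_closed_def)
  have "c \<in> X \<inter> Field J" if "b \<in> X \<inter> Field J" "(b, c) \<in> J" for b c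
    using X'[of b c] that DJ(8)[OF that(2)] by (auto simp: K_simps)
  then show "up_closed J (X \<inter> Field J)" unfolding up_closed_def by blast
qed

lemma convex_collapse:
  assumes X: "convex_in K X"
  shows "convex_in I (collapse X)" "convex_in J (X \<inter> Field J)"
proof -
  have X': "c \<in> X" if "a \<in> X" "b \<in> X" "(a, c) \<in> K" "(c, b) \<in> K" for a b c
    using X that unfolding convex_in_def by blast
  \<comment> \<open>Every element of the collapsed set is represented by an element of
    \<open>X\<close> that compares with the rest of \<open>I\<close> in the same way:
    \<open>i\<close> by an element of \<open>J\<close>, any other element by itself.\<close>
  have rep: "\<exists>a'\<in>X. a' \<in> (Field I - {i}) \<union> Field J \<and> (if a = i then a' \<in> Field J else a' = a)"
    if "a \<in> collapse X" for a
  proof (cases "a = i")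
    case True
    then show ?thesis using that min_J by (auto simp: collapse_simps)
  next
    case False
    then show ?thesis using that by (auto simp: collapse_simps)
  qed
  have "c \<in> collapse X" if ab: "a \<in> collapse X" "b \<in> collapse X" and c: "(a, c) \<in> I" "(c, b) \<in> I" for a b c
  proof -
    have F: "a \<in> Field I" "b \<in> Field I" "c \<in> Field I" using c DI(7,8) by auto
    obtain a' where a': "a' \<in> X" "if a = i then a' \<in> Field J else a' = a" using rep[OF ab(1)] by blast
    obtain b' where b': "b' \<in> X" "if b = i then b' \<in> Field J else b' = b" using rep[OF ab(2)] by blast
    show ?thesis
    proof (cases "c = i")
      case ci: True
      show ?thesis
      proof (cases "a = i \<or> b = i")
        case True then show ?thesis using ab ci by auto
      next
        case False
        then have "y \<in> X" if "y \<in> Field J" for y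
          using X'[of a b y] ab c ci F that by (auto simp: collapse_simps K_simps)
        then show ?thesis using ci by (auto simp: collapse_simps)
      qed
    next
      case ci: False
      have "(a', c) \<in> K" using a' c(1) ci F by (auto simp: K_simps split: if_splits)
      moreover have "(c, b') \<in> K" using b' c(2) ci F by (auto simp: K_simps split: if_splits)
      ultimately have "c \<in> X" using X' a' b' by blast
      then show ?thesis using ci F by (simp add: collapse_simps)
    qed
  qed
  then show "convex_in I (collapse X)" using collapse_Field unfolding convex_in_def by blast
  have "c \<in> X \<inter> Field J" if "a \<in> X \<inter> Field J" "b \<in> X \<inter> Field J" "(a, c) \<in> J" "(c, b) \<in> J" for a b c
    using X'[of a b c] that DJ(7)[OF that(4)] by (auto simp: K_simps)
  then show "convex_in J (X \<inter> Field J)" unfolding convex_in_def by blast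
qed

lemma collapse_eq_Field: "X \<subseteq> Field K \<Longrightarrow> collapse X = Field I \<longleftrightarrow> X = Field K"
  using i by (auto simp: collapse_def Field_K)

lemma collapse_insert:
  "x \<in> Field I \<Longrightarrow> x \<noteq> i \<Longrightarrow> collapse (insert x X) = insert x (collapse X)"
  "x \<in> Field J \<Longrightarrow> collapse (insert x X) = (if Field J \<subseteq> insert x X then insert i (collapse X) else collapse X)"
  using not_both i by (auto simp: collapse_def)

text \<open>The closure of brick manifolds under composition, free of the eight cases: traces on
  \<open>I\<close> and \<open>J\<close> preserve convex, initial and final sets, and a direct sum
  adds dimensions and keeps inclusions and coordinate subspaces.\<close>

lemma brick_family_glue:
  fixes E F :: "'i set \<Rightarrow> ('i \<times> 'i \<Rightarrow> 'a::field) set"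
  assumes E: "brick_family I E" and F: "brick_family J F"
  shows "brick_family K (\<lambda>X. gl (E (collapse X)) (F (X \<inter> Field J)))"
proof -
  note E = E brick_familyD[OF E] and F = F brick_familyD[OF F]
  have 1: "fvs.subspace (gl (E (collapse X)) (F (X \<inter> Field J)))" if "convex_in K X" for X
    by (rule G.subspace_glue[OF E(2) F(2)]) (rule convex_collapse[OF that])+
  have 2: "fvs.dim (gl (E (collapse X)) (F (X \<inter> Field J))) = card X" if X: "convex_in K X" "X \<noteq> Field K" for X
  proof -
    note c = convex_collapse[OF X(1)]
    have XF: "X \<subseteq> Field K" using X by (simp add: convex_in_def)
    then have ne: "collapse X \<noteq> Field I" using collapse_eq_Field X(2) by simp
    have fX: "finite X" using XF DK(1) finite_subset by blast
    have XI: "X = (X \<inter> (Field I - {i})) \<union> (X \<inter> Field J)" using XF Field_K by blast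
    have "card X = card ((X \<inter> (Field I - {i})) \<union> (X \<inter> Field J))" using XI by simp
    also have "\<dots> = card (X \<inter> (Field I - {i})) + card (X \<inter> Field J)"
      by (rule card_Un_disjoint) (use fX not_both in auto)
    finally have card: "card X = card (X \<inter> (Field I - {i})) + card (X \<inter> Field J)" .
    have d: "fvs.dim (gl (E (collapse X)) (F (X \<inter> Field J))) = card (collapse X) + fvs.dim (F (X \<inter> Field J))"
      using G.dim_glue[OF E(2,3)[OF c(1)] F(2,3)[OF c(2)]] E(4)[OF c(1) ne] by simp
    show ?thesis
    proof (cases "Field J \<subseteq> X")
      case True
      then have XJ: "X \<inter> Field J = Field J" by blast
      \<comment> \<open>The point \<open>i\<close> adds one to the dimension and \<open>G(J)\<close>
        falls short of \<open>card (Field J)\<close> by one, so the corrections cancel.\<close>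
      have "collapse X = insert i (X \<inter> (Field I - {i}))" using True i by (auto simp: collapse_def)
      then have "card (collapse X) = Suc (card (X \<inter> (Field I - {i})))" using fX by simp
      \<comment> \<open>Positivity is needed because \<open>card (Field J) - 1\<close> is a
        truncated subtraction.\<close>
      moreover have "card (Field J) > 0" using DJ(1,2) by (simp add: card_gt_0_iff)
      ultimately show ?thesis using d card XJ brick_family_Field(3)[OF J F(1)] by simp
    next
      case False
      then have "X \<inter> Field J \<noteq> Field J" by blast
      moreover have "collapse X = X \<inter> (Field I - {i})" using False by (auto simp: collapse_def)
      ultimately show ?thesis using d card F(4)[OF c(2)] by simp
    qed
  qed
  have 3: "gl (E (collapse X)) (F (X \<inter> Field J)) \<subseteq> gl (E (collapse (insert x X))) (F (insert x X \<inter> Field J))"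
    if X: "convex_in K X" "convex_in K (insert x X)" for X x
  proof -
    note c = convex_collapse[OF X(1)] and c' = convex_collapse[OF X(2)]
    have "x \<in> (Field I - {i}) \<union> Field J" using X(2) Field_K by (auto simp: convex_in_def)
    then show ?thesis
    proof (cases rule: K_cases)
      case x: 1
      have "insert x X \<inter> Field J = X \<inter> Field J" using x by blast
      then show ?thesis
        using E(5)[OF c(1), of x] c'(1) by (intro glue_mono) (auto simp: collapse_insert(1)[OF x(1,2)])
    next
      case x: 2
      have J': "insert x X \<inter> Field J = insert x (X \<inter> Field J)" using x by blast
      \<comment> \<open>A new point of \<open>J\<close> changes the trace on \<open>I\<close> only
        if it completes \<open>J\<close>, and then exactly by \<open>i\<close>.\<close>
      have "E (collapse X) \<subseteq> E (collapse (insert x X))"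
        using E(5)[OF c(1), of i] c'(1) by (auto simp: collapse_insert(2)[OF x(1)] split: if_splits)
      then show ?thesis using F(5)[OF c(2), of x] c'(2) unfolding J' by (intro glue_mono)
    qed
  qed
  have gm: "fst (gap_map i J g) = (if fst g = i then ord_max J else fst g)"
    "snd (gap_map i J g) = (if snd g = i then ord_min J else snd g)" for g
    by (auto simp: gap_map_def split: prod.splits)
  have FI: "fst g \<in> Field I" "snd g \<in> Field I" if "g \<in> Gap I" for g
    using Gap_Field[of "fst g" "snd g" I] that by auto
  have FJ: "fst g \<in> Field J" "snd g \<in> Field J" if "g \<in> Gap J" for g
    using Gap_Field[of "fst g" "snd g" J] that by auto
  have 4: "gl (E (collapse X)) (F (X \<inter> Field J)) = coord_space {g \<in> Gap K. fst g \<in> X}" if X: "down_closed K X" for X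
  proof -
    note c = down_closed_collapse[OF X]
    have "fst (gap_map i J g) \<in> X \<longleftrightarrow> fst g \<in> collapse X" if "g \<in> Gap I" for g
    proof (cases "fst g = i")
      case True
      \<comment> \<open>After insertion, the gap that left \<open>i\<close> starts at the last
        element of \<open>J\<close>; an initial set contains that element only if it contains all of
        \<open>J\<close>.\<close>
      have "ord_max J \<in> X \<longleftrightarrow> Field J \<subseteq> X"
      proof
        assume "ord_max J \<in> X"
        then show "Field J \<subseteq> X" using X max_J K_JJ unfolding down_closed_def by blast
      qed (use max_J in auto)
      then show ?thesis using True by (simp add: gm collapse_simps)
    next
      case False then show ?thesis using FI[OF that] by (simp add: gm collapse_simps)
    qed
    then have "{g \<in> Gap K. fst g \<in> X} =
        gap_map i J ` {g \<in> Gap I. fst g \<in> collapse X} \<union> (\<lambda>g. g) ` {g \<in> Gap J. fst g \<in> X \<inter> Field J}"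
      using FJ unfolding Gap_K by auto
    then show ?thesis unfolding E(6)[OF c(1)] F(6)[OF c(2)]
      by (subst G.glue_coord_space) auto
  qed
  have 5: "gl (E (collapse X)) (F (X \<inter> Field J)) = coord_space {g \<in> Gap K. snd g \<in> X}" if X: "up_closed K X" for X
  proof -
    note c = up_closed_collapse[OF X]
    have "snd (gap_map i J g) \<in> X \<longleftrightarrow> snd g \<in> collapse X" if "g \<in> Gap I" for g
    proof (cases "snd g = i")
      case True
      have "ord_min J \<in> X \<longleftrightarrow> Field J \<subseteq> X"
      proof
        assume "ord_min J \<in> X"
        then show "Field J \<subseteq> X" using X min_J K_JJ unfolding up_closed_def by blast
      qed (use min_J in auto)
      then show ?thesis using True by (simp add: gm collapse_simps)
    next
      case False then show ?thesis using FI[OF that] by (simp add: gm collapse_simps)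
    qed
    then have "{g \<in> Gap K. snd g \<in> X} =
        gap_map i J ` {g \<in> Gap I. snd g \<in> collapse X} \<union> (\<lambda>g. g) ` {g \<in> Gap J. snd g \<in> X \<inter> Field J}"
      using FJ unfolding Gap_K by auto
    then show ?thesis unfolding E(7)[OF c(1)] F(7)[OF c(2)]
      by (subst G.glue_coord_space) auto
  qed
  show ?thesis unfolding brick_family_def using 1 2 3 4 5 glue_subset by blast
qed

end

context insertion begin

text \<open>All eight cases in the definition of the composition are instances of one formula, because the
  families have been extended to the empty and to the full interval.\<close>

lemma brick_ext_comp:
  fixes V W :: "('i, 'a::field) subspaces"
  assumes V: "V \<in> bricks I" and W: "W \<in> bricks J" and X: "convex_in K X"
  shows "brick_ext K (brick_comp I i J V W) X = gl (brick_ext I V (collapse X)) (brick_ext J W (X \<inter> Field J))"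
proof -
  note fI = bricks_imp_brick_family[OF I V] and fJ = bricks_imp_brick_family[OF J W]
  note c = convex_collapse[OF X]
  consider "X = {}" | "X = Field K" | "X \<noteq> {}" "X \<noteq> Field K" by blast
  then show ?thesis
  proof cases
    case 1
    then have "collapse X = {}" using DJ(2) by (auto simp: collapse_def)
    then have "gl (brick_ext I V (collapse X)) (brick_ext J W (X \<inter> Field J)) = coord_space {}"
      using 1 G.glue_coord_space[of "{}" "{}"] by (simp add: brick_ext_empty coord_space_empty)
    then show ?thesis using 1 by (simp add: brick_ext_empty coord_space_empty)
  next
    case 2
    have cF: "collapse X = Field I" using 2 collapse_eq_Field by blast
    have XJ: "X \<inter> Field J = Field J" using 2 Field_K by blast
    have "gl (coord_space (Gap I)) (coord_space (Gap J)) = (coord_space (Gap K) :: ('i \<times> 'i \<Rightarrow> 'a) set)"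
      by (subst G.glue_coord_space) (use Gap_K in auto)
    then show ?thesis unfolding cF XJ brick_ext_Field[OF I] brick_ext_Field[OF J]
      unfolding 2 brick_ext_Field[OF finite_ordinal_K] by simp
  next
    case 3
    define a where "a = lo K X"
    define b where "b = hi K X"
    have Xab: "X = ord_interval K a b"
      using interval_lo_hi[OF finite_ordinal_K X 3(1)] by (simp add: a_def b_def)
    have p: "(a, b) \<in> proper_intervals K"
      unfolding a_def b_def by (rule proper_intervals_lo_hi[OF finite_ordinal_K X 3])
    then have ab: "(a, b) \<in> K" by (simp add: proper_intervals_iff)
    have XF: "X \<subseteq> Field K" using X by (simp add: convex_in_def)
    have ne: "collapse X \<noteq> Field I" using collapse_eq_Field[OF XF] 3(2) by simp
    have mem: "x \<in> X \<longleftrightarrow> (a, x) \<in> K \<and> (x, b) \<in> K" for x by (simp add: Xab ord_interval_def)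
    have "a \<in> (Field I - {i}) \<union> Field J" "b \<in> (Field I - {i}) \<union> Field J" using K_in[OF ab] by auto
    have VI: "V (u, v) = brick_ext I V (collapse X)" if "(u, v) \<in> I" "collapse X = ord_interval I u v" for u v
      using brick_ext_interval[OF I, of u v V] that ne by (simp add: proper_intervals_iff)
    \<comment> \<open>A copy of the case distinction in \<open>brick_comp\<close>, evaluated below
      according to the origin of the two end points.\<close>
    let ?P = "\<lambda>a b. if (a, b) \<in> I \<and> (ord_lt I b i \<or> ord_lt I i a) then V (a, b) \<times> {0}
        else if (a, b) \<in> J \<and> (a, b) \<noteq> (ord_min J, ord_max J) then {0} \<times> W (a, b)
        else if ord_lt I a i \<and> b \<in> Field J \<and> b \<noteq> ord_max J
          then V (a, ord_pred I i) \<times> Gint J (ord_min J) (ord_succ J b)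
        else if a \<in> Field J \<and> a \<noteq> ord_min J \<and> ord_lt I i b
          then V (ord_succ I i, b) \<times> Gint J (ord_pred J a) (ord_max J)
        else if (a, b) = (ord_min J, ord_max J) then V (i, i) \<times> Gsp J
        else if ord_lt I a i \<and> b = ord_max J then V (a, i) \<times> Gsp J
        else if a = ord_min J \<and> ord_lt I i b then V (i, b) \<times> Gsp J
        else V (a, b) \<times> Gsp J"
    have full: "brick_ext J W (X \<inter> Field J) = Gsp J" if "Field J \<subseteq> X"
    proof -
      have "X \<inter> Field J = Field J" using that by blast
      then show ?thesis using brick_ext_Field[OF J] by (simp add: Gsp_def)
    qed
    have none: "brick_ext J W (X \<inter> Field J) = {0}" if "X \<inter> Field J = {}"
      using that by (simp add: brick_ext_empty)
    have "?P a b = brick_ext I V (collapse X) \<times> brick_ext J W (X \<inter> Field J)"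
      using \<open>a \<in> _\<close>
    proof (cases rule: K_cases)
      case a: 1
      have aJ: "(a, b) \<notin> J" for b using a DJ(7) by blast
      from \<open>b \<in> _\<close> show ?thesis
      proof (cases rule: K_cases)
        case b: 1
        have abI: "(a, b) \<in> I" using ab a b by (simp add: K_simps)
        \<comment> \<open>With both ends in \<open>I\<close>, the interval contains all of
          \<open>J\<close> if \<open>i\<close> lies between the ends, and none of it
          otherwise.\<close>
        have i_mem: "Field J \<subseteq> X \<longleftrightarrow> (a, i) \<in> I \<and> (i, b) \<in> I"
          using min_J a b by (auto simp: mem K_simps)
        have col: "collapse X = ord_interval I a b"
        proof -
          have "x \<in> collapse X \<longleftrightarrow> x \<in> ord_interval I a b" if x: "x \<in> Field I" for x
          proof (cases "x = i")
            case True then show ?thesis using i_mem by (simp add: collapse_simps ord_interval_def)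
          next
            case False then show ?thesis using x a b by (simp add: collapse_simps mem K_simps ord_interval_def)
          qed
          moreover have "ord_interval I a b \<subseteq> Field I" using DI(7) by (auto simp: ord_interval_def)
          ultimately show ?thesis using collapse_Field by blast
        qed
        show ?thesis
        proof (cases "(a, i) \<in> I \<and> (i, b) \<in> I")
          case True
          then have "\<not> ord_lt I b i" "\<not> ord_lt I i a"
            using between_i a b by (auto simp: ord_lt_def)
          then have "?P a b = V (a, b) \<times> Gsp J"
            using a b max_min_J max_J min_J aJ by auto
          then show ?thesis using VI[OF abI col] full i_mem True by simp
        next
          case False
          then have lt: "ord_lt I b i \<or> ord_lt I i a"
            using DI(6)[OF a(1) i] DI(6)[OF b(1) i] a b by (auto simp: ord_lt_def)
          have "X \<inter> Field J = {}" using False a b by (auto simp: mem K_simps)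
          then show ?thesis using lt abI VI[OF abI col] none by simp
        qed
      next
        case b: 2
        have ai: "(a, i) \<in> I" using ab a b by (simp add: K_simps)
        then have lt: "ord_lt I a i" using a by (simp add: ord_lt_def)
        have nI: "(a, b) \<notin> I" using b DI(8) by blast
        have memJ: "x \<in> X \<longleftrightarrow> (x, b) \<in> J" if "x \<in> Field J" for x using that a b ai by (simp add: mem K_simps)
        have memI: "x \<in> X \<longleftrightarrow> (a, x) \<in> I \<and> (x, i) \<in> I" if "x \<in> Field I" "x \<noteq> i" for x
          using that a b by (simp add: mem K_simps)
        show ?thesis
        proof (cases "b = ord_max J")
          case True
          have JX: "Field J \<subseteq> X" using memJ max_J True by blast
          have "x \<in> collapse X \<longleftrightarrow> x \<in> ord_interval I a i" if x: "x \<in> Field I" for x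
            using JX memI[OF x] ai DI(3)[OF i] by (cases "x = i") (auto simp: collapse_simps ord_interval_def x)
          moreover have "ord_interval I a i \<subseteq> Field I" using DI(7) by (auto simp: ord_interval_def)
          ultimately have col: "collapse X = ord_interval I a i" using collapse_Field by blast
          have "?P a b = V (a, i) \<times> Gsp J" using nI aJ lt True a min_J max_J by auto
          then show ?thesis using VI[OF ai col] full JX by simp
        next
          case False
          \<comment> \<open>\<open>a\<close> lies strictly below \<open>i\<close>, so the
            predecessor of \<open>i\<close> named in this case exists.\<close>
          have "ord_min I \<noteq> i" using ai a ord_min(2)[OF I a(1)] DI(5) by blast
          then have g: "(ord_pred I i, i) \<in> Gap I" using ord_pred[OF I i] by blast
          have pi: "ord_pred I i \<noteq> i" "(ord_pred I i, i) \<in> I" using g by (auto simp: Gap_iff ord_lt_def)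
          have le: "(x, i) \<in> I \<and> x \<noteq> i \<longleftrightarrow> (x, ord_pred I i) \<in> I" if x: "x \<in> Field I" for x
            using Gap_le[OF I g x] pi DI(4)[of x "ord_pred I i" i] DI(3)[OF x] DI(5)[of i x] by blast
          have ap: "(a, ord_pred I i) \<in> I" using le[OF a(1)] ai a by blast
          have nJX: "\<not> Field J \<subseteq> X"
            using memJ[OF max_J(1)] max_J(1) DJ(5)[OF max_J(2)[OF b(1)]] False by blast
          have "x \<in> collapse X \<longleftrightarrow> x \<in> ord_interval I a (ord_pred I i)" if x: "x \<in> Field I" for x
            using nJX memI[OF x] le[OF x] by (cases "x = i") (auto simp: collapse_simps ord_interval_def x)
          moreover have "ord_interval I a (ord_pred I i) \<subseteq> Field I" using DI(7) by (auto simp: ord_interval_def)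
          ultimately have col: "collapse X = ord_interval I a (ord_pred I i)" using collapse_Field by blast
          have XJ: "X \<inter> Field J = ord_interval J (ord_min J) b"
            using memJ min_J(2) DJ(7) by (auto simp: ord_interval_def)
          \<comment> \<open>The trace on \<open>J\<close> is an initial segment, where the value of
            \<open>W\<close> is prescribed by the boundary condition. This is why the definition can
            use \<open>Gint J\<close> in this case without mentioning \<open>W\<close>.\<close>
          have dc: "down_closed J (X \<inter> Field J)"
            unfolding down_closed_def using memJ DJ(4)[of _ _ b] DJ(7) by blast
          have "brick_ext J W (X \<inter> Field J) = Gint J (ord_min J) (ord_succ J b)"
            unfolding brick_familyD(5)[OF fJ dc] Gint_initial[OF J b(1) False]
            unfolding XJ by (rule refl)
          moreover have "?P a b = V (a, ord_pred I i) \<times> Gint J (ord_min J) (ord_succ J b)"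
            using nI aJ lt False b by simp
          ultimately show ?thesis using VI[OF ap col] by simp
        qed
      qed
    next
      case a: 2
      have nI: "(a, b) \<notin> I" for b using a DI(7) by blast
      have nlt: "\<not> ord_lt I a i" using nI by (simp add: ord_lt_def)
      from \<open>b \<in> _\<close> show ?thesis
      proof (cases rule: K_cases)
        case b: 1
        have ib: "(i, b) \<in> I" using ab a b by (simp add: K_simps)
        then have lt: "ord_lt I i b" using b by (simp add: ord_lt_def)
        have nJ: "(a, b) \<notin> J" using b DJ(8) by blast
        have memJ: "x \<in> X \<longleftrightarrow> (a, x) \<in> J" if "x \<in> Field J" for x using that a b ib by (simp add: mem K_simps)
        have memI: "x \<in> X \<longleftrightarrow> (i, x) \<in> I \<and> (x, b) \<in> I" if "x \<in> Field I" "x \<noteq> i" for x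
          using that a b by (simp add: mem K_simps)
        have bm: "b \<noteq> ord_max J" using b max_J by blast
        show ?thesis
        proof (cases "a = ord_min J")
          case True
          have JX: "Field J \<subseteq> X" using memJ min_J True by blast
          have "x \<in> collapse X \<longleftrightarrow> x \<in> ord_interval I i b" if x: "x \<in> Field I" for x
            using JX memI[OF x] ib DI(3)[OF i] by (cases "x = i") (auto simp: collapse_simps ord_interval_def x)
          moreover have "ord_interval I i b \<subseteq> Field I" using DI(7) by (auto simp: ord_interval_def)
          ultimately have col: "collapse X = ord_interval I i b" using collapse_Field by blast
          have "?P a b = V (i, b) \<times> Gsp J" using nI nJ nlt lt True bm by simp
          then show ?thesis using VI[OF ib col] full JX by simp
        next
          case False
          have "ord_max I \<noteq> i" using ib b ord_max(2)[OF I b(1)] DI(5) by blast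
          then have g: "(i, ord_succ I i) \<in> Gap I" using ord_succ[OF I i] by blast
          have pi: "ord_succ I i \<noteq> i" "(i, ord_succ I i) \<in> I" using g by (auto simp: Gap_iff ord_lt_def)
          have le: "(i, x) \<in> I \<and> x \<noteq> i \<longleftrightarrow> (ord_succ I i, x) \<in> I" if x: "x \<in> Field I" for x
            using Gap_le[OF I g x] pi DI(4)[of i "ord_succ I i" x] DI(3)[OF x] DI(5)[of i x] by blast
          have ap: "(ord_succ I i, b) \<in> I" using le[OF b(1)] ib b by blast
          have nJX: "\<not> Field J \<subseteq> X"
            using memJ[OF min_J(1)] min_J(1) DJ(5)[OF min_J(2)[OF a(1)]] False by blast
          have "x \<in> collapse X \<longleftrightarrow> x \<in> ord_interval I (ord_succ I i) b" if x: "x \<in> Field I" for x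
            using nJX memI[OF x] le[OF x] by (cases "x = i") (auto simp: collapse_simps ord_interval_def x)
          moreover have "ord_interval I (ord_succ I i) b \<subseteq> Field I" using DI(7) by (auto simp: ord_interval_def)
          ultimately have col: "collapse X = ord_interval I (ord_succ I i) b" using collapse_Field by blast
          have XJ: "X \<inter> Field J = ord_interval J a (ord_max J)"
            using memJ max_J(2) DJ(8) by (auto simp: ord_interval_def)
          \<comment> \<open>Likewise the trace is a final segment of \<open>J\<close>, and the value
            of \<open>W\<close> is prescribed.\<close>
          have uc: "up_closed J (X \<inter> Field J)"
            unfolding up_closed_def using memJ DJ(4)[of a] DJ(8) by blast
          have "brick_ext J W (X \<inter> Field J) = Gint J (ord_pred J a) (ord_max J)"
            unfolding brick_familyD(6)[OF fJ uc] Gint_final[OF J a(1) False]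
            unfolding XJ by (rule refl)
          moreover have "?P a b = V (ord_succ I i, b) \<times> Gint J (ord_pred J a) (ord_max J)"
            using nI nJ nlt lt False a by simp
          ultimately show ?thesis using VI[OF ap col] by simp
        qed
      next
        case b: 2
        have abJ: "(a, b) \<in> J" using ab a b by (simp add: K_simps)
        have ltb: "\<not> ord_lt I i b" using b DI(8) by (auto simp: ord_lt_def)
        have memJ: "x \<in> X \<longleftrightarrow> (a, x) \<in> J \<and> (x, b) \<in> J" if "x \<in> Field J" for x using that a b by (simp add: mem K_simps)
        have XI: "x \<notin> X" if "x \<in> Field I" "x \<noteq> i" for x
          using that a b between_i[of x] by (auto simp: mem K_simps)
        show ?thesis
        proof (cases "(a, b) = (ord_min J, ord_max J)")
          case True
          have JX: "Field J \<subseteq> X" using memJ min_J max_J True by blast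
          \<comment> \<open>The interval is \<open>J\<close> itself, whose trace on \<open>I\<close>
            is the single point it replaces.\<close>
          have "collapse X = {i}" using JX XI i by (auto simp: collapse_def split: if_splits)
          also have "\<dots> = ord_interval I i i" using DI(3)[OF i] between_i by (auto simp: ord_interval_def)
          finally have col: "collapse X = ord_interval I i i" .
          have "?P a b = V (i, i) \<times> Gsp J" using nI nlt ltb True by simp
          then show ?thesis using VI[OF DI(3)[OF i] col] full JX by simp
        next
          case False
          have XJ: "X \<inter> Field J = ord_interval J a b"
            using memJ DJ(7) by (auto simp: ord_interval_def)
          have nJX: "\<not> Field J \<subseteq> X"
          proof
            assume "Field J \<subseteq> X"
            then have "(a, ord_min J) \<in> J" "(ord_max J, b) \<in> J" using memJ min_J(1) max_J(1) by blast+
            then show False using False DJ(5) min_J(2)[OF a(1)] max_J(2)[OF b(1)] by blast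
          qed
          then have "collapse X = {}" using XI by (auto simp: collapse_def split: if_splits)
          moreover have "brick_ext J W (X \<inter> Field J) = W (a, b)"
            unfolding XJ by (rule brick_ext_interval[OF J]) (use abJ nJX XJ in \<open>auto simp: proper_intervals_iff\<close>)
          moreover have "?P a b = {0} \<times> W (a, b)" using nI abJ False by simp
          ultimately show ?thesis by (simp add: brick_ext_empty)
        qed
      qed
    qed
    moreover have "brick_ext K (brick_comp I i J V W) X = brick_comp I i J V W (a, b)"
      using 3 by (simp add: brick_ext_def a_def b_def)
    moreover have "brick_comp I i J V W (a, b) = insert_iso I i J ` ?P a b"
      using p by (simp only: brick_comp_def restrict_apply prod.case if_True)
    ultimately show ?thesis
      using insert_iso_image[OF brick_familyD(2)[OF fI c(1)] brick_familyD(2)[OF fJ c(2)]] by simp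
  qed
qed

lemma brick_comp_bricks:
  assumes "V \<in> bricks I" "W \<in> bricks J"
  shows "brick_comp I i J V W \<in> bricks K"
proof (rule brick_family_imp_bricks[OF finite_ordinal_K])
  show "brick_comp I i J V W \<in> extensional (proper_intervals K)"
    by (simp add: brick_comp_def)
  show "brick_family K (brick_ext K (brick_comp I i J V W))"
    by (rule brick_family_cong[OF brick_ext_comp[OF assms]
        brick_family_glue[OF bricks_imp_brick_family[OF I assms(1)] bricks_imp_brick_family[OF J assms(2)]]])
qed

end

section \<open>Relabelling\<close>

locale relabelling =
  fixes I I' :: "'i rel" and \<phi> :: "'i \<Rightarrow> 'i"
  assumes I: "finite_ordinal I" and I': "finite_ordinal I'" and iso: "ord_iso I I' \<phi>"
begin

lemmas D = finite_ordinalD[OF I] and D' = finite_ordinalD[OF I']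

lemma bij: "bij_betw \<phi> (Field I) (Field I')"
  and le_iff: "x \<in> Field I \<Longrightarrow> y \<in> Field I \<Longrightarrow> (\<phi> x, \<phi> y) \<in> I' \<longleftrightarrow> (x, y) \<in> I"
  using iso by (auto simp: ord_iso_def)

lemma phi_in: "x \<in> Field I \<Longrightarrow> \<phi> x \<in> Field I'"
  using bij by (auto simp: bij_betw_def)

lemma phi_inj: "x \<in> Field I \<Longrightarrow> y \<in> Field I \<Longrightarrow> \<phi> x = \<phi> y \<longleftrightarrow> x = y"
  using bij by (auto simp: bij_betw_def inj_on_def)

lemma phi_surj: "y \<in> Field I' \<Longrightarrow> \<exists>x\<in>Field I. y = \<phi> x"
  using bij by (auto simp: bij_betw_def)

definition pre :: "'i set \<Rightarrow> 'i set" where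
  "pre X = {x \<in> Field I. \<phi> x \<in> X}"

lemma Gap_image: "Gap I' = map_prod \<phi> \<phi> ` Gap I"
proof -
  have *: "(\<phi> u, \<phi> v) \<in> Gap I' \<longleftrightarrow> (u, v) \<in> Gap I" if uv: "u \<in> Field I" "v \<in> Field I" for u v
  proof -
    have "(\<exists>w. ord_lt I' (\<phi> u) w \<and> ord_lt I' w (\<phi> v)) \<longleftrightarrow> (\<exists>w. ord_lt I u w \<and> ord_lt I w v)"
    proof
      assume "\<exists>w. ord_lt I' (\<phi> u) w \<and> ord_lt I' w (\<phi> v)"
      then obtain w where w: "ord_lt I' (\<phi> u) w" "ord_lt I' w (\<phi> v)" by blast
      then have "w \<in> Field I'" using D'(7) by (auto simp: ord_lt_def)
      then obtain x where "x \<in> Field I" "w = \<phi> x" using phi_surj by blast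
      then show "\<exists>w. ord_lt I u w \<and> ord_lt I w v"
        using w uv by (intro exI[of _ x]) (auto simp: ord_lt_def le_iff)
    next
      assume "\<exists>w. ord_lt I u w \<and> ord_lt I w v"
      then obtain w where w: "ord_lt I u w" "ord_lt I w v" by blast
      then have "w \<in> Field I" using D(7) by (auto simp: ord_lt_def)
      then show "\<exists>w. ord_lt I' (\<phi> u) w \<and> ord_lt I' w (\<phi> v)"
        using w uv by (intro exI[of _ "\<phi> w"]) (auto simp: ord_lt_def le_iff phi_inj)
    qed
    moreover have "ord_lt I' (\<phi> u) (\<phi> v) \<longleftrightarrow> ord_lt I u v"
      using uv by (simp add: ord_lt_def le_iff phi_inj)
    ultimately show ?thesis by (simp add: Gap_iff)
  qed
  show ?thesis
  proof (intro equalityI subsetI)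
    fix g assume g: "g \<in> Gap I'"
    obtain u v where uv: "g = (u, v)" by (cases g)
    then have "u \<in> Field I'" "v \<in> Field I'" using g Gap_Field[of u v I'] by auto
    then obtain x y where xy: "x \<in> Field I" "u = \<phi> x" "y \<in> Field I" "v = \<phi> y" using phi_surj by blast
    then have "(x, y) \<in> Gap I" using * g uv by simp
    moreover have "g = map_prod \<phi> \<phi> (x, y)" using uv xy by simp
    ultimately show "g \<in> map_prod \<phi> \<phi> ` Gap I" by blast
  next
    fix g assume "g \<in> map_prod \<phi> \<phi> ` Gap I"
    then obtain u v where "(u, v) \<in> Gap I" "g = (\<phi> u, \<phi> v)" by auto
    then show "g \<in> Gap I'" using * Gap_Field[of u v I] by simp
  qed
qed

text \<open>A relabelling is treated as a gluing whose second index set is empty, so the results on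
  subspaces, dimensions and frames of direct sums apply unchanged.\<close>

sublocale G: gluing "Gap I'" "Gap I" "map_prod \<phi> \<phi>" "{} :: ('i \<times> 'i) set" "\<lambda>g. g"
proof
  show "inj_on (map_prod \<phi> \<phi>) (Gap I)"
  proof
    fix g h assume gh: "g \<in> Gap I" "h \<in> Gap I" "map_prod \<phi> \<phi> g = map_prod \<phi> \<phi> h"
    have "fst g \<in> Field I" "snd g \<in> Field I" "fst h \<in> Field I" "snd h \<in> Field I"
      using gh Gap_Field[of "fst g" "snd g" I] Gap_Field[of "fst h" "snd h" I] by auto
    then show "g = h" using gh(3) phi_inj by (cases g; cases h) auto
  qed
qed (use finite_Gap[OF I] Gap_image in auto)

abbreviation gl where
  "gl A \<equiv> glue (Gap I') (Gap I) (map_prod \<phi> \<phi>) ({} :: ('i \<times> 'i) set) (\<lambda>g. g) A {0}"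

lemma pre_Field: "pre X \<subseteq> Field I" by (auto simp: pre_def)

lemma convex_pre:
  "convex_in I' X \<Longrightarrow> convex_in I (pre X)"
  "down_closed I' X \<Longrightarrow> down_closed I (pre X)"
  "up_closed I' X \<Longrightarrow> up_closed I (pre X)"
proof -
  have F: "(x, y) \<in> I \<Longrightarrow> (\<phi> x, \<phi> y) \<in> I'" for x y using le_iff D(7,8) by blast
  show "convex_in I' X \<Longrightarrow> convex_in I (pre X)"
    using F D(7) unfolding convex_in_def pre_def by blast
  show "down_closed I' X \<Longrightarrow> down_closed I (pre X)"
    using F D(7) unfolding down_closed_def pre_def by blast
  show "up_closed I' X \<Longrightarrow> up_closed I (pre X)"
    using F D(8) unfolding up_closed_def pre_def by blast
qed

lemma image_pre: "X \<subseteq> Field I' \<Longrightarrow> \<phi> ` pre X = X"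
  using phi_surj by (auto simp: pre_def)

lemma pre_eq_Field: "X \<subseteq> Field I' \<Longrightarrow> pre X = Field I \<longleftrightarrow> X = Field I'"
  using phi_surj phi_in by (auto simp: pre_def)

lemma pre_insert: "x \<in> Field I \<Longrightarrow> pre (insert (\<phi> x) X) = insert x (pre X)"
  by (auto simp: pre_def phi_inj)

lemma brick_family_relabel:
  fixes F :: "'i set \<Rightarrow> ('i \<times> 'i \<Rightarrow> 'a::field) set"
  assumes F: "brick_family I F"
  shows "brick_family I' (\<lambda>X. gl (F (pre X)))"
proof -
  note F = F brick_familyD[OF F]
  have z: "fvs.subspace {0 :: 'i \<times> 'i \<Rightarrow> 'a}" "{0 :: 'i \<times> 'i \<Rightarrow> 'a} \<subseteq> coord_space {}"
    using framed_coord_space[of "{}"] by (auto simp: framed_def coord_space_empty)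
  have dz: "fvs.dim {0 :: 'i \<times> 'i \<Rightarrow> 'a} = 0"
    using framed_dim[OF framed_coord_space, of "{}"] by (simp add: coord_space_empty)
  have 1: "fvs.subspace (gl (F (pre X)))" if "convex_in I' X" for X
    by (rule G.subspace_glue[OF F(2) z(1)]) (rule convex_pre(1)[OF that])
  have 2: "fvs.dim (gl (F (pre X))) = card X" if X: "convex_in I' X" "X \<noteq> Field I'" for X
  proof -
    have XF: "X \<subseteq> Field I'" using X by (simp add: convex_in_def)
    have "card X = card (pre X)"
      using card_image[of \<phi> "pre X"] image_pre[OF XF] bij inj_on_subset[OF _ pre_Field]
      by (auto simp: bij_betw_def)
    then show ?thesis
      using G.dim_glue[OF F(2,3)[OF convex_pre(1)[OF X(1)]] z] dz F(4)[OF convex_pre(1)[OF X(1)]]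
        pre_eq_Field[OF XF] X(2) by simp
  qed
  have 3: "gl (F (pre X)) \<subseteq> gl (F (pre (insert x X)))" if X: "convex_in I' X" "convex_in I' (insert x X)" for X x
  proof -
    have "x \<in> Field I'" using X(2) by (simp add: convex_in_def)
    then obtain y where "y \<in> Field I" "x = \<phi> y" using phi_surj by blast
    then show ?thesis
      using F(5)[OF convex_pre(1)[OF X(1)], of y] convex_pre(1)[OF X(2)]
      by (intro glue_mono) (auto simp: pre_insert)
  qed
  have FI: "fst g \<in> Field I" "snd g \<in> Field I" if "g \<in> Gap I" for g
    using Gap_Field[of "fst g" "snd g" I] that by auto
  have 4: "gl (F (pre X)) = coord_space {g \<in> Gap I'. fst g \<in> X}" if X: "down_closed I' X" for X
  proof -
    have "{g \<in> Gap I'. fst g \<in> X} = map_prod \<phi> \<phi> ` {g \<in> Gap I. fst g \<in> pre X}"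
      using FI unfolding Gap_image pre_def by auto
    then show ?thesis unfolding F(6)[OF convex_pre(2)[OF X]] coord_space_empty[symmetric]
      by (subst G.glue_coord_space) auto
  qed
  have 5: "gl (F (pre X)) = coord_space {g \<in> Gap I'. snd g \<in> X}" if X: "up_closed I' X" for X
  proof -
    have "{g \<in> Gap I'. snd g \<in> X} = map_prod \<phi> \<phi> ` {g \<in> Gap I. snd g \<in> pre X}"
      using FI unfolding Gap_image pre_def by auto
    then show ?thesis unfolding F(7)[OF convex_pre(3)[OF X]] coord_space_empty[symmetric]
      by (subst G.glue_coord_space) auto
  qed
  show ?thesis unfolding brick_family_def using 1 2 3 4 5 glue_subset by blast
qed

lemma act_image:
  assumes "A \<subseteq> coord_space (Gap I)"
  shows "(\<lambda>v. \<Sum>g\<in>Gap I. fscale (v g) (basis_vec (map_prod \<phi> \<phi> g))) ` A = gl A"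
proof -
  have "(\<lambda>v. \<Sum>g\<in>Gap I. fscale (v g) (basis_vec (map_prod \<phi> \<phi> g))) ` A =
    (\<lambda>(v, w). (\<Sum>g\<in>Gap I. fscale (v g) (basis_vec (map_prod \<phi> \<phi> g))) +
      (\<Sum>g\<in>{}. fscale (w g) (basis_vec g))) ` (A \<times> {0 :: 'i \<times> 'i \<Rightarrow> 'a})"
    by force
  then show ?thesis using G.image_eq_glue[OF assms, of "{0}"] by (simp add: coord_space_empty)
qed

lemma brick_ext_act:
  fixes V :: "('i, 'a::field) subspaces"
  assumes V: "V \<in> bricks I" and X: "convex_in I' X"
  shows "brick_ext I' (brick_act I I' \<phi> V) X = gl (brick_ext I V (pre X))"
proof -
  note f = brick_familyD[OF bricks_imp_brick_family[OF I V]]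
  have XF: "X \<subseteq> Field I'" using X by (simp add: convex_in_def)
  have c: "convex_in I (pre X)" by (rule convex_pre(1)[OF X])
  consider "X = {}" | "X = Field I'" | "X \<noteq> {}" "X \<noteq> Field I'" by blast
  then show ?thesis
  proof cases
    case 1
    then have "gl (brick_ext I V (pre X)) = coord_space {}"
      using G.glue_coord_space[of "{}" "{}"] by (simp add: brick_ext_empty coord_space_empty pre_def)
    then show ?thesis using 1 by (simp add: brick_ext_empty coord_space_empty)
  next
    case 2
    have p: "pre X = Field I" using 2 pre_eq_Field by blast
    have "gl (coord_space (Gap I)) = (coord_space (Gap I') :: ('i \<times> 'i \<Rightarrow> 'a) set)"
      unfolding coord_space_empty[symmetric] by (subst G.glue_coord_space) (use Gap_image in auto)
    then show ?thesis unfolding p brick_ext_Field[OF I] unfolding 2 brick_ext_Field[OF I'] by simp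
  next
    case 3
    have ne: "pre X \<noteq> Field I" "pre X \<noteq> {}" using pre_eq_Field[OF XF] image_pre[OF XF] 3 by auto
    note l = lo_hi[OF I pre_Field ne(2)]
    have F: "lo I (pre X) \<in> Field I" "hi I (pre X) \<in> Field I" using l pre_Field by blast+
    have X': "x \<in> X \<Longrightarrow> \<exists>y\<in>pre X. x = \<phi> y" for x using image_pre[OF XF] by blast
    have lo: "lo I' X = \<phi> (lo I (pre X))"
    proof (rule lo_eqI[OF I' XF])
      show "\<phi> (lo I (pre X)) \<in> X" using l(1) by (simp add: pre_def)
      fix x assume "x \<in> X"
      then obtain y where "y \<in> pre X" "x = \<phi> y" using X' by blast
      then show "(\<phi> (lo I (pre X)), x) \<in> I'" using l(3)[of y] F le_iff pre_Field by blast
    qed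
    have hi: "hi I' X = \<phi> (hi I (pre X))"
    proof (rule hi_eqI[OF I' XF])
      show "\<phi> (hi I (pre X)) \<in> X" using l(2) by (simp add: pre_def)
      fix x assume "x \<in> X"
      then obtain y where "y \<in> pre X" "x = \<phi> y" using X' by blast
      then show "(x, \<phi> (hi I (pre X))) \<in> I'" using l(4)[of y] F le_iff pre_Field by blast
    qed
    have inj: "inj_on \<phi> (Field I)" using bij by (simp add: bij_betw_def)
    have "brick_ext I' (brick_act I I' \<phi> V) X = brick_act I I' \<phi> V (lo I' X, hi I' X)"
      using 3 by (simp add: brick_ext_def)
    also have "\<dots> = (\<lambda>v. \<Sum>g\<in>Gap I. fscale (v g) (basis_vec (map_prod \<phi> \<phi> g))) ` brick_ext I V (pre X)"
      using proper_intervals_lo_hi[OF I' X 3] ne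
      by (simp add: brick_act_def lo hi inv_into_f_f[OF inj] F brick_ext_def)
    also have "\<dots> = gl (brick_ext I V (pre X))" by (rule act_image[OF f(2)[OF c]])
    finally show ?thesis .
  qed
qed

lemma brick_act_bricks:
  assumes "V \<in> bricks I"
  shows "brick_act I I' \<phi> V \<in> bricks I'"
proof (rule brick_family_imp_bricks[OF I'])
  show "brick_act I I' \<phi> V \<in> extensional (proper_intervals I')"
    by (simp add: brick_act_def)
  show "brick_family I' (brick_ext I' (brick_act I I' \<phi> V))"
    by (rule brick_family_cong[OF brick_ext_act[OF assms]
        brick_family_relabel[OF bricks_imp_brick_family[OF I assms]]])
qed

end

section \<open>The operad axioms\<close>

lemma cut_cong: "(\<And>s. s \<in> S \<Longrightarrow> f s = g s) \<Longrightarrow> cut S f = cut S g"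
  by (auto simp: cut_def)

lemma cut_cut: "(\<And>s. s \<in> S \<Longrightarrow> h s \<in> S') \<Longrightarrow> cut S (\<lambda>s. cut S' f (h s)) = cut S (\<lambda>s. f (h s))"
  by (auto simp: cut_def)

lemma cut_cut_subset: "(\<And>s. s \<in> S \<Longrightarrow> s \<in> S') \<Longrightarrow> cut S (cut S' f) = cut S f"
  by (auto simp: cut_def)

lemma cut_in: "cut S f \<in> coord_space S"
  by (auto simp: cut_def coord_space_def)

lemma cut_coord_space: "f \<in> coord_space S \<Longrightarrow> cut S f = f"
  by (auto simp: cut_def coord_space_def fun_eq_iff)

lemma cut_empty: "cut {} f = 0"
  by (auto simp: cut_def)

context insertion begin

lemma mem_gl:
  "u \<in> gl A B \<longleftrightarrow> u \<in> coord_space (Gap K) \<and> cut (Gap I) (\<lambda>g. u (gap_map i J g)) \<in> A \<and> cut (Gap J) u \<in> B"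
  by (simp add: glue_def)

lemma brick_ext_comp_mem:
  assumes "V \<in> bricks I" "W \<in> bricks J" "convex_in K X"
  shows "u \<in> brick_ext K (brick_comp I i J V W) X \<longleftrightarrow> u \<in> coord_space (Gap K) \<and>
    cut (Gap I) (\<lambda>g. u (gap_map i J g)) \<in> brick_ext I V (collapse X) \<and> cut (Gap J) u \<in> brick_ext J W (X \<inter> Field J)"
  by (simp add: brick_ext_comp[OF assms] mem_gl)

end

context relabelling begin

lemma brick_ext_act_mem:
  assumes "V \<in> bricks I" "convex_in I' X"
  shows "u \<in> brick_ext I' (brick_act I I' \<phi> V) X \<longleftrightarrow> u \<in> coord_space (Gap I') \<and>
    cut (Gap I) (\<lambda>g. u (map_prod \<phi> \<phi> g)) \<in> brick_ext I V (pre X)"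
  by (simp add: brick_ext_act[OF assms] glue_def cut_empty)

lemma map_prod_Gap: "g \<in> Gap I \<Longrightarrow> map_prod \<phi> \<phi> g \<in> Gap I'"
  using Gap_image by blast

end

lemma bricks_eqI':
  fixes V W :: "('i, 'a::field) subspaces"
  assumes I: "finite_ordinal I" and V: "V \<in> bricks I" "W \<in> bricks I"
    and eq: "\<And>X u. convex_in I X \<Longrightarrow> X \<noteq> {} \<Longrightarrow> X \<noteq> Field I \<Longrightarrow> u \<in> brick_ext I V X \<longleftrightarrow> u \<in> brick_ext I W X"
  shows "V = W"
  by (rule bricks_eqI[OF I bricks_extensional[OF V(1)] bricks_extensional[OF V(2)]]) (use eq in blast)

lemma Gap_in_Field: "g \<in> Gap I \<Longrightarrow> fst g \<in> Field I" "g \<in> Gap I \<Longrightarrow> snd g \<in> Field I"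
  using Gap_Field[of "fst g" "snd g" I] by auto

section \<open>Functoriality and naturality in order-preserving bijections\<close>

lemma brick_act_cong:
  fixes x :: "('i, 'a::field) subspaces"
  assumes I: "finite_ordinal I" "finite_ordinal I'" "ord_iso I I' \<phi>"
    and eq: "\<forall>j\<in>Field I. \<psi> j = \<phi> j" and x: "x \<in> bricks I"
  shows "brick_act I I' \<psi> x = brick_act I I' \<phi> x"
proof -
  have "ord_iso I I' \<psi>"
    using I(3) eq bij_betw_cong[of "Field I" \<psi> \<phi>] by (simp add: ord_iso_def)
  then interpret P: relabelling I I' \<psi> using I by unfold_locales
  interpret F: relabelling I I' \<phi> using I by unfold_locales
  have pre: "P.pre X = F.pre X" for X using eq by (auto simp: P.pre_def F.pre_def)
  have cut: "cut (Gap I) (\<lambda>g. u (map_prod \<psi> \<psi> g)) = cut (Gap I) (\<lambda>g. u (map_prod \<phi> \<phi> g))" for u :: "_ \<Rightarrow> 'a"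
  proof (rule cut_cong)
    fix g assume "g \<in> Gap I"
    then show "u (map_prod \<psi> \<psi> g) = u (map_prod \<phi> \<phi> g)"
      using eq Gap_in_Field[of g I] by (cases g) simp
  qed
  show ?thesis
    by (rule bricks_eqI'[OF I(2) P.brick_act_bricks[OF x] F.brick_act_bricks[OF x]])
      (simp add: P.brick_ext_act_mem[OF x] F.brick_ext_act_mem[OF x] pre cut)
qed

lemma brick_act_id:
  fixes x :: "('i, 'a::field) subspaces"
  assumes I: "finite_ordinal I" and x: "x \<in> bricks I"
  shows "brick_act I I (\<lambda>j. j) x = x"
proof -
  have "ord_iso I I (\<lambda>j. j)" using bij_betw_id[of "Field I"] by (simp add: ord_iso_def id_def)
  then interpret F: relabelling I I "\<lambda>j. j" using I by unfold_locales
  note f = brick_familyD[OF bricks_imp_brick_family[OF I x]]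
  show ?thesis
  proof (rule bricks_eqI'[OF I F.brick_act_bricks[OF x] x])
    fix X and u :: "'i \<times> 'i \<Rightarrow> 'a" assume X: "convex_in I X"
    then have p: "F.pre X = X" by (auto simp: F.pre_def convex_in_def)
    show "u \<in> brick_ext I (brick_act I I (\<lambda>j. j) x) X \<longleftrightarrow> u \<in> brick_ext I x X"
      using f(2)[OF X] cut_coord_space[of u "Gap I"]
      by (auto simp: F.brick_ext_act_mem[OF x X] p map_prod_def split_beta)
  qed
qed

lemma brick_act_comp:
  fixes x :: "('i, 'a::field) subspaces"
  assumes I: "finite_ordinal I" "finite_ordinal I'" "finite_ordinal I''"
    and iso: "ord_iso I I' \<phi>" "ord_iso I' I'' \<psi>" and x: "x \<in> bricks I"
  shows "brick_act I I'' (\<lambda>j. \<psi> (\<phi> j)) x = brick_act I' I'' \<psi> (brick_act I I' \<phi> x)"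
proof -
  interpret F: relabelling I I' \<phi> using I iso by unfold_locales
  interpret P: relabelling I' I'' \<psi> using I iso by unfold_locales
  have "bij_betw (\<lambda>j. \<psi> (\<phi> j)) (Field I) (Field I'')"
    using bij_betw_trans[OF F.bij P.bij] by (simp add: o_def)
  then have "ord_iso I I'' (\<lambda>j. \<psi> (\<phi> j))"
    unfolding ord_iso_def using F.le_iff P.le_iff F.phi_in by auto
  then interpret Q: relabelling I I'' "\<lambda>j. \<psi> (\<phi> j)" using I by unfold_locales
  note y = F.brick_act_bricks[OF x]
  show ?thesis
  proof (rule bricks_eqI'[OF I(3) Q.brick_act_bricks[OF x] P.brick_act_bricks[OF y]])
    fix X and u :: "'i \<times> 'i \<Rightarrow> 'a" assume X: "convex_in I'' X"
    have p: "Q.pre X = F.pre (P.pre X)" using F.phi_in by (auto simp: Q.pre_def F.pre_def P.pre_def)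
    have "cut (Gap I) (\<lambda>g. cut (Gap I') (\<lambda>g. u (map_prod \<psi> \<psi> g)) (map_prod \<phi> \<phi> g)) =
        cut (Gap I) (\<lambda>g. u (map_prod (\<lambda>j. \<psi> (\<phi> j)) (\<lambda>j. \<psi> (\<phi> j)) g))"
      by (subst cut_cut[OF F.map_prod_Gap]) (auto simp: map_prod_def split_beta)
    then show "u \<in> brick_ext I'' (brick_act I I'' (\<lambda>j. \<psi> (\<phi> j)) x) X \<longleftrightarrow>
        u \<in> brick_ext I'' (brick_act I' I'' \<psi> (brick_act I I' \<phi> x)) X"
      by (simp add: Q.brick_ext_act_mem[OF x X] P.brick_ext_act_mem[OF y X]
          F.brick_ext_act_mem[OF x P.convex_pre(1)[OF X]] p cut_in)
  qed
qed

text \<open>Two commutations suffice: taking traces commutes with preimages of subsets, and the gap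
  maps commute with relabelling of gaps. The latter uses that the bijection of \<open>J\<close>
  preserves its extreme elements.\<close>

lemma brick_comp_natural:
  fixes x y :: "('i, 'a::field) subspaces"
  assumes IJ: "insertion I i J" and IJ': "insertion I' (\<phi> i) J'"
    and iso: "ord_iso I I' \<phi>" "ord_iso J J' \<psi>" and x: "x \<in> bricks I" and y: "y \<in> bricks J"
  shows "brick_act (ord_insert I i J) (ord_insert I' (\<phi> i) J') (\<lambda>j. if j \<in> Field J then \<psi> j else \<phi> j)
      (brick_comp I i J x y) = brick_comp I' (\<phi> i) J' (brick_act I I' \<phi> x) (brick_act J J' \<psi> y)"
proof -
  interpret A: insertion I i J by (rule IJ)
  interpret B: insertion I' "\<phi> i" J' by (rule IJ')
  interpret F: relabelling I I' \<phi> using A.I B.I iso by unfold_locales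
  interpret P: relabelling J J' \<psi> using A.J B.J iso by unfold_locales
  let ?\<chi> = "\<lambda>j. if j \<in> Field J then \<psi> j else \<phi> j"
  have chi_I: "?\<chi> j = \<phi> j" "\<phi> j \<in> Field I'" "\<phi> j \<noteq> \<phi> i" "\<phi> j \<notin> Field J'"
    if "j \<in> Field I" "j \<noteq> i" for j
    using that A.not_both B.not_both F.phi_in F.phi_inj A.i by auto
  have chi_J: "?\<chi> j = \<psi> j" "\<psi> j \<in> Field J'" "\<psi> j \<notin> Field I'" "\<psi> j \<noteq> \<phi> i" if "j \<in> Field J" for j
    using P.phi_in[OF that] B.not_both[OF P.phi_in[OF that]] B.i_J that by auto
  have "ord_iso A.K B.K ?\<chi>"
    unfolding ord_iso_def A.Field_K B.Field_K
  proof (intro conjI ballI)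
    show "bij_betw ?\<chi> (Field I - {i} \<union> Field J) (Field I' - {\<phi> i} \<union> Field J')"
    proof (rule bij_betw_combine)
      have "bij_betw \<phi> (Field I - {i}) (Field I' - {\<phi> i})"
        using bij_betw_DiffI[OF F.bij, of "{i}" "{\<phi> i}"] A.i B.i by (simp add: bij_betw_def)
      then show "bij_betw ?\<chi> (Field I - {i}) (Field I' - {\<phi> i})"
        using bij_betw_cong[of "Field I - {i}" ?\<chi> \<phi>] chi_I(1) by auto
      show "bij_betw ?\<chi> (Field J) (Field J')"
        using bij_betw_cong[of "Field J" ?\<chi> \<psi>] P.bij by auto
      show "(Field I' - {\<phi> i}) \<inter> Field J' = {}" using B.disjoint by blast
    qed
    fix a b assume "a \<in> Field I - {i} \<union> Field J" "b \<in> Field I - {i} \<union> Field J"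
    then show "(a, b) \<in> A.K \<longleftrightarrow> (?\<chi> a, ?\<chi> b) \<in> B.K"
      using A.i by (elim A.K_cases)
        (simp_all add: chi_I chi_J A.K_simps B.K_simps F.le_iff P.le_iff)
  qed
  then interpret Q: relabelling A.K B.K ?\<chi>
    using A.finite_ordinal_K B.finite_ordinal_K by unfold_locales
  have mx: "ord_max J' = \<psi> (ord_max J)"
  proof (rule ord_max_eqI[OF B.J])
    fix z assume "z \<in> Field J'"
    then obtain w where "w \<in> Field J" "z = \<psi> w" using P.phi_surj by blast
    then show "(z, \<psi> (ord_max J)) \<in> J'" using A.max_J P.le_iff by simp
  qed (use P.phi_in A.max_J in simp)
  have mn: "ord_min J' = \<psi> (ord_min J)"
  proof (rule ord_min_eqI[OF B.J])
    fix z assume "z \<in> Field J'"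
    then obtain w where "w \<in> Field J" "z = \<psi> w" using P.phi_surj by blast
    then show "(\<psi> (ord_min J), z) \<in> J'" using A.min_J P.le_iff by simp
  qed (use P.phi_in A.min_J in simp)
  note xy = A.brick_comp_bricks[OF x y] and x' = F.brick_act_bricks[OF x] and y' = P.brick_act_bricks[OF y]
  show ?thesis
  proof (rule bricks_eqI'[OF B.finite_ordinal_K Q.brick_act_bricks[OF xy] B.brick_comp_bricks[OF x' y']])
    fix X and u :: "'i \<times> 'i \<Rightarrow> 'a" assume X: "convex_in B.K X"
    have p1: "A.collapse (Q.pre X) = F.pre (B.collapse X)"
    proof -
      have "Field J \<subseteq> Q.pre X \<longleftrightarrow> Field J' \<subseteq> X"
      proof
        assume *: "Field J \<subseteq> Q.pre X"
        show "Field J' \<subseteq> X"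
        proof
          fix z assume "z \<in> Field J'"
          then obtain w where w: "w \<in> Field J" "z = \<psi> w" using P.phi_surj by blast
          then show "z \<in> X" using * chi_J(1)[OF w(1)] by (auto simp: Q.pre_def)
        qed
      next
        assume "Field J' \<subseteq> X"
        then show "Field J \<subseteq> Q.pre X" using chi_J A.Field_K by (auto simp: Q.pre_def)
      qed
      moreover have "z \<in> Q.pre X \<longleftrightarrow> \<phi> z \<in> X" if "z \<in> Field I" "z \<noteq> i" for z
        using chi_I(1)[OF that] that A.Field_K by (simp add: Q.pre_def)
      moreover have "\<phi> z = \<phi> i \<longleftrightarrow> z = i" if "z \<in> Field I" for z using F.phi_inj[OF that A.i] .
      ultimately show ?thesis using F.phi_in by (auto simp: A.collapse_def B.collapse_def F.pre_def)
    qed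
    have p2: "Q.pre X \<inter> Field J = P.pre (X \<inter> Field J')"
      using chi_J A.Field_K by (auto simp: Q.pre_def P.pre_def)
    have c1: "cut (Gap I) (\<lambda>g. cut (Gap A.K) (\<lambda>g. u (map_prod ?\<chi> ?\<chi> g)) (gap_map i J g)) =
        cut (Gap I) (\<lambda>g. cut (Gap I') (\<lambda>g. u (gap_map (\<phi> i) J' g)) (map_prod \<phi> \<phi> g))"
    proof -
      have key: "map_prod ?\<chi> ?\<chi> (gap_map i J g) = gap_map (\<phi> i) J' (map_prod \<phi> \<phi> g)" if g: "g \<in> Gap I" for g
      proof -
        \<comment> \<open>By injectivity of \<open>\<phi>\<close>, the end of a relabelled gap is
          \<open>\<phi> i\<close> only if the original end was \<open>i\<close>; so both sides
          replace the same end.\<close>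
        have eq: "?\<chi> (if z = i then m else z) = (if \<phi> z = \<phi> i then \<psi> m else \<phi> z)"
          if "z \<in> Field I" "m \<in> Field J" for z m
          using that chi_I[of z] by auto
        obtain v w where vw: "g = (v, w)" by (cases g)
        then have "v \<in> Field I" "w \<in> Field I" using Gap_in_Field[OF g] by auto
        then show ?thesis
          unfolding vw gap_map_def prod.case map_prod_simp mx mn
          using eq[OF _ A.max_J(1), of v] eq[OF _ A.min_J(1), of w] by (simp only: prod.inject)
      qed
      show ?thesis
        by (subst cut_cut[OF A.gap_map_Gap], assumption, subst cut_cut[OF F.map_prod_Gap], assumption)
          (rule cut_cong, simp only: key)
    qed
    have c2: "cut (Gap J) (cut (Gap A.K) (\<lambda>g. u (map_prod ?\<chi> ?\<chi> g))) =
        cut (Gap J) (\<lambda>g. cut (Gap J') u (map_prod \<psi> \<psi> g))"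
    proof -
      have key: "map_prod ?\<chi> ?\<chi> g = map_prod \<psi> \<psi> g" if g: "g \<in> Gap J" for g
        using Gap_in_Field[OF g] by (cases g) simp
      show ?thesis
        by (subst cut_cut_subset[OF A.Gap_J_K], assumption, subst cut_cut[OF P.map_prod_Gap], assumption)
          (rule cut_cong, simp only: key)
    qed
    note cX = B.convex_collapse[OF X] and cQ = Q.convex_pre(1)[OF X]
    show "u \<in> brick_ext B.K (brick_act A.K B.K ?\<chi> (brick_comp I i J x y)) X \<longleftrightarrow>
        u \<in> brick_ext B.K (brick_comp I' (\<phi> i) J' (brick_act I I' \<phi> x) (brick_act J J' \<psi> y)) X"
      unfolding Q.brick_ext_act_mem[OF xy X] B.brick_ext_comp_mem[OF x' y' X]
        A.brick_ext_comp_mem[OF x y cQ] F.brick_ext_act_mem[OF x cX(1)] P.brick_ext_act_mem[OF y cX(2)]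
      by (simp only: p1 p2 c1 c2 cut_in simp_thms)
  qed
qed

section \<open>The parallel and sequential axioms\<close>

lemma insertionI:
  "finite_ordinal I \<Longrightarrow> finite_ordinal J \<Longrightarrow> Field I \<inter> Field J = {} \<Longrightarrow> i \<in> Field I \<Longrightarrow> insertion I i J"
  by unfold_locales

text \<open>The two insertions happen at different points, so neither changes what the other one
  uses: the traces commute and so do the gap maps.\<close>

lemma brick_comp_parallel:
  fixes x y z :: "('i, 'a::field) subspaces"
  assumes fin: "finite_ordinal I" "finite_ordinal J" "finite_ordinal K"
    and disj: "Field I \<inter> Field J = {}" "Field I \<inter> Field K = {}" "Field J \<inter> Field K = {}"
    and i: "i \<in> Field I" "i' \<in> Field I" "i \<noteq> i'"
    and x: "x \<in> bricks I" and y: "y \<in> bricks J" and z: "z \<in> bricks K"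
  shows "brick_comp (ord_insert I i J) i' K (brick_comp I i J x y) z
      = brick_comp (ord_insert I i' K) i J (brick_comp I i' K x z) y"
proof -
  interpret A: insertion I i J by (rule insertionI) fact+
  interpret B: insertion I i' K by (rule insertionI) fact+
  interpret C: insertion A.K i' K
    by (rule insertionI) (use A.finite_ordinal_K A.Field_K fin disj i in auto)
  interpret D: insertion B.K i J
    by (rule insertionI) (use B.finite_ordinal_K B.Field_K fin disj i in auto)
  \<comment> \<open>The two orders are equal as relations, not merely isomorphic: in both, every
    comparison between elements of different origin is decided by the points they replace.\<close>
  have KK: "C.K = D.K"
  proof -
    have "(a, b) \<in> C.K \<longleftrightarrow> (a, b) \<in> D.K"
      if a: "a \<in> Field C.K" and b: "b \<in> Field C.K" for a b
    proof -
      have *: "(a \<in> Field I \<and> a \<noteq> i \<and> a \<noteq> i' \<and> a \<notin> Field J \<and> a \<notin> Field K) \<or>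
        (a \<in> Field J \<and> a \<notin> Field I \<and> a \<notin> Field K \<and> a \<noteq> i \<and> a \<noteq> i') \<or>
        (a \<in> Field K \<and> a \<notin> Field I \<and> a \<notin> Field J \<and> a \<noteq> i \<and> a \<noteq> i')"
        if "a \<in> Field C.K" for a
        using that disj i unfolding C.Field_K A.Field_K by blast
      have FK: "a \<in> Field A.K \<longleftrightarrow> a \<in> Field I \<and> a \<noteq> i \<or> a \<in> Field J"
        "a \<in> Field B.K \<longleftrightarrow> a \<in> Field I \<and> a \<noteq> i' \<or> a \<in> Field K" for a
        unfolding A.Field_K B.Field_K by auto
      show ?thesis
        using *[OF a] *[OF b] i not_sym[OF i(3)]
        by (elim disjE conjE) (simp_all add: C.K_simps D.K_simps A.K_simps B.K_simps FK)
    qed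
    moreover have "Field C.K = Field D.K"
      unfolding C.Field_K D.Field_K A.Field_K B.Field_K using disj i by blast
    ultimately show ?thesis by (auto dest: FieldI1 FieldI2 intro: set_eqI)
  qed
  note xy = A.brick_comp_bricks[OF x y] and xz = B.brick_comp_bricks[OF x z]
  note l = C.brick_comp_bricks[OF xy z] and r = D.brick_comp_bricks[OF xz y]
  show ?thesis
  proof (rule bricks_eqI'[OF C.finite_ordinal_K l])
    show "brick_comp B.K i J (brick_comp I i' K x z) y \<in> bricks C.K" using r KK by simp
    fix X and u :: "'i \<times> 'i \<Rightarrow> 'a" assume X: "convex_in C.K X"
    then have X': "convex_in D.K X" using KK by simp
    have XF: "X \<subseteq> Field C.K" using X by (simp add: convex_in_def)
    have XF': "X \<subseteq> Field I \<union> Field J \<union> Field K" "i \<notin> X" "i' \<notin> X"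
      using XF disj i unfolding C.Field_K A.Field_K by blast+
    have i_JK: "i \<notin> Field J" "i \<notin> Field K" "i' \<notin> Field J" "i' \<notin> Field K" using disj i by blast+
    \<comment> \<open>Passing to the trace at \<open>i'\<close> neither adds nor removes elements of
      \<open>J\<close>, so the test for \<open>i\<close> gives the same result before and
      after.\<close>
    have JC: "Field J \<subseteq> C.collapse X \<longleftrightarrow> Field J \<subseteq> X"
      using i_JK A.Field_K by (auto simp: C.collapse_def)
    have KD: "Field K \<subseteq> D.collapse X \<longleftrightarrow> Field K \<subseteq> X"
      using i_JK B.Field_K by (auto simp: D.collapse_def)
    have s1: "A.collapse (C.collapse X) = B.collapse (D.collapse X)"
    proof -
      have "v \<in> A.collapse (C.collapse X) \<longleftrightarrow> v \<in> B.collapse (D.collapse X)" for v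
      proof (cases "v \<in> Field I")
        case False then show ?thesis using A.collapse_Field B.collapse_Field by blast
      next
        case True
        then show ?thesis
          using i JC KD A.Field_K B.Field_K
          by (cases "v = i"; cases "v = i'")
            (auto simp: A.collapse_simps B.collapse_simps C.collapse_simps D.collapse_simps)
      qed
      then show ?thesis by blast
    qed
    have s2: "C.collapse X \<inter> Field J = X \<inter> Field J" using i_JK A.Field_K by (auto simp: C.collapse_def)
    have s3: "D.collapse X \<inter> Field K = X \<inter> Field K" using i_JK B.Field_K by (auto simp: D.collapse_def)
    \<comment> \<open>The elements inserted as new ends of gaps lie in \<open>J\<close> or
      \<open>K\<close>, so they are neither \<open>i\<close> nor \<open>i'\<close> and are not moved
      by the other gap map.\<close>
    have gm: "gap_map i' K (gap_map i J g) = gap_map i J (gap_map i' K g)" for g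
      using A.max_min_J B.max_min_J i by (cases g) (auto simp: gap_map_def)
    have gJ: "gap_map i' K g = g" if "g \<in> Gap J" for g
      using Gap_in_Field[OF that] i_JK by (cases g) (auto simp: gap_map_def)
    have gK: "gap_map i J g = g" if "g \<in> Gap K" for g
      using Gap_in_Field[OF that] i_JK by (cases g) (auto simp: gap_map_def)
    have c1: "cut (Gap I) (\<lambda>g. cut (Gap A.K) (\<lambda>g. u (gap_map i' K g)) (gap_map i J g)) =
        cut (Gap I) (\<lambda>g. cut (Gap B.K) (\<lambda>g. u (gap_map i J g)) (gap_map i' K g))"
      by (subst cut_cut[OF A.gap_map_Gap], assumption, subst cut_cut[OF B.gap_map_Gap], assumption)
        (simp add: gm)
    have c2: "cut (Gap J) (cut (Gap A.K) (\<lambda>g. u (gap_map i' K g))) = cut (Gap J) u"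
      by (subst cut_cut_subset[OF A.Gap_J_K], assumption) (rule cut_cong, simp add: gJ)
    have c3: "cut (Gap K) (cut (Gap B.K) (\<lambda>g. u (gap_map i J g))) = cut (Gap K) u"
      by (subst cut_cut_subset[OF B.Gap_J_K], assumption) (rule cut_cong, simp add: gK)
    have "u \<in> brick_ext D.K (brick_comp B.K i J (brick_comp I i' K x z) y) X \<longleftrightarrow>
        u \<in> brick_ext C.K (brick_comp A.K i' K (brick_comp I i J x y) z) X"
      unfolding C.brick_ext_comp_mem[OF xy z X] D.brick_ext_comp_mem[OF xz y X']
        A.brick_ext_comp_mem[OF x y C.convex_collapse(1)[OF X]]
        B.brick_ext_comp_mem[OF x z D.convex_collapse(1)[OF X']]
      unfolding c1 c2 c3 s1 s2 s3 KK using cut_in by blast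
    then show "u \<in> brick_ext C.K (brick_comp A.K i' K (brick_comp I i J x y) z) X \<longleftrightarrow>
        u \<in> brick_ext C.K (brick_comp B.K i J (brick_comp I i' K x z) y) X"
      unfolding KK by blast
  qed
qed

text \<open>The two substitutions interact only if \<open>j\<close> is an extreme element of
  \<open>J\<close>: a gap at \<open>i\<close> is first attached to \<open>j\<close> and then to an
  end of \<open>K\<close>. Inserting the composed ordinal attaches it to that end of
  \<open>K\<close> at once.\<close>

lemma brick_comp_sequential:
  fixes x y z :: "('i, 'a::field) subspaces"
  assumes fin: "finite_ordinal I" "finite_ordinal J" "finite_ordinal K"
    and disj: "Field I \<inter> Field J = {}" "Field I \<inter> Field K = {}" "Field J \<inter> Field K = {}"
    and i: "i \<in> Field I" and j: "j \<in> Field J"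
    and x: "x \<in> bricks I" and y: "y \<in> bricks J" and z: "z \<in> bricks K"
  shows "brick_comp (ord_insert I i J) j K (brick_comp I i J x y) z
      = brick_comp I i (ord_insert J j K) x (brick_comp J j K y z)"
proof -
  interpret A: insertion I i J by (rule insertionI) fact+
  interpret B: insertion J j K by (rule insertionI) fact+
  interpret C: insertion A.K j K
    by (rule insertionI) (use A.finite_ordinal_K A.Field_K fin disj j in auto)
  interpret D: insertion I i B.K
    by (rule insertionI) (use B.finite_ordinal_K B.Field_K fin disj i in auto)
  have ij: "i \<notin> Field J" "i \<notin> Field K" "j \<notin> Field I" "j \<notin> Field K" "i \<noteq> j" using disj i j by blast+
  have FK: "a \<in> Field A.K \<longleftrightarrow> a \<in> Field I \<and> a \<noteq> i \<or> a \<in> Field J"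
    "a \<in> Field B.K \<longleftrightarrow> a \<in> Field J \<and> a \<noteq> j \<or> a \<in> Field K" for a
    unfolding A.Field_K B.Field_K by auto
  have KK: "C.K = D.K"
  proof -
    have "(a, b) \<in> C.K \<longleftrightarrow> (a, b) \<in> D.K"
      if a: "a \<in> Field C.K" and b: "b \<in> Field C.K" for a b
    proof -
      have *: "(a \<in> Field I \<and> a \<noteq> i \<and> a \<noteq> j \<and> a \<notin> Field J \<and> a \<notin> Field K) \<or>
        (a \<in> Field J \<and> a \<notin> Field I \<and> a \<notin> Field K \<and> a \<noteq> i \<and> a \<noteq> j) \<or>
        (a \<in> Field K \<and> a \<notin> Field I \<and> a \<notin> Field J \<and> a \<noteq> i \<and> a \<noteq> j)"
        if "a \<in> Field C.K" for a
        using that disj i j unfolding C.Field_K A.Field_K by blast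
      show ?thesis
        using *[OF a] *[OF b] i j ij
        by (elim disjE conjE) (simp_all add: C.K_simps D.K_simps A.K_simps B.K_simps FK)
    qed
    moreover have "Field C.K = Field D.K"
      unfolding C.Field_K D.Field_K A.Field_K B.Field_K using disj i j by blast
    ultimately show ?thesis by (auto dest: FieldI1 FieldI2 intro: set_eqI)
  qed
  note xy = A.brick_comp_bricks[OF x y] and yz = B.brick_comp_bricks[OF y z]
  note l = C.brick_comp_bricks[OF xy z] and r = D.brick_comp_bricks[OF x yz]
  show ?thesis
  proof (rule bricks_eqI'[OF C.finite_ordinal_K l])
    show "brick_comp I i B.K x (brick_comp J j K y z) \<in> bricks C.K" using r KK by simp
    fix X and u :: "'i \<times> 'i \<Rightarrow> 'a" assume X: "convex_in C.K X"
    then have X': "convex_in D.K X" using KK by simp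
    \<comment> \<open>This gives the membership of \<open>i\<close> in the iterated trace:
      \<open>J\<close> is completed after collapsing \<open>K\<close> to \<open>j\<close> exactly if
      \<open>X\<close> contains both \<open>K\<close> and the rest of \<open>J\<close>.\<close>
    have BX: "Field B.K \<subseteq> X \<longleftrightarrow> Field J \<subseteq> C.collapse X"
      using j FK by (auto simp: C.collapse_def subset_eq split: if_splits)
    have s1: "A.collapse (C.collapse X) = D.collapse X"
    proof -
      have "v \<in> A.collapse (C.collapse X) \<longleftrightarrow> v \<in> D.collapse X" for v
      proof (cases "v \<in> Field I")
        case False then show ?thesis using A.collapse_Field D.collapse_Field by blast
      next
        case True
        then have "v \<noteq> j" using ij by blast
        then show ?thesis using BX FK True
          by (cases "v = i") (auto simp: A.collapse_simps C.collapse_simps D.collapse_simps)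
      qed
      then show ?thesis by blast
    qed
    have s2: "C.collapse X \<inter> Field J = B.collapse (X \<inter> Field B.K)"
      using FK j by (auto simp: C.collapse_def B.collapse_def)
    have s3: "X \<inter> Field B.K \<inter> Field K = X \<inter> Field K" using FK by auto
    have mx: "ord_max B.K = (if ord_max J = j then ord_max K else ord_max J)"
    proof (rule ord_max_eqI[OF B.finite_ordinal_K])
      show "(if ord_max J = j then ord_max K else ord_max J) \<in> Field B.K"
        using FK A.max_J B.max_J by auto
      fix v assume "v \<in> Field B.K"
      then have "v \<in> Field J - {j} \<union> Field K" using B.Field_K by simp
      then show "(v, if ord_max J = j then ord_max K else ord_max J) \<in> B.K"
        using A.max_J B.max_J j by (cases rule: B.K_cases) (auto simp: B.K_simps)
    qed
    have mn: "ord_min B.K = (if ord_min J = j then ord_min K else ord_min J)"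
    proof (rule ord_min_eqI[OF B.finite_ordinal_K])
      show "(if ord_min J = j then ord_min K else ord_min J) \<in> Field B.K"
        using FK A.min_J B.min_J by auto
      fix v assume "v \<in> Field B.K"
      then have "v \<in> Field J - {j} \<union> Field K" using B.Field_K by simp
      then show "(if ord_min J = j then ord_min K else ord_min J, v) \<in> B.K"
        using A.min_J B.min_J j by (cases rule: B.K_cases) (auto simp: B.K_simps)
    qed
    have gm: "gap_map j K (gap_map i J g) = gap_map i B.K g" if "g \<in> Gap I" for g
      using Gap_in_Field[OF that] ij by (cases g) (auto simp: gap_map_def mx mn)
    have c1: "cut (Gap I) (\<lambda>g. cut (Gap A.K) (\<lambda>g. u (gap_map j K g)) (gap_map i J g)) =
        cut (Gap I) (\<lambda>g. u (gap_map i B.K g))"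
      by (subst cut_cut[OF A.gap_map_Gap], assumption) (rule cut_cong, simp add: gm)
    have c2: "cut (Gap J) (cut (Gap A.K) (\<lambda>g. u (gap_map j K g))) =
        cut (Gap J) (\<lambda>g. cut (Gap B.K) u (gap_map j K g))"
      by (subst cut_cut_subset[OF A.Gap_J_K], assumption,
          subst cut_cut[OF B.gap_map_Gap], assumption) (rule refl)
    have c3: "cut (Gap K) (cut (Gap B.K) u) = cut (Gap K) u"
      by (subst cut_cut_subset[OF B.Gap_J_K], assumption) (rule refl)
    have "u \<in> brick_ext C.K (brick_comp A.K j K (brick_comp I i J x y) z) X \<longleftrightarrow>
        u \<in> brick_ext D.K (brick_comp I i B.K x (brick_comp J j K y z)) X"
      unfolding C.brick_ext_comp_mem[OF xy z X] D.brick_ext_comp_mem[OF x yz X']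
        A.brick_ext_comp_mem[OF x y C.convex_collapse(1)[OF X]]
        B.brick_ext_comp_mem[OF y z D.convex_collapse(2)[OF X']]
      unfolding c1 c2 c3 s1 s2 s3 KK using cut_in by blast
    then show "u \<in> brick_ext C.K (brick_comp A.K j K (brick_comp I i J x y) z) X \<longleftrightarrow>
        u \<in> brick_ext C.K (brick_comp I i B.K x (brick_comp J j K y z)) X"
      unfolding KK by blast
  qed
qed

section \<open>The unit axioms\<close>

lemma singleton_ordinal:
  "finite_ordinal {(i, i)}" "Field {(i, i)} = {i}" "proper_intervals {(i, i)} = {}" "Gap {(i, i)} = {}"
proof -
  show "finite_ordinal {(i, i)}" "Field {(i, i)} = {i}"
    by (rule finite_ordinalI[of "{i}"]; simp)+
  then show "proper_intervals {(i, i)} = {}" "Gap {(i, i)} = {}"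
    by (auto simp: proper_intervals_def ord_interval_def Gap_def ord_lt_def)
qed

lemma brick_unit_bricks: "brick_unit i \<in> bricks {(i, i)}"
  unfolding bricks_iff singleton_ordinal by (simp add: brick_unit_def extensional_def)

lemma brick_unit_natural: "brick_act {(i, i)} {(j, j)} (\<lambda>_. j) (brick_unit i) = brick_unit j"
  by (simp add: brick_act_def brick_unit_def singleton_ordinal fun_eq_iff)

text \<open>Inserting \<open>J\<close> into a single point gives the relation \<open>J\<close>
  itself, so no relabelling appears. The one-point ordinal has no gaps and contributes the zero
  space.\<close>

lemma brick_unit_left:
  fixes y :: "('i, 'a::field) subspaces"
  assumes J: "finite_ordinal J" "i \<notin> Field J" and y: "y \<in> bricks J"
  shows "brick_comp {(i, i)} i J (brick_unit i) y = y"
proof -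
  interpret A: insertion "{(i, i)}" i J
    by (rule insertionI) (use J singleton_ordinal in auto)
  have K: "A.K = J" using J(2) by (auto simp: ord_insert_def ord_lt_def)
  note u = brick_unit_bricks[of i]
  note c = A.brick_comp_bricks[OF u y]
  show ?thesis
  proof (rule bricks_eqI'[OF J(1) c[unfolded K] y])
    fix X and u :: "'i \<times> 'i \<Rightarrow> 'a" assume X: "convex_in J X" "X \<noteq> {}" "X \<noteq> Field J"
    \<comment> \<open>A proper \<open>X\<close> does not contain all of \<open>J\<close>, so its
      trace on the one-point ordinal is empty and only the value of \<open>y\<close>
      remains.\<close>
    have XJ: "X \<inter> Field J = X" "\<not> Field J \<subseteq> X" using X by (auto simp: convex_in_def)
    then have col: "A.collapse X = {}" by (auto simp: A.collapse_def singleton_ordinal)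
    have X': "convex_in A.K X" using X K by simp
    show "u \<in> brick_ext J (brick_comp {(i, i)} i J (brick_unit i) y) X \<longleftrightarrow> u \<in> brick_ext J y X"
      using A.brick_ext_comp_mem[OF brick_unit_bricks y X', of u]
        brick_familyD(2)[OF bricks_imp_brick_family[OF J(1) y] X(1)] cut_coord_space[of u "Gap J"]
      unfolding K col XJ(1) singleton_ordinal(4) by (auto simp: cut_empty brick_ext_empty)
  qed
qed

text \<open>Here the point \<open>i\<close> is renamed to \<open>j\<close>: the gap map of the
  insertion is the relabelling of gaps, and the trace of a set is its preimage.\<close>

lemma brick_unit_right:
  fixes x :: "('i, 'a::field) subspaces"
  assumes I: "finite_ordinal I" "i \<in> Field I" "j \<notin> Field I" and x: "x \<in> bricks I"
  shows "brick_comp I i {(j, j)} x (brick_unit j)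
    = brick_act I (ord_insert I i {(j, j)}) ((\<lambda>l. l)(i := j)) x"
proof -
  interpret A: insertion I i "{(j, j)}"
    by (rule insertionI) (use I singleton_ordinal in auto)
  let ?\<phi> = "(\<lambda>l. l)(i := j)"
  have "ord_iso I A.K ?\<phi>"
    unfolding ord_iso_def A.Field_K singleton_ordinal
  proof (intro conjI ballI)
    show "bij_betw ?\<phi> (Field I) (Field I - {i} \<union> {j})"
      using I(2,3) by (auto simp: bij_betw_def inj_on_def)
    fix a b assume ab: "a \<in> Field I" "b \<in> Field I"
    then show "(a, b) \<in> I \<longleftrightarrow> (?\<phi> a, ?\<phi> b) \<in> A.K"
      using I A.DI(3)[OF I(2)] by (cases "a = i"; cases "b = i") (auto simp: A.K_simps singleton_ordinal)
  qed
  then interpret F: relabelling I A.K ?\<phi> using I A.finite_ordinal_K by unfold_locales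
  have m: "ord_max {(j, j)} = j" "ord_min {(j, j)} = j"
    using A.max_J(1) A.min_J(1) by (simp_all add: singleton_ordinal)
  note u = brick_unit_bricks[of j]
  show ?thesis
  proof (rule bricks_eqI'[OF A.finite_ordinal_K A.brick_comp_bricks[OF x u] F.brick_act_bricks[OF x]])
    fix X and u :: "'i \<times> 'i \<Rightarrow> 'a" assume X: "convex_in A.K X"
    have col: "A.collapse X = F.pre X"
      by (auto simp: A.collapse_def F.pre_def singleton_ordinal)
    have gm: "gap_map i {(j, j)} g = map_prod ?\<phi> ?\<phi> g" for g
      by (cases g) (simp add: gap_map_def m)
    \<comment> \<open>The one-point ordinal has no gaps, so the condition on the second pullback
      concerns the zero vector only. It holds whether or not \<open>j\<close> lies in
      \<open>X\<close>.\<close>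
    have "(0 :: 'i \<times> 'i \<Rightarrow> 'a) \<in> brick_ext {(j, j)} (brick_unit j) (X \<inter> {j})"
      by (auto simp: brick_ext_def Gsp_def singleton_ordinal coord_space_def)
    then show "u \<in> brick_ext A.K (brick_comp I i {(j, j)} x (brick_unit j)) X \<longleftrightarrow>
        u \<in> brick_ext A.K (brick_act I A.K ?\<phi> x) X"
      unfolding A.brick_ext_comp_mem[OF x brick_unit_bricks X] F.brick_ext_act_mem[OF x X]
      by (simp add: col gm singleton_ordinal cut_empty)
  qed
qed

section \<open>Regularity of the structure maps\<close>

definition brick_dim :: "'i rel \<Rightarrow> 'i \<times> 'i \<Rightarrow> nat" where
  "brick_dim I = (\<lambda>(i, j). card (ord_interval I i j))"

locale brick_charts =
  fixes I :: "'i rel"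
  assumes I: "finite_ordinal I"
begin

sublocale GD: grassmannian_data "proper_intervals I" "\<lambda>_. Gap I" "brick_dim I"
  by (rule grassmannian_data_bricks[OF I])

definition brick_chart ::
  "('i \<times> 'i \<Rightarrow> ('i \<times> 'i) set) \<Rightarrow>
    (('i, 'a::field) subspaces, ('i \<times> 'i) \<times> ('i \<times> 'i) \<times> ('i \<times> 'i), 'a) chart" where
  "brick_chart T = Chart (cdom (GD.gchart T) \<inter> bricks I) (GD.chart_vars T) (ccoord (GD.gchart T))"

lemma brick_chart_simps:
  "cdom (brick_chart T) = cdom (GD.gchart T) \<inter> bricks I"
  "cvars (brick_chart T) = GD.chart_vars T"
  "ccoord (brick_chart T) = ccoord (GD.gchart T)"
  by (simp_all add: brick_chart_def)

lemma atlas_brick_variety: "atlas (brick_variety I) = brick_chart ` GD.frames"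
proof -
  have "atlas (brick_variety I) = (\<lambda>C. Chart (cdom C \<inter> bricks I) (cvars C) (ccoord C)) ` GD.gchart ` GD.frames"
    unfolding brick_variety_def subvariety_def grassmannian_product_def GD.frames_def
    unfolding brick_dim_def by simp
  then show ?thesis by (simp add: image_image brick_chart_def GD.cvars_gchart)
qed

lemma bricks_gpoints: "V \<in> bricks I \<Longrightarrow> V \<in> GD.gpoints"
  by (auto simp: bricks_iff PiE_iff brick_dim_def)

lemma bricks_cdom_iff:
  "T \<in> GD.frames \<Longrightarrow> V \<in> bricks I \<Longrightarrow>
    V \<in> cdom (brick_chart T) \<longleftrightarrow> (\<forall>\<alpha>\<in>proper_intervals I. framed (V \<alpha>) (T \<alpha>))"
  by (simp add: bricks_gpoints brick_chart_simps GD.cdom_gchart)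

lemma ex_brick_chart:
  assumes "V \<in> bricks I"
  shows "\<exists>T\<in>GD.frames. V \<in> cdom (brick_chart T)"
  using GD.gpoints_cdom[OF bricks_gpoints[OF assms]] assms by (auto simp: brick_chart_simps)

text \<open>Frames for the added values of \<open>brick_ext\<close>: the zero space has the empty
  frame, and \<open>G(I)\<close> has all gaps.\<close>

definition frame_ext :: "('i \<times> 'i \<Rightarrow> ('i \<times> 'i) set) \<Rightarrow> 'i set \<Rightarrow> ('i \<times> 'i) set" where
  "frame_ext T X = (if X = {} then {} else if X = Field I then Gap I else T (lo I X, hi I X))"

text \<open>For the two added sets the frame matrix is an identity matrix, empty in the first case.
  These are the constants that the composition inserts among the copied coordinates.\<close>

definition entry_ext ::
  "('i \<times> 'i \<Rightarrow> ('i \<times> 'i) set) \<Rightarrow> 'i set \<Rightarrow> 'i \<times> 'i \<Rightarrow> 'i \<times> 'i \<Rightarrow>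
    (('i \<times> 'i) \<times> ('i \<times> 'i) \<times> ('i \<times> 'i) \<Rightarrow> 'a::field) \<Rightarrow> 'a" where
  "entry_ext T X t s x =
     (if X = {} \<or> X = Field I then basis_vec t s else GD.entry T (lo I X, hi I X) t s x)"

lemma polyfun_entry_ext:
  assumes k: "is_subfield k" and g: "\<And>c. polyfun k (\<lambda>z. g z c)"
  shows "polyfun k (\<lambda>z. entry_ext T X t s (g z))"
proof (cases "X = {} \<or> X = Field I")
  case True
  have "polyfun k (\<lambda>z. basis_vec t s)"
    by (cases "s = t") (simp_all add: basis_vec_def polyfun_0 polyfun_1 k)
  then show ?thesis using True by (simp add: entry_ext_def)
next
  case False
  then show ?thesis using GD.polyfun_entry_subst[OF k g] by (simp add: entry_ext_def)
qed

lemma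
  fixes V :: "('i, 'a::field) subspaces"
  assumes T: "T \<in> GD.frames" and V: "V \<in> cdom (brick_chart T)" and X: "convex_in I X"
  shows framed_brick_ext: "framed (brick_ext I V X) (frame_ext T X)"
    and frame_ext_subset: "frame_ext T X \<subseteq> Gap I"
    and graph_vec_brick_ext: "t \<in> frame_ext T X \<Longrightarrow> s \<in> Gap I \<Longrightarrow>
      graph_vec (brick_ext I V X) (frame_ext T X) t s = entry_ext T X t s (ccoord (brick_chart T) V)"
proof -
  have Vb: "V \<in> bricks I" and Vg: "V \<in> cdom (GD.gchart T)" using V by (auto simp: brick_chart_simps)
  have cs: "framed (coord_space S :: ('i \<times> 'i \<Rightarrow> 'a) set) S" for S by (rule framed_coord_space)
  consider "X = {}" | "X = Field I" "X \<noteq> {}" | "X \<noteq> {}" "X \<noteq> Field I" by blast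
  then have *: "framed (brick_ext I V X) (frame_ext T X) \<and> frame_ext T X \<subseteq> Gap I \<and>
      (t \<in> frame_ext T X \<longrightarrow> s \<in> Gap I \<longrightarrow>
        graph_vec (brick_ext I V X) (frame_ext T X) t s = entry_ext T X t s (ccoord (brick_chart T) V))" for t s
  proof cases
    case 1
    then show ?thesis
      using cs[of "{}"] by (simp add: frame_ext_def brick_ext_empty coord_space_empty)
  next
    case 2
    then have "frame_ext T X = Gap I" "brick_ext I V X = coord_space (Gap I)"
      using brick_ext_Field[OF I, of V] by (simp_all add: frame_ext_def)
    then show ?thesis
      using cs[of "Gap I"] graph_vec_framed(2)[OF cs[of "Gap I"]] 2
      by (simp add: entry_ext_def)
  next
    case 3
    then have p: "(lo I X, hi I X) \<in> proper_intervals I" using proper_intervals_lo_hi[OF I X] by blast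
    have "framed (V (lo I X, hi I X)) (T (lo I X, hi I X))"
      using bricks_cdom_iff[OF T Vb] V p by blast
    then show ?thesis
      using 3 GD.frames_D(1)[OF T p] GD.graph_vec_entry[OF T Vg p]
      by (simp add: frame_ext_def brick_ext_def entry_ext_def brick_chart_simps)
  qed
  then show "framed (brick_ext I V X) (frame_ext T X)" "frame_ext T X \<subseteq> Gap I"
    "t \<in> frame_ext T X \<Longrightarrow> s \<in> Gap I \<Longrightarrow>
      graph_vec (brick_ext I V X) (frame_ext T X) t s = entry_ext T X t s (ccoord (brick_chart T) V)"
    by blast+
qed

text \<open>The cardinality required of the index sets of a chart is automatic, being the dimension
  of a framed subspace. So frames found at one point determine a chart.\<close>

lemma frames_of_brick:
  assumes V: "V \<in> bricks I"
    and T: "\<And>\<alpha>. \<alpha> \<in> proper_intervals I \<Longrightarrow> T \<alpha> \<subseteq> Gap I"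
      "\<And>\<alpha>. \<alpha> \<in> proper_intervals I \<Longrightarrow> framed (V \<alpha>) (T \<alpha>)"
  shows "restrict T (proper_intervals I) \<in> GD.frames"
proof -
  have "card (T \<alpha>) = brick_dim I \<alpha>" if \<alpha>: "\<alpha> \<in> proper_intervals I" for \<alpha>
  proof -
    have "finite (T \<alpha>)" using T(1)[OF \<alpha>] finite_Gap[OF I] finite_subset by blast
    then have "fvs.dim (V \<alpha>) = card (T \<alpha>)" by (rule framed_dim[OF T(2)[OF \<alpha>]])
    moreover have "V \<alpha> \<in> grassmannian (Gap I) (brick_dim I \<alpha>)"
      using bricks_gpoints[OF V] \<alpha> by (auto simp: PiE_iff)
    ultimately show ?thesis by (simp add: grassmannian_def)
  qed
  then show ?thesis using T(1) by (auto simp: GD.frames_def)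
qed

end

section \<open>Regularity of composition, relabelling and unit in charts\<close>

lemma proper_interval_convex:
  assumes "finite_ordinal I" "(a, b) \<in> proper_intervals I"
  shows "convex_in I (ord_interval I a b)"
  using interval(1)[OF assms(1), of a b] assms(2) by (simp add: proper_intervals_iff)

text \<open>Gluing the frames of a chart at \<open>V\<close> and a chart at \<open>W\<close> frames
  the composite at every proper interval. The target chart depends only on the two source charts, so
  the whole product chart maps into it; each new coordinate is an old one or a constant
  \<open>0\<close> or \<open>1\<close>.\<close>

lemma morphism_brick_comp:
  fixes k :: "'a::field set"
  assumes k: "is_subfield k" and IJ: "insertion I i J"
  shows "morphism k (prod_variety (brick_variety I) (brick_variety J))
    (brick_variety (ord_insert I i J) :: (('i, 'a) subspaces, _, 'a) variety) (\<lambda>(x, y). brick_comp I i J x y)"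
  unfolding morphism_def
proof (intro conjI ballI)
  interpret A: insertion I i J by (rule IJ)
  interpret CI: brick_charts I by unfold_locales (rule A.I)
  interpret CJ: brick_charts J by unfold_locales (rule A.J)
  interpret CK: brick_charts A.K by unfold_locales (rule A.finite_ordinal_K)
  let ?\<phi> = "\<lambda>(x, y). brick_comp I i J x y :: ('i, 'a) subspaces"
  let ?X = "prod_variety (brick_variety I) (brick_variety J) ::
    (('i, 'a) subspaces \<times> ('i, 'a) subspaces, _, 'a) variety"
  have points: "points ?X = bricks I \<times> bricks J" by (simp add: prod_variety_def points_brick_variety)
  show "?\<phi> \<in> points ?X \<rightarrow> points (brick_variety A.K)"
    using A.brick_comp_bricks by (auto simp: points points_brick_variety)
  fix x assume "x \<in> points ?X"
  then obtain V W where x: "x = (V, W)" and V: "V \<in> bricks I" and W: "W \<in> bricks J" using points by auto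
  obtain T1 where T1: "T1 \<in> CI.GD.frames" "V \<in> cdom (CI.brick_chart T1)" using CI.ex_brick_chart[OF V] by blast
  obtain T2 where T2: "T2 \<in> CJ.GD.frames" "W \<in> cdom (CJ.brick_chart T2)" using CJ.ex_brick_chart[OF W] by blast
  define C where "C \<alpha> = A.collapse (ord_interval A.K (fst \<alpha>) (snd \<alpha>))" for \<alpha>
  define D where "D \<alpha> = ord_interval A.K (fst \<alpha>) (snd \<alpha>) \<inter> Field J" for \<alpha>
  define T where "T \<alpha> = gap_map i J ` CI.frame_ext T1 (C \<alpha>) \<union> (\<lambda>g. g) ` CJ.frame_ext T2 (D \<alpha>)" for \<alpha>
  have conv: "convex_in I (C \<alpha>)" "convex_in J (D \<alpha>)" if "\<alpha> \<in> proper_intervals A.K" for \<alpha>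
    using A.convex_collapse[OF proper_interval_convex[OF A.finite_ordinal_K, of "fst \<alpha>" "snd \<alpha>"]] that
    by (auto simp: C_def D_def)
  have comp: "brick_comp I i J V' W' \<alpha> = A.gl (brick_ext I V' (C \<alpha>)) (brick_ext J W' (D \<alpha>))"
    if V': "V' \<in> bricks I" and W': "W' \<in> bricks J" and \<alpha>: "\<alpha> \<in> proper_intervals A.K"
    for V' W' :: "('i, 'a) subspaces" and \<alpha>
  proof -
    have \<alpha>': "(fst \<alpha>, snd \<alpha>) \<in> proper_intervals A.K" using \<alpha> by simp
    show ?thesis
      using A.brick_ext_comp[OF V' W' proper_interval_convex[OF A.finite_ordinal_K \<alpha>']]
        brick_ext_interval[OF A.finite_ordinal_K \<alpha>', of "brick_comp I i J V' W'"] by (simp add: C_def D_def)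
  qed
  have glue: "framed (brick_comp I i J V' W' \<alpha>) (T \<alpha>)"
    "t \<in> T \<alpha> \<Longrightarrow> graph_vec (brick_comp I i J V' W' \<alpha>) (T \<alpha>) t s =
       (if t \<in> gap_map i J ` Gap I \<and> s \<in> gap_map i J ` Gap I
        then CI.entry_ext T1 (C \<alpha>) (inv_into (Gap I) (gap_map i J) t) (inv_into (Gap I) (gap_map i J) s)
          (ccoord (CI.brick_chart T1) V')
        else if t \<in> Gap J \<and> s \<in> Gap J then CJ.entry_ext T2 (D \<alpha>) t s (ccoord (CJ.brick_chart T2) W')
        else 0)"
    if V': "V' \<in> cdom (CI.brick_chart T1)" and W': "W' \<in> cdom (CJ.brick_chart T2)" and \<alpha>: "\<alpha> \<in> proper_intervals A.K"
    for V' W' :: "('i, 'a) subspaces" and \<alpha> t s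
  proof -
    have b: "V' \<in> bricks I" "W' \<in> bricks J" using V' W' by (auto simp: CI.brick_chart_simps CJ.brick_chart_simps)
    note sI = brick_familyD(2)[OF bricks_imp_brick_family[OF A.I b(1)] conv(1)[OF \<alpha>]]
    note sJ = brick_familyD(2)[OF bricks_imp_brick_family[OF A.J b(2)] conv(2)[OF \<alpha>]]
    note fI = CI.framed_brick_ext[OF T1(1) V' conv(1)[OF \<alpha>]] CI.frame_ext_subset[OF T1(1) V' conv(1)[OF \<alpha>]]
    note fJ = CJ.framed_brick_ext[OF T2(1) W' conv(2)[OF \<alpha>]] CJ.frame_ext_subset[OF T2(1) W' conv(2)[OF \<alpha>]]
    show "framed (brick_comp I i J V' W' \<alpha>) (T \<alpha>)"
      unfolding comp[OF b \<alpha>] T_def by (rule A.G.framed_glue[OF fI(1) sI fI(2) fJ(1) sJ fJ(2)])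
    assume t: "t \<in> T \<alpha>"
    have invJ: "inv_into (Gap J) (\<lambda>g. g) g = g" if "g \<in> Gap J" for g
      by (rule inv_into_f_f[of "\<lambda>g. g" "Gap J" g]) (use that in auto)
    \<comment> \<open>The images of gaps of \<open>I\<close> and the gaps of \<open>J\<close> are
      disjoint, so an index of the united frame reveals the summand it belongs to.\<close>
    have tI: "inv_into (Gap I) (gap_map i J) t \<in> CI.frame_ext T1 (C \<alpha>)" if "t \<in> gap_map i J ` Gap I"
    proof -
      have "t \<notin> Gap J" using that A.G.disj by auto
      then obtain r where r: "r \<in> CI.frame_ext T1 (C \<alpha>)" "t = gap_map i J r" using t fJ(2) by (auto simp: T_def)
      then have "r \<in> Gap I" using fI(2) by blast
      then show ?thesis using inv_into_f_f[OF A.G.inj(1)] r by simp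
    qed
    have tJ: "t \<in> CJ.frame_ext T2 (D \<alpha>)" if "t \<in> Gap J"
    proof -
      have "t \<notin> gap_map i J ` Gap I" using that A.G.disj by auto
      then show ?thesis using t fI(2) by (auto simp: T_def)
    qed
    have 1: "graph_vec (brick_ext I V' (C \<alpha>)) (CI.frame_ext T1 (C \<alpha>)) (inv_into (Gap I) (gap_map i J) t)
        (inv_into (Gap I) (gap_map i J) s) = CI.entry_ext T1 (C \<alpha>) (inv_into (Gap I) (gap_map i J) t)
          (inv_into (Gap I) (gap_map i J) s) (ccoord (CI.brick_chart T1) V')"
      if "t \<in> gap_map i J ` Gap I" "s \<in> gap_map i J ` Gap I"
      by (rule CI.graph_vec_brick_ext[OF T1(1) V' conv(1)[OF \<alpha>] tI[OF that(1)] inv_into_into[OF that(2)]])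
    have 2: "graph_vec (brick_ext J W' (D \<alpha>)) (CJ.frame_ext T2 (D \<alpha>)) t s =
        CJ.entry_ext T2 (D \<alpha>) t s (ccoord (CJ.brick_chart T2) W')"
      if "t \<in> Gap J" "s \<in> Gap J"
      by (rule CJ.graph_vec_brick_ext[OF T2(1) W' conv(2)[OF \<alpha>] tJ[OF that(1)] that(2)])
    have "graph_vec (brick_comp I i J V' W' \<alpha>) (T \<alpha>) t s =
       (if t \<in> gap_map i J ` Gap I \<and> s \<in> gap_map i J ` Gap I
        then graph_vec (brick_ext I V' (C \<alpha>)) (CI.frame_ext T1 (C \<alpha>))
          (inv_into (Gap I) (gap_map i J) t) (inv_into (Gap I) (gap_map i J) s)
        else if t \<in> (\<lambda>g. g) ` Gap J \<and> s \<in> (\<lambda>g. g) ` Gap J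
        then graph_vec (brick_ext J W' (D \<alpha>)) (CJ.frame_ext T2 (D \<alpha>))
          (inv_into (Gap J) (\<lambda>g. g) t) (inv_into (Gap J) (\<lambda>g. g) s)
        else 0)"
      unfolding comp[OF b \<alpha>] T_def
      by (rule A.G.graph_vec_glue[OF fI(1) sI fI(2) fJ(1) sJ fJ(2) t[unfolded T_def]])
    then show "graph_vec (brick_comp I i J V' W' \<alpha>) (T \<alpha>) t s =
       (if t \<in> gap_map i J ` Gap I \<and> s \<in> gap_map i J ` Gap I
        then CI.entry_ext T1 (C \<alpha>) (inv_into (Gap I) (gap_map i J) t) (inv_into (Gap I) (gap_map i J) s)
          (ccoord (CI.brick_chart T1) V')
        else if t \<in> Gap J \<and> s \<in> Gap J then CJ.entry_ext T2 (D \<alpha>) t s (ccoord (CJ.brick_chart T2) W')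
        else 0)"
      using 1 2 by (simp add: invJ)
  qed
  have TK: "T \<alpha> \<subseteq> Gap A.K" if "\<alpha> \<in> proper_intervals A.K" for \<alpha>
    using CI.frame_ext_subset[OF T1 conv(1)[OF that]] CJ.frame_ext_subset[OF T2 conv(2)[OF that]]
      A.Gap_K by (auto simp: T_def)
  define T3 where "T3 = restrict T (proper_intervals A.K)"
  have T3: "T3 \<in> CK.GD.frames"
    unfolding T3_def by (rule CK.frames_of_brick[OF A.brick_comp_bricks[OF V W] TK glue(1)[OF T1(2) T2(2)]])
  \<comment> \<open>Entries within a block are read from the coordinates of the corresponding
    factor, selected by \<open>Inl\<close> or \<open>Inr\<close>; entries between different blocks
    vanish.\<close>
  define p where "p = (\<lambda>(\<alpha>, t, s) z.
      if t \<in> gap_map i J ` Gap I \<and> s \<in> gap_map i J ` Gap I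
      then CI.entry_ext T1 (C \<alpha>) (inv_into (Gap I) (gap_map i J) t) (inv_into (Gap I) (gap_map i J) s)
        (\<lambda>c. z (Inl c))
      else if t \<in> Gap J \<and> s \<in> Gap J then CJ.entry_ext T2 (D \<alpha>) t s (\<lambda>c. z (Inr c)) else (0 :: 'a))"
  let ?C = "prod_chart (CI.brick_chart T1) (CJ.brick_chart T2)"
  have "regular_at k ?C (CK.brick_chart T3) ?\<phi> x"
  proof (rule regular_atI_polyfun[OF k, where p = p])
    show "x \<in> cdom ?C" using T1(2) T2(2) by (simp add: prod_chart_def x)
    fix j show "polyfun k (p j)"
    proof -
      obtain \<alpha> t s where j: "j = (\<alpha>, t, s)" by (cases j)
      show ?thesis
        unfolding p_def j prod.case
        by (cases "t \<in> gap_map i J ` Gap I \<and> s \<in> gap_map i J ` Gap I"; cases "t \<in> Gap J \<and> s \<in> Gap J")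
          (simp_all only: if_True if_False,
            auto intro!: CI.polyfun_entry_ext CJ.polyfun_entry_ext k polyfun_var polyfun_0)
    qed
  next
    fix y :: "('i, 'a) subspaces \<times> ('i, 'a) subspaces" assume "y \<in> cdom ?C"
    then obtain V' W' where y: "y = (V', W')" and V': "V' \<in> cdom (CI.brick_chart T1)"
      and W': "W' \<in> cdom (CJ.brick_chart T2)" by (auto simp: prod_chart_def)
    then have b: "V' \<in> bricks I" "W' \<in> bricks J" by (auto simp: CI.brick_chart_simps CJ.brick_chart_simps)
    show "?\<phi> y \<in> cdom (CK.brick_chart T3)"
      using CK.bricks_cdom_iff[OF T3 A.brick_comp_bricks[OF b]] glue(1)[OF V' W'] by (simp add: y T3_def)
    fix j assume "j \<in> cvars (CK.brick_chart T3)"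
    then obtain \<alpha> t s where j: "j = (\<alpha>, t, s)" and jv: "(\<alpha>, t, s) \<in> CK.GD.chart_vars T3"
      by (cases j) (auto simp: CK.brick_chart_simps)
    then have \<alpha>: "\<alpha> \<in> proper_intervals A.K" and t: "t \<in> T \<alpha>" by (auto simp: CK.GD.chart_vars_def T3_def)
    show "ccoord (CK.brick_chart T3) (?\<phi> y) j = p j (ccoord ?C y)"
      using glue(2)[OF V' W' \<alpha> t, of s] \<alpha> jv
      by (simp add: CK.brick_chart_simps CK.GD.ccoord_gchart j y p_def prod_chart_def T3_def)
  qed
  moreover have "?C \<in> atlas ?X"
    using T1(1) T2(1) by (auto simp: prod_variety_def CI.atlas_brick_variety CJ.atlas_brick_variety)
  moreover have "CK.brick_chart T3 \<in> atlas (brick_variety A.K)"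
    using T3 by (simp add: CK.atlas_brick_variety)
  ultimately show "\<exists>C\<in>atlas ?X. \<exists>D\<in>atlas (brick_variety A.K). regular_at k C D ?\<phi> x" by blast
qed

text \<open>The same argument with a single block: the coordinates are permuted, up to the constants
  at the empty and the full set.\<close>

lemma morphism_brick_act:
  fixes k :: "'a::field set"
  assumes k: "is_subfield k" and R: "relabelling I I' \<phi>"
  shows "morphism k (brick_variety I) (brick_variety I' :: (('i, 'a) subspaces, _, 'a) variety) (brick_act I I' \<phi>)"
  unfolding morphism_def points_brick_variety
proof (intro conjI ballI)
  interpret R: relabelling I I' \<phi> by (rule R)
  interpret CI: brick_charts I by unfold_locales (rule R.I)
  interpret CK: brick_charts I' by unfold_locales (rule R.I')
  let ?h = "map_prod \<phi> \<phi>"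
  show "(brick_act I I' \<phi> :: ('i, 'a) subspaces \<Rightarrow> _) \<in> bricks I \<rightarrow> bricks I'"
    using R.brick_act_bricks by blast
  fix V :: "('i, 'a) subspaces" assume V: "V \<in> bricks I"
  obtain T1 where T1: "T1 \<in> CI.GD.frames" "V \<in> cdom (CI.brick_chart T1)" using CI.ex_brick_chart[OF V] by blast
  define C where "C \<alpha> = R.pre (ord_interval I' (fst \<alpha>) (snd \<alpha>))" for \<alpha>
  define T where "T \<alpha> = ?h ` CI.frame_ext T1 (C \<alpha>)" for \<alpha>
  have conv: "convex_in I (C \<alpha>)" if "\<alpha> \<in> proper_intervals I'" for \<alpha>
    using R.convex_pre(1)[OF proper_interval_convex[OF R.I', of "fst \<alpha>" "snd \<alpha>"]] that by (auto simp: C_def)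
  have act: "brick_act I I' \<phi> V' \<alpha> = R.gl (brick_ext I V' (C \<alpha>))"
    if V': "V' \<in> bricks I" and \<alpha>: "\<alpha> \<in> proper_intervals I'" for V' :: "('i, 'a) subspaces" and \<alpha>
  proof -
    have \<alpha>': "(fst \<alpha>, snd \<alpha>) \<in> proper_intervals I'" using \<alpha> by simp
    show ?thesis
      using R.brick_ext_act[OF V' proper_interval_convex[OF R.I' \<alpha>']]
        brick_ext_interval[OF R.I' \<alpha>', of "brick_act I I' \<phi> V'"] by (simp add: C_def)
  qed
  have z: "framed {0 :: 'i \<times> 'i \<Rightarrow> 'a} {}" "{0 :: 'i \<times> 'i \<Rightarrow> 'a} \<subseteq> coord_space {}"
    using framed_coord_space[of "{}"] by (auto simp: coord_space_empty)
  have glue: "framed (brick_act I I' \<phi> V' \<alpha>) (T \<alpha>)"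
    "t \<in> T \<alpha> \<Longrightarrow> s \<in> Gap I' \<Longrightarrow> graph_vec (brick_act I I' \<phi> V' \<alpha>) (T \<alpha>) t s =
       CI.entry_ext T1 (C \<alpha>) (inv_into (Gap I) ?h t) (inv_into (Gap I) ?h s) (ccoord (CI.brick_chart T1) V')"
    if V': "V' \<in> cdom (CI.brick_chart T1)" and \<alpha>: "\<alpha> \<in> proper_intervals I'"
    for V' :: "('i, 'a) subspaces" and \<alpha> t s
  proof -
    have b: "V' \<in> bricks I" using V' by (auto simp: CI.brick_chart_simps)
    note sI = brick_familyD(2)[OF bricks_imp_brick_family[OF R.I b] conv[OF \<alpha>]]
    note fI = CI.framed_brick_ext[OF T1(1) V' conv[OF \<alpha>]] CI.frame_ext_subset[OF T1(1) V' conv[OF \<alpha>]]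
    \<comment> \<open>Written with an empty second frame, to fit the gluing with the zero
      space.\<close>
    have T': "T \<alpha> = ?h ` CI.frame_ext T1 (C \<alpha>) \<union> (\<lambda>g. g) ` {}" by (simp add: T_def)
    show "framed (brick_act I I' \<phi> V' \<alpha>) (T \<alpha>)"
      unfolding act[OF b \<alpha>] T' by (rule R.G.framed_glue[OF fI(1) sI fI(2) z order_refl])
    assume t: "t \<in> T \<alpha>" and s: "s \<in> Gap I'"
    have s': "s \<in> ?h ` Gap I" using s R.Gap_image by simp
    obtain r where r: "r \<in> CI.frame_ext T1 (C \<alpha>)" "t = ?h r" using t by (auto simp: T_def)
    then have "r \<in> Gap I" using fI(2) by blast
    then have t': "t \<in> ?h ` Gap I" "inv_into (Gap I) ?h t \<in> CI.frame_ext T1 (C \<alpha>)"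
      using inv_into_f_f[OF R.G.inj(1)] r by (simp_all only: image_eqI)
    have "graph_vec (brick_act I I' \<phi> V' \<alpha>) (T \<alpha>) t s =
       graph_vec (brick_ext I V' (C \<alpha>)) (CI.frame_ext T1 (C \<alpha>)) (inv_into (Gap I) ?h t) (inv_into (Gap I) ?h s)"
      unfolding act[OF b \<alpha>] T'
      using R.G.graph_vec_glue[OF fI(1) sI fI(2) z order_refl t[unfolded T']] s' t'(1) by simp
    also have "\<dots> = CI.entry_ext T1 (C \<alpha>) (inv_into (Gap I) ?h t) (inv_into (Gap I) ?h s)
        (ccoord (CI.brick_chart T1) V')"
      by (rule CI.graph_vec_brick_ext[OF T1(1) V' conv[OF \<alpha>] t'(2) inv_into_into[OF s']])
    finally show "graph_vec (brick_act I I' \<phi> V' \<alpha>) (T \<alpha>) t s =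
       CI.entry_ext T1 (C \<alpha>) (inv_into (Gap I) ?h t) (inv_into (Gap I) ?h s) (ccoord (CI.brick_chart T1) V')" .
  qed
  have TK: "T \<alpha> \<subseteq> Gap I'" if "\<alpha> \<in> proper_intervals I'" for \<alpha>
    using CI.frame_ext_subset[OF T1 conv[OF that]] R.Gap_image by (auto simp: T_def)
  define T3 where "T3 = restrict T (proper_intervals I')"
  have T3: "T3 \<in> CK.GD.frames"
    unfolding T3_def by (rule CK.frames_of_brick[OF R.brick_act_bricks[OF V] TK glue(1)[OF T1(2)]])
  define p where "p = (\<lambda>(\<alpha>, t, s) z :: _ \<Rightarrow> 'a.
      CI.entry_ext T1 (C \<alpha>) (inv_into (Gap I) ?h t) (inv_into (Gap I) ?h s) z)"
  have "regular_at k (CI.brick_chart T1) (CK.brick_chart T3) (brick_act I I' \<phi>) V"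
  proof (rule regular_atI_polyfun[OF k T1(2), where p = p])
    fix j show "polyfun k (p j)"
      unfolding p_def by (cases j) (auto intro!: CI.polyfun_entry_ext k polyfun_var)
  next
    fix V' :: "('i, 'a) subspaces" assume V': "V' \<in> cdom (CI.brick_chart T1)"
    then have b: "V' \<in> bricks I" by (auto simp: CI.brick_chart_simps)
    show "brick_act I I' \<phi> V' \<in> cdom (CK.brick_chart T3)"
      using CK.bricks_cdom_iff[OF T3 R.brick_act_bricks[OF b]] glue(1)[OF V'] by (simp add: T3_def)
    fix j assume "j \<in> cvars (CK.brick_chart T3)"
    then obtain \<alpha> t s where j: "j = (\<alpha>, t, s)" and jv: "(\<alpha>, t, s) \<in> CK.GD.chart_vars T3"
      by (cases j) (auto simp: CK.brick_chart_simps)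
    then have \<alpha>: "\<alpha> \<in> proper_intervals I'" and t: "t \<in> T \<alpha>" and s: "s \<in> Gap I'"
      by (auto simp: CK.GD.chart_vars_def T3_def)
    show "ccoord (CK.brick_chart T3) (brick_act I I' \<phi> V') j = p j (ccoord (CI.brick_chart T1) V')"
      using glue(2)[OF V' \<alpha> t s] \<alpha> jv
      by (simp add: CK.brick_chart_simps CK.GD.ccoord_gchart j p_def T3_def)
  qed
  moreover have "CI.brick_chart T1 \<in> atlas (brick_variety I)"
    using T1(1) by (simp add: CI.atlas_brick_variety)
  moreover have "CK.brick_chart T3 \<in> atlas (brick_variety I')"
    using T3 by (simp add: CK.atlas_brick_variety)
  ultimately show "\<exists>C\<in>atlas (brick_variety I). \<exists>D\<in>atlas (brick_variety I'). regular_at k C D (brick_act I I' \<phi>) V"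
    by blast
qed

text \<open>A one-point ordinal has no proper intervals, hence its chart has no coordinates and
  there are no functions to check.\<close>

lemma morphism_brick_unit:
  fixes k :: "'a::field set"
  assumes k: "is_subfield k"
  shows "morphism k point_variety (brick_variety {(i, i)} :: (('i, 'a) subspaces, _, 'a) variety) (\<lambda>_. brick_unit i)"
  unfolding morphism_def points_brick_variety
proof (intro conjI ballI)
  interpret C: brick_charts "{(i, i)}" by unfold_locales (rule singleton_ordinal)
  show "(\<lambda>_. brick_unit i) \<in> points point_variety \<rightarrow> (bricks {(i, i)} :: ('i, 'a) subspaces set)"
    by (simp add: brick_unit_bricks)
  fix x :: unit
  obtain T where T: "T \<in> C.GD.frames" "(brick_unit i :: ('i, 'a) subspaces) \<in> cdom (C.brick_chart T)"
    using C.ex_brick_chart[OF brick_unit_bricks] by blast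
  let ?P = "Chart UNIV {} (\<lambda>_ _. 0) :: (unit, unit, 'a) chart"
  have vars: "cvars (C.brick_chart T :: (('i, 'a) subspaces, _, 'a) chart) = {}"
    unfolding C.brick_chart_simps C.GD.chart_vars_def
    unfolding singleton_ordinal by simp
  have "regular_at k ?P (C.brick_chart T) (\<lambda>_. brick_unit i) x"
    by (rule regular_atI_polyfun[OF k, where p = "\<lambda>_ _. 0"])
      (simp_all only: vars empty_iff T(2) polyfun_0[OF k] chart.sel UNIV_I)
  moreover have "?P \<in> atlas point_variety" by (simp add: point_variety_def)
  moreover have "C.brick_chart T \<in> atlas (brick_variety {(i, i)})"
    using T(1) by (simp add: C.atlas_brick_variety)
  ultimately show "\<exists>C\<in>atlas point_variety. \<exists>D\<in>atlas (brick_variety {(i, i)}).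
      regular_at k C D (\<lambda>_. brick_unit i :: ('i, 'a) subspaces) x"
    by blast
qed

theorem proposition5p1p1:
  fixes k :: "'a::field set"
  assumes "is_subfield k"
  shows "ns_operad_of_varieties k
    (brick_variety :: 'i rel \<Rightarrow>
       (('i, 'a) subspaces, ('i \<times> 'i) \<times> ('i \<times> 'i) \<times> ('i \<times> 'i), 'a) variety)
    brick_act brick_comp brick_unit"
proof (unfold_locales, unfold points_brick_variety, goal_cases)
  case 1 then show ?case by (rule is_variety_brick_variety[OF assms])
next
  case 2 then show ?case by (intro morphism_brick_act[OF assms] relabelling.intro)
next
  case 3 then show ?case by (rule brick_act_cong)
next
  case 4 then show ?case by (rule brick_act_id)
next
  case 5 then show ?case by (rule brick_act_comp)
next
  case 6 then show ?case by (intro morphism_brick_comp[OF assms] insertionI)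
next
  case (7 I J i I' J' \<phi> \<psi> x y)
  have "\<phi> i \<in> Field I'" using 7 by (auto simp: ord_iso_def bij_betw_def)
  then show ?case using 7 by (intro brick_comp_natural insertionI)
next
  case 8 then show ?case by (rule brick_comp_parallel)
next
  case 9 then show ?case by (rule brick_comp_sequential)
next
  case 10 then show ?case by (rule morphism_brick_unit[OF assms])
next
  case 11 then show ?case by (rule brick_unit_natural)
next
  case 12 then show ?case by (rule brick_unit_left)
next
  case 13 then show ?case by (rule brick_unit_right)
qed

end
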